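(* Let $(M^{2m},J,g)$ be a standard Kähler manifold and let $T^{*}M$ be its cotangent bundle equipped with the Berger-type deformed Sasaki metric ${}^{BS}g$ with constant $\delta$. Let $\nabla$ and $R$ be the Levi-Civita connection and curvature tensor of $(M,g)$, and let ${}^{BS}\nabla$ be the Levi-Civita connection of $(T^{*}M,{}^{BS}g)$. Then for all vector fields $X,Y$ on $M$ and all $1$-forms $\omega,\theta$ on $M$, at every point $(x,p)\in T^{*}M$: (i) ${}^{BS}\nabla_{{}^{H}X}{}^{H}Y={}^{H}(\nabla_{X}Y)+\frac12\,{}^{V}(pR(X,Y))$; (ii) ${}^{BS}\nabla_{{}^{H}X}{}^{V}\theta={}^{V}(\nabla_{X}\theta)+\frac12\Big({}^{H}(R(\widetilde p,\widetilde\theta)X)-\delta^{2}g^{-1}(\theta,pJ)\,{}^{H}(R(\widetilde p,J\widetilde p)X)\Big)$; (iii) ${}^{BS}\nabla_{{}^{V}\omega}{}^{H}Y=\frac12\Big({}^{H}(R(\widetilde p,\widetilde\omega)Y)-\delta^{2}g^{-1}(\omega,pJ)\,{}^{H}(R(\widetilde p,J\widetilde p)Y)\Big)$; (iv) ${}^{BS}\nabla_{{}^{V}\omega}{}^{V}\theta=\delta^{2}\big(g^{-1}(\omega,pJ)\,{}^{V}(\theta J)+g^{-1}(\theta,pJ)\,{}^{V}(\omega J)\big)-\frac{\delta^{4}}{\lambda}\big(g^{-1}(\omega,pJ)g^{-1}(\theta,p)+g^{-1}(\omega,p)g^{-1}(\theta,pJ)\big)\,{}^{V}(pJ)$, wh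ere $\lambda=1+\delta^{2}g^{-1}(p,p)$.
   Context: All objects are smooth. A standard Kähler manifold $(M^{2m},J,g)$ is a $2m$-dimensional manifold with an almost complex structure $J$ ($J^2=-I$) and a Riemannian metric $g$ with $g(JX,JY)=g(X,Y)$ such that $\nabla J=0$, where $\nabla$ is the Levi-Civita connection of $g$. The curvature convention is $R(X,Y)Z=\nabla_X\nabla_YZ-\nabla_Y\nabla_XZ-\nabla_{[X,Y]}Z$. For a covector (or $1$-form) $\omega$, $\widetilde\omega$ is the vector (field) with $g(\widetilde\omega,X)=\omega(X)$ for all $X$; $g^{-1}(\omega,\theta)=g(\widetilde\omega,\widetilde\theta)$; $\omega J$ is the covector $(\omega J)(X)=\omega(JX)$; and $pR(X,Y)$ is the covector $Z\mapsto p(R(X,Y)Z)$. In the coordinates $(x^i,p_i)$ on $T^{*}M$ induced by coordinates $(x^i)$ on $M$, with Christoffel symbols $\Gamma^k_{ij}$ of $g$, the horizontal lift of $X=X^i\partial_{x^i}$ is ${}^{H}X=X^{i}\partial_{x^i}+p_{h}\Gamma^{h}_{ij}X^{j}\partial_{p_i}$ and the vertical lift of $\omega=\omega_idx^i$ is ${}^{V}\omega=\omega_i\partial_{p_i}$. In the formulas, $p$ denotes the fibre component of the point $(x,p)\in T^*M$, and expressions such as ${}^{H}(R(\widetilde p,\widetilde\theta)X)$, ${}^{V}(pJ)$ are the horizontal/vertical lifts to $(x,p)$ of the indicated vector/covector at $x$. The Berger-type deformed Sasaki metric ${}^{BS}g$ on $T^{*}M$, with real constant $\delta$, is the Riemannian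 metric defined at $(x,p)$ by ${}^{BS}g({}^{H}X,{}^{H}Y)=g(X,Y)$, ${}^{BS}g({}^{H}X,{}^{V}\theta)=0$, ${}^{BS}g({}^{V}\omega,{}^{V}\theta)=g^{-1}(\omega,\theta)+\delta^{2}g^{-1}(\omega,pJ)\,g^{-1}(\theta,pJ)$. *)

theory Defs
  imports "HOL-Analysis.Analysis"
begin

section \<open>Smooth maps between Euclidean spaces\<close>

text \<open>Used only for open \<open>S\<close>.\<close>

primrec Ck_on ::
  "nat \<Rightarrow> 'e::real_normed_vector set \<Rightarrow> ('e \<Rightarrow> 'f::real_normed_vector) \<Rightarrow> bool" where
  "Ck_on 0 S f \<longleftrightarrow> continuous_on S f"
| "Ck_on (Suc k) S f \<longleftrightarrow>
     f differentiable_on S \<and> (\<forall>v. Ck_on k S (\<lambda>u. frechet_derivative f (at u) v))"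

definition smooth_on ::
  "'e::real_normed_vector set \<Rightarrow> ('e \<Rightarrow> 'f::real_normed_vector) \<Rightarrow> bool" where
  "smooth_on S f \<longleftrightarrow> (\<forall>k. Ck_on k S f)"

section \<open>Manifolds\<close>

type_synonym ('a, 'e) chart = "'a set \<times> ('a \<Rightarrow> 'e)"

text \<open>
  A manifold modelled on the Euclidean space \<open>'e\<close> is given by an atlas on a set of points;
  its topology is the one induced by the atlas.  As part of the data there is an arbitrary choice,
  for each point \<open>x\<close>, of a chart \<open>chart_at M x\<close> of the atlas around \<open>x\<close>.  Its only purpose is to
  make tangent vectors concrete: a vector \<open>v\<close> of \<open>T\<^sub>xM\<close> is represented by its component vector
  \<open>v :: 'e\<close> in the chart \<open>chart_at M x\<close>, so that every \<open>T\<^sub>xM\<close> is a copy of \<open>'e\<close>.  Components in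
  the other charts are obtained by the transformation law (\<open>tcomp\<close> and its inverse \<open>tvec\<close> below).
  A covector at \<open>x\<close> is then a linear functional \<open>'e \<Rightarrow> real\<close>.
\<close>

record ('a, 'e) manifold =
  atlas :: "('a, 'e) chart set"
  chart_at :: "'a \<Rightarrow> ('a, 'e) chart"

abbreviation dom_of :: "('a, 'e) chart \<Rightarrow> 'a set" where
  "dom_of c \<equiv> fst c"

abbreviation coords :: "('a, 'e) chart \<Rightarrow> 'a \<Rightarrow> 'e" where
  "coords c \<equiv> snd c"

definition chart_inv :: "('a, 'e) chart \<Rightarrow> 'e \<Rightarrow> 'a" where
  "chart_inv c = inv_into (dom_of c) (coords c)"

definition transition :: "('a, 'e) chart \<Rightarrow> ('a, 'e) chart \<Rightarrow> 'e \<Rightarrow> 'e" where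
  "transition c d = coords d \<circ> chart_inv c"

definition points :: "('a, 'e) manifold \<Rightarrow> 'a set" where
  "points M = \<Union> (dom_of ` atlas M)"

definition open_in_mfd :: "('a, 'e::euclidean_space) manifold \<Rightarrow> 'a set \<Rightarrow> bool" where
  "open_in_mfd M U \<longleftrightarrow> U \<subseteq> points M \<and> (\<forall>c\<in>atlas M. open (coords c ` (U \<inter> dom_of c)))"

definition smooth_manifold :: "('a, 'e::euclidean_space) manifold \<Rightarrow> bool" where
  "smooth_manifold M \<longleftrightarrow>
     (\<forall>c\<in>atlas M. inj_on (coords c) (dom_of c) \<and> open (coords c ` dom_of c)) \<and>
     (\<forall>c\<in>atlas M. \<forall>d\<in>atlas M.
        open (coords c ` (dom_of c \<inter> dom_of d)) \<and>
        smooth_on (coords c ` (dom_of c \<inter> dom_of d)) (transition c d)) \<and>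
     (\<forall>x\<in>points M. chart_at M x \<in> atlas M \<and> x \<in> dom_of (chart_at M x)) \<and>
     Hausdorff_space (topology (open_in_mfd M)) \<and>
     second_countable (topology (open_in_mfd M))"

text \<open>
  \<open>tcomp M c x v\<close>: components in the chart \<open>c\<close> of the tangent vector \<open>v\<close> at \<open>x\<close>;
  \<open>tvec M c x w\<close>: the tangent vector at \<open>x\<close> with components \<open>w\<close> in the chart \<open>c\<close>.
  In particular, \<open>tvec M c x b\<close> with \<open>b \<in> Basis\<close> is a coordinate vector of \<open>c\<close> at \<open>x\<close>.
\<close>

definition tcomp ::
  "('a, 'e::euclidean_space) manifold \<Rightarrow> ('a, 'e) chart \<Rightarrow> 'a \<Rightarrow> 'e \<Rightarrow> 'e" where
  "tcomp M c x =
     frechet_derivative (transition (chart_at M x) c) (at (coords (chart_at M x) x))"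

definition tvec ::
  "('a, 'e::euclidean_space) manifold \<Rightarrow> ('a, 'e) chart \<Rightarrow> 'a \<Rightarrow> 'e \<Rightarrow> 'e" where
  "tvec M c x = frechet_derivative (transition c (chart_at M x)) (at (coords c x))"

section \<open>Tensor fields\<close>

text \<open>
  Fields are functions on the whole type \<open>'a\<close>; only their values on the open set \<open>U\<close> under
  consideration matter.
\<close>

definition smooth_fun_on ::
  "('a, 'e::euclidean_space) manifold \<Rightarrow> 'a set \<Rightarrow> ('a \<Rightarrow> real) \<Rightarrow> bool" where
  "smooth_fun_on M U f \<longleftrightarrow>
     (\<forall>c\<in>atlas M. smooth_on (coords c ` (U \<inter> dom_of c)) (f \<circ> chart_inv c))"

definition vfield_rep ::
  "('a, 'e::euclidean_space) manifold \<Rightarrow> ('a, 'e) chart \<Rightarrow> ('a \<Rightarrow> 'e) \<Rightarrow> 'e \<Rightarrow> 'e" where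
  "vfield_rep M c X = (\<lambda>u. tcomp M c (chart_inv c u) (X (chart_inv c u)))"

definition smooth_vfield_on ::
  "('a, 'e::euclidean_space) manifold \<Rightarrow> 'a set \<Rightarrow> ('a \<Rightarrow> 'e) \<Rightarrow> bool" where
  "smooth_vfield_on M U X \<longleftrightarrow>
     (\<forall>c\<in>atlas M. smooth_on (coords c ` (U \<inter> dom_of c)) (vfield_rep M c X))"

definition smooth_form_on ::
  "('a, 'e::euclidean_space) manifold \<Rightarrow> 'a set \<Rightarrow> ('a \<Rightarrow> 'e \<Rightarrow> real) \<Rightarrow> bool" where
  "smooth_form_on M U \<omega> \<longleftrightarrow>
     (\<forall>x\<in>U. linear (\<omega> x)) \<and>
     (\<forall>c\<in>atlas M. \<forall>b\<in>Basis. smooth_on (coords c ` (U \<inter> dom_of c))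
        (\<lambda>u. \<omega> (chart_inv c u) (tvec M c (chart_inv c u) b)))"

definition riemannian_metric ::
  "('a, 'e::euclidean_space) manifold \<Rightarrow> ('a \<Rightarrow> 'e \<Rightarrow> 'e \<Rightarrow> real) \<Rightarrow> bool" where
  "riemannian_metric M g \<longleftrightarrow>
     (\<forall>x\<in>points M. bilinear (g x) \<and> (\<forall>v w. g x v w = g x w v) \<and> (\<forall>v. v \<noteq> 0 \<longrightarrow> g x v v > 0)) \<and>
     (\<forall>c\<in>atlas M. \<forall>a\<in>Basis. \<forall>b\<in>Basis. smooth_on (coords c ` dom_of c)
        (\<lambda>u. g (chart_inv c u) (tvec M c (chart_inv c u) a) (tvec M c (chart_inv c u) b)))"

definition almost_complex_structure ::
  "('a, 'e::euclidean_space) manifold \<Rightarrow> ('a \<Rightarrow> 'e \<Rightarrow> 'e) \<Rightarrow> bool" where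
  "almost_complex_structure M J \<longleftrightarrow>
     (\<forall>x\<in>points M. linear (J x) \<and> (\<forall>v. J x (J x v) = - v)) \<and>
     (\<forall>c\<in>atlas M. \<forall>b\<in>Basis. smooth_on (coords c ` dom_of c)
        (\<lambda>u. tcomp M c (chart_inv c u) (J (chart_inv c u) (tvec M c (chart_inv c u) b))))"

definition dir_deriv ::
  "('a, 'e::euclidean_space) manifold \<Rightarrow> 'a \<Rightarrow> 'e \<Rightarrow> ('a \<Rightarrow> real) \<Rightarrow> real" where
  "dir_deriv M x v f =
     frechet_derivative (f \<circ> chart_inv (chart_at M x)) (at (coords (chart_at M x) x)) v"

text \<open>\<open>[X,Y]\<^sup>i = X\<^sup>j \<partial>\<^sub>j Y\<^sup>i - Y\<^sup>j \<partial>\<^sub>j X\<^sup>i\<close>, in the coordinates of \<open>chart_at M x\<close>.\<close>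

definition lie_bracket ::
  "('a, 'e::euclidean_space) manifold \<Rightarrow> ('a \<Rightarrow> 'e) \<Rightarrow> ('a \<Rightarrow> 'e) \<Rightarrow> 'a \<Rightarrow> 'e" where
  "lie_bracket M X Y x =
     (let c = chart_at M x in
        frechet_derivative (vfield_rep M c Y) (at (coords c x)) (X x) -
        frechet_derivative (vfield_rep M c X) (at (coords c x)) (Y x))"

section \<open>The Levi-Civita connection\<close>

text \<open>
  A connection acts on the vector fields on every open subset \<open>U\<close>, not only on those on the whole
  manifold.  Since \<open>D\<close> does not take \<open>U\<close> as an argument, the action is compatible with restriction:
  at points of \<open>U\<close>, the axioms for \<open>U\<close> force \<open>D X Y\<close> to depend only on the restrictions of
  \<open>X\<close> and \<open>Y\<close> to \<open>U\<close> (take for \<open>f\<close> the indicator function of the complement of \<open>U\<close>).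
\<close>

definition affine_connection ::
  "('a, 'e::euclidean_space) manifold \<Rightarrow> (('a \<Rightarrow> 'e) \<Rightarrow> ('a \<Rightarrow> 'e) \<Rightarrow> 'a \<Rightarrow> 'e) \<Rightarrow> bool" where
  "affine_connection M D \<longleftrightarrow>
     (\<forall>U X Y Z f.
        open_in_mfd M U \<and> smooth_vfield_on M U X \<and> smooth_vfield_on M U Y \<and>
        smooth_vfield_on M U Z \<and> smooth_fun_on M U f \<longrightarrow>
        smooth_vfield_on M U (D X Y) \<and>
        (\<forall>x\<in>U.
           D (\<lambda>y. X y + Y y) Z x = D X Z x + D Y Z x \<and>
           D (\<lambda>y. f y *\<^sub>R X y) Z x = f x *\<^sub>R D X Z x \<and>
           D X (\<lambda>y. Y y + Z y) x = D X Y x + D X Z x \<and>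
           D X (\<lambda>y. f y *\<^sub>R Y y) x = dir_deriv M x (X x) f *\<^sub>R Y x + f x *\<^sub>R D X Y x))"

definition torsion_free ::
  "('a, 'e::euclidean_space) manifold \<Rightarrow> (('a \<Rightarrow> 'e) \<Rightarrow> ('a \<Rightarrow> 'e) \<Rightarrow> 'a \<Rightarrow> 'e) \<Rightarrow> bool" where
  "torsion_free M D \<longleftrightarrow>
     (\<forall>U X Y. open_in_mfd M U \<and> smooth_vfield_on M U X \<and> smooth_vfield_on M U Y \<longrightarrow>
        (\<forall>x\<in>U. D X Y x - D Y X x = lie_bracket M X Y x))"

definition metric_compatible ::
  "('a, 'e::euclidean_space) manifold \<Rightarrow> ('a \<Rightarrow> 'e \<Rightarrow> 'e \<Rightarrow> real) \<Rightarrow>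
     (('a \<Rightarrow> 'e) \<Rightarrow> ('a \<Rightarrow> 'e) \<Rightarrow> 'a \<Rightarrow> 'e) \<Rightarrow> bool" where
  "metric_compatible M g D \<longleftrightarrow>
     (\<forall>U X Y Z. open_in_mfd M U \<and> smooth_vfield_on M U X \<and> smooth_vfield_on M U Y \<and>
        smooth_vfield_on M U Z \<longrightarrow>
        (\<forall>x\<in>U. dir_deriv M x (X x) (\<lambda>y. g y (Y y) (Z y)) =
           g x (D X Y x) (Z x) + g x (Y x) (D X Z x)))"

definition levi_civita_connection ::
  "('a, 'e::euclidean_space) manifold \<Rightarrow> ('a \<Rightarrow> 'e \<Rightarrow> 'e \<Rightarrow> real) \<Rightarrow>
     (('a \<Rightarrow> 'e) \<Rightarrow> ('a \<Rightarrow> 'e) \<Rightarrow> 'a \<Rightarrow> 'e) \<Rightarrow> bool" where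
  "levi_civita_connection M g D \<longleftrightarrow>
     affine_connection M D \<and> torsion_free M D \<and> metric_compatible M g D"

definition parallel_endomorphism ::
  "('a, 'e::euclidean_space) manifold \<Rightarrow> (('a \<Rightarrow> 'e) \<Rightarrow> ('a \<Rightarrow> 'e) \<Rightarrow> 'a \<Rightarrow> 'e) \<Rightarrow>
     ('a \<Rightarrow> 'e \<Rightarrow> 'e) \<Rightarrow> bool" where
  "parallel_endomorphism M D J \<longleftrightarrow>
     (\<forall>U X Y. open_in_mfd M U \<and> smooth_vfield_on M U X \<and> smooth_vfield_on M U Y \<longrightarrow>
        (\<forall>x\<in>U. D X (\<lambda>y. J y (Y y)) x = J x (D X Y x)))"

definition standard_kaehler ::
  "('a, 'e::euclidean_space) manifold \<Rightarrow> ('a \<Rightarrow> 'e \<Rightarrow> 'e) \<Rightarrow> ('a \<Rightarrow> 'e \<Rightarrow> 'e \<Rightarrow> real) \<Rightarrow>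
     (('a \<Rightarrow> 'e) \<Rightarrow> ('a \<Rightarrow> 'e) \<Rightarrow> 'a \<Rightarrow> 'e) \<Rightarrow> bool" where
  "standard_kaehler M J g D \<longleftrightarrow>
     smooth_manifold M \<and> almost_complex_structure M J \<and> riemannian_metric M g \<and>
     (\<forall>x\<in>points M. \<forall>v w. g x (J x v) (J x w) = g x v w) \<and>
     levi_civita_connection M g D \<and> parallel_endomorphism M D J"

section \<open>Curvature and derivatives of 1-forms\<close>

text \<open>
  The vector field, defined on the domain of \<open>chart_at M x\<close>, with constant components \<open>v\<close> in that
  chart.  It extends \<open>v \<in> T\<^sub>xM\<close>, and is the coordinate field \<open>\<partial>\<^sub>b\<close> if \<open>v = b \<in> Basis\<close>.
\<close>

definition extension ::
  "('a, 'e::euclidean_space) manifold \<Rightarrow> 'a \<Rightarrow> 'e \<Rightarrow> 'a \<Rightarrow> 'e" where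
  "extension M x v = (\<lambda>y. tvec M (chart_at M x) y v)"

definition curvature_op ::
  "('a, 'e::euclidean_space) manifold \<Rightarrow> (('a \<Rightarrow> 'e) \<Rightarrow> ('a \<Rightarrow> 'e) \<Rightarrow> 'a \<Rightarrow> 'e) \<Rightarrow>
     ('a \<Rightarrow> 'e) \<Rightarrow> ('a \<Rightarrow> 'e) \<Rightarrow> ('a \<Rightarrow> 'e) \<Rightarrow> 'a \<Rightarrow> 'e" where
  "curvature_op M D X Y Z x =
     D X (D Y Z) x - D Y (D X Z) x - D (lie_bracket M X Y) Z x"

text \<open>
  The value of the curvature tensor on tangent vectors at \<open>x\<close>, computed (as it may be with any
  extension, by tensoriality) with the extensions above.  The same applies to \<open>D\<^sub>X \<theta>\<close>.
\<close>

definition curvature ::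
  "('a, 'e::euclidean_space) manifold \<Rightarrow> (('a \<Rightarrow> 'e) \<Rightarrow> ('a \<Rightarrow> 'e) \<Rightarrow> 'a \<Rightarrow> 'e) \<Rightarrow>
     'a \<Rightarrow> 'e \<Rightarrow> 'e \<Rightarrow> 'e \<Rightarrow> 'e" where
  "curvature M D x u v w =
     curvature_op M D (extension M x u) (extension M x v) (extension M x w) x"

definition form_deriv ::
  "('a, 'e::euclidean_space) manifold \<Rightarrow> (('a \<Rightarrow> 'e) \<Rightarrow> ('a \<Rightarrow> 'e) \<Rightarrow> 'a \<Rightarrow> 'e) \<Rightarrow>
     ('a \<Rightarrow> 'e) \<Rightarrow> ('a \<Rightarrow> 'e \<Rightarrow> real) \<Rightarrow> 'a \<Rightarrow> 'e \<Rightarrow> real" where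
  "form_deriv M D X \<theta> x w =
     dir_deriv M x (X x) (\<lambda>y. \<theta> y (extension M x w y)) - \<theta> x (D X (extension M x w) x)"

text \<open>The Christoffel symbol \<open>\<Gamma>\<^sup>k\<^sub>i\<^sub>j\<close> at \<open>x\<close> of the chart \<open>chart_at M x\<close>, for \<open>i, j, k \<in> Basis\<close>.\<close>

definition christoffel ::
  "('a, 'e::euclidean_space) manifold \<Rightarrow> (('a \<Rightarrow> 'e) \<Rightarrow> ('a \<Rightarrow> 'e) \<Rightarrow> 'a \<Rightarrow> 'e) \<Rightarrow>
     'a \<Rightarrow> 'e \<Rightarrow> 'e \<Rightarrow> 'e \<Rightarrow> real" where
  "christoffel M D x k i j = D (extension M x i) (extension M x j) x \<bullet> k"

definition sharp ::
  "('a \<Rightarrow> 'e \<Rightarrow> 'e \<Rightarrow> real) \<Rightarrow> 'a \<Rightarrow> ('e \<Rightarrow> real) \<Rightarrow> 'e" where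
  "sharp g x \<omega> = (THE v. \<forall>w. g x v w = \<omega> w)"

definition ginv ::
  "('a \<Rightarrow> 'e \<Rightarrow> 'e \<Rightarrow> real) \<Rightarrow> 'a \<Rightarrow> ('e \<Rightarrow> real) \<Rightarrow> ('e \<Rightarrow> real) \<Rightarrow> real" where
  "ginv g x \<omega> \<theta> = g x (sharp g x \<omega>) (sharp g x \<theta>)"

section \<open>The cotangent bundle\<close>

text \<open>
  A point of the cotangent bundle is a pair \<open>(x, p)\<close> with \<open>p\<close> linear.  The chart induced by \<open>c\<close> has
  the coordinates \<open>(x\<^sup>i, p\<^sub>i)\<close>, the vector \<open>(p\<^sub>i)\<close> being encoded as an element of \<open>'e\<close>.
\<close>

definition cotangent_chart ::
  "('a, 'e::euclidean_space) manifold \<Rightarrow> ('a, 'e) chart \<Rightarrow>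
     ('a \<times> ('e \<Rightarrow> real), 'e \<times> 'e) chart" where
  "cotangent_chart M c =
     ({(x, p). x \<in> dom_of c \<and> linear p},
      \<lambda>(x, p). (coords c x, \<Sum>i\<in>Basis. p (tvec M c x i) *\<^sub>R i))"

definition cotangent_bundle ::
  "('a, 'e::euclidean_space) manifold \<Rightarrow> ('a \<times> ('e \<Rightarrow> real), 'e \<times> 'e) manifold" where
  "cotangent_bundle M =
     \<lparr>atlas = cotangent_chart M ` atlas M,
      chart_at = (\<lambda>(x, p). cotangent_chart M (chart_at M x))\<rparr>"

text \<open>
  Lifts to the point \<open>(x, p)\<close> of a vector \<open>v\<close> and of a covector \<open>\<omega>\<close> at \<open>x\<close>.  Tangent vectors at
  \<open>(x, p)\<close> are represented by their components in the chart induced by \<open>chart_at M x\<close>, for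
  which \<open>\<partial>\<^sub>i\<close> at \<open>x\<close> is \<open>i \<in> Basis\<close>; hence \<open>p\<^sub>h = p h\<close>, \<open>\<omega>\<^sub>i = \<omega> i\<close> and \<open>v\<^sup>j = v \<bullet> j\<close>.
\<close>

definition hlift ::
  "('a, 'e::euclidean_space) manifold \<Rightarrow> (('a \<Rightarrow> 'e) \<Rightarrow> ('a \<Rightarrow> 'e) \<Rightarrow> 'a \<Rightarrow> 'e) \<Rightarrow>
     'a \<times> ('e \<Rightarrow> real) \<Rightarrow> 'e \<Rightarrow> 'e \<times> 'e" where
  "hlift M D = (\<lambda>(x, p) v.
     (v, \<Sum>i\<in>Basis. (\<Sum>h\<in>Basis. \<Sum>j\<in>Basis. p h * christoffel M D x h i j * (v \<bullet> j)) *\<^sub>R i))"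

definition vlift :: "('e::euclidean_space \<Rightarrow> real) \<Rightarrow> 'e \<times> 'e" where
  "vlift \<omega> = (0, \<Sum>i\<in>Basis. \<omega> i *\<^sub>R i)"

definition hlift_field ::
  "('a, 'e::euclidean_space) manifold \<Rightarrow> (('a \<Rightarrow> 'e) \<Rightarrow> ('a \<Rightarrow> 'e) \<Rightarrow> 'a \<Rightarrow> 'e) \<Rightarrow>
     ('a \<Rightarrow> 'e) \<Rightarrow> 'a \<times> ('e \<Rightarrow> real) \<Rightarrow> 'e \<times> 'e" where
  "hlift_field M D X = (\<lambda>(x, p). hlift M D (x, p) (X x))"

definition vlift_field ::
  "('a \<Rightarrow> 'e::euclidean_space \<Rightarrow> real) \<Rightarrow> 'a \<times> ('e \<Rightarrow> real) \<Rightarrow> 'e \<times> 'e" where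
  "vlift_field \<omega> = (\<lambda>(x, p). vlift (\<omega> x))"

section \<open>The Berger-type deformed Sasaki metric\<close>

text \<open>
  Every tangent vector \<open>\<xi>\<close> at \<open>P = (x, p)\<close> is uniquely the sum of the horizontal lift of \<open>fst \<xi>\<close> and
  the vertical lift of the covector \<open>vert_part M D P \<xi>\<close> (\<open>hlift_vlift_decomp\<close>).
\<close>

definition vert_part ::
  "('a, 'e::euclidean_space) manifold \<Rightarrow> (('a \<Rightarrow> 'e) \<Rightarrow> ('a \<Rightarrow> 'e) \<Rightarrow> 'a \<Rightarrow> 'e) \<Rightarrow>
     'a \<times> ('e \<Rightarrow> real) \<Rightarrow> 'e \<times> 'e \<Rightarrow> 'e \<Rightarrow> real" where
  "vert_part M D P \<xi> = (\<lambda>w. (snd \<xi> - snd (hlift M D P (fst \<xi>))) \<bullet> w)"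

definition berger_sasaki ::
  "('a, 'e::euclidean_space) manifold \<Rightarrow> ('a \<Rightarrow> 'e \<Rightarrow> 'e) \<Rightarrow> ('a \<Rightarrow> 'e \<Rightarrow> 'e \<Rightarrow> real) \<Rightarrow>
     (('a \<Rightarrow> 'e) \<Rightarrow> ('a \<Rightarrow> 'e) \<Rightarrow> 'a \<Rightarrow> 'e) \<Rightarrow> real \<Rightarrow>
     'a \<times> ('e \<Rightarrow> real) \<Rightarrow> 'e \<times> 'e \<Rightarrow> 'e \<times> 'e \<Rightarrow> real" where
  "berger_sasaki M J g D \<delta> = (\<lambda>(x, p) \<xi> \<eta>.
     let \<omega> = vert_part M D (x, p) \<xi>; \<theta> = vert_part M D (x, p) \<eta>; pJ = p \<circ> J x in
       g x (fst \<xi>) (fst \<eta>) + ginv g x \<omega> \<theta> + \<delta>\<^sup>2 * ginv g x \<omega> pJ * ginv g x \<theta> pJ)"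

lemma vert_part_hlift: "vert_part M D P (hlift M D P v) = (\<lambda>w. 0)"
  by (cases P) (simp add: vert_part_def hlift_def)

lemma vert_part_vlift:
  assumes "linear \<omega>"
  shows "vert_part M D P (vlift \<omega>) = \<omega>"
proof
  fix w
  have "\<omega> w = \<omega> (\<Sum>i\<in>Basis. (w \<bullet> i) *\<^sub>R i)"
    by (simp add: euclidean_representation)
  also have "\<dots> = (\<Sum>i\<in>Basis. (w \<bullet> i) * \<omega> i)"
    using assms by (simp add: linear_sum linear_scale o_def)
  finally show "vert_part M D P (vlift \<omega>) w = \<omega> w"
    by (cases P) (simp add: vert_part_def vlift_def hlift_def inner_sum_left
      inner_commute[of w] mult.commute)
qed

lemma hlift_vlift_decomp:
  fixes \<xi> :: "'e::euclidean_space \<times> 'e"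
  shows "\<xi> = hlift M D P (fst \<xi>) + vlift (vert_part M D P \<xi>)"
proof -
  have "(\<Sum>i\<in>Basis. (a \<bullet> i) *\<^sub>R i) = a" for a :: 'e
    by (rule euclidean_representation)
  then show ?thesis
    by (simp add: vert_part_def vlift_def prod_eq_iff hlift_def split_beta del: inner_diff_left)
qed

lemma sharp_zero:
  assumes "riemannian_metric M g" and "x \<in> points M"
  shows "sharp g x (\<lambda>w. 0) = 0"
proof -
  have g: "bilinear (g x)" "\<And>v. v \<noteq> 0 \<Longrightarrow> g x v v > 0"
    using assms by (auto simp: riemannian_metric_def)
  show ?thesis
    unfolding sharp_def
  proof (rule the_equality)
    show "\<forall>w. g x 0 w = 0"
      using g(1) by (simp add: bilinear_lzero)
    show "v = 0" if "\<forall>w. g x v w = 0" for v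
      using g(2)[of v] that by force
  qed
qed

text \<open>The three equations by which the Berger-type deformed Sasaki metric is defined.\<close>

lemma berger_sasaki_lifts:
  assumes "riemannian_metric M g" and "x \<in> points M" and "linear \<omega>" and "linear \<theta>"
  shows "berger_sasaki M J g D \<delta> (x, p) (hlift M D (x, p) v) (hlift M D (x, p) w) = g x v w"
    and "berger_sasaki M J g D \<delta> (x, p) (hlift M D (x, p) v) (vlift \<theta>) = 0"
    and "berger_sasaki M J g D \<delta> (x, p) (vlift \<omega>) (vlift \<theta>) =
           ginv g x \<omega> \<theta> + \<delta>\<^sup>2 * ginv g x \<omega> (p \<circ> J x) * ginv g x \<theta> (p \<circ> J x)"
proof -
  have bil: "bilinear (g x)"
    using assms by (simp add: riemannian_metric_def)
  have fst_lifts: "fst (hlift M D (x, p) u) = u" "fst (vlift \<alpha>) = 0" for u \<alpha>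
    by (simp_all add: hlift_def vlift_def)
  have ginv0: "ginv g x (\<lambda>w. 0) \<alpha> = 0" for \<alpha>
    by (simp add: ginv_def sharp_zero[OF assms(1,2)] bilinear_lzero[OF bil])
  note lift_simps = berger_sasaki_def Let_def vert_part_hlift vert_part_vlift assms(3,4) fst_lifts
    ginv0 bilinear_lzero[OF bil] bilinear_rzero[OF bil]
  show "berger_sasaki M J g D \<delta> (x, p) (hlift M D (x, p) v) (hlift M D (x, p) w) = g x v w"
    and "berger_sasaki M J g D \<delta> (x, p) (hlift M D (x, p) v) (vlift \<theta>) = 0"
    and "berger_sasaki M J g D \<delta> (x, p) (vlift \<omega>) (vlift \<theta>) =
           ginv g x \<omega> \<theta> + \<delta>\<^sup>2 * ginv g x \<omega> (p \<circ> J x) * ginv g x \<theta> (p \<circ> J x)"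
    by (simp_all add: lift_simps)
qed

end

theory Submission
  imports Defs
begin

text \<open>
  The Koszul formula determines \<open>\<nabla>\<^sub>A B\<close> at \<open>(x, p)\<close> from its inner products with horizontal lifts
  of coordinate fields and vertical lifts of constant covectors.  For lifted fields the terms of that
  formula are
  \<open>[HX, HY] = H[X, Y] + V(pR(X, Y))\<close>, \<open>[HX, V\<theta>] = V(\<nabla>\<^sub>X \<theta>)\<close>, \<open>[V\<omega>, V\<theta>] = 0\<close>,
  the vanishing of \<open>HX\<close> on the metric beyond the Leibniz terms (\<open>p\<close>, \<open>g\<close> and \<open>J\<close> are parallel along
  horizontal curves), and the derivative of \<open>g\<inverse>(\<omega>, pJ)\<close> along \<open>V\<zeta>\<close>, which is \<open>g\<inverse>(\<omega>, \<zeta>J)\<close>.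
  The curvature terms are moved to the required arguments by pair symmetry, and the last formula
  follows because \<open>V(pJ)\<close> is an eigenvector of the deformed vertical metric relative to the
  undeformed one, with eigenvalue \<open>\<lambda>\<close>.
\<close>

section \<open>Calculus of smooth maps\<close>

text \<open>Tangent spaces at different points are identified with \<open>'e\<close> through
  unrelated charts \<open>chart_at M y\<close>, so nothing may be differentiated before it is
  rewritten in one fixed chart. The final computation uses the chart chosen at \<open>x\<close>,
  where this rewriting is trivial at \<open>x\<close>, and works over its domain only; the axioms of
  a connection hold on every open set, which makes this legitimate. Two constants need an
  explanation. Raising the index of pJ gives minus J of the raised p; this is the minus sign before
  delta^2 in the mixed formulas. In the last formula, Koszul yields delta^2 times the undeformed
  dual of g^{-1}(omega,pJ) thetaJ + g^{-1}(theta,pJ) omegaJ. The deformed pairing with thetaJ has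
  the additional term delta^2 g^{-1}(thetaJ,pJ) g^{-1}(.,pJ), and g^{-1}(thetaJ,pJ) =
  g^{-1}(theta,p) because J is an isometry. This excess is proportional to the functional
  g^{-1}(.,pJ), which is the deformed dual of pJ divided by lambda; hence the factor delta^2 *
  delta^2 / lambda.\<close>

lemma has_derivative_frechet:
  assumes "f differentiable_on S" "open S" "u \<in> S"
  shows "(f has_derivative frechet_derivative f (at u)) (at u)"
  using assms frechet_derivative_works differentiable_on_eq_differentiable_at by blast

lemma frechet_derivativeI: "(f has_derivative f') (at u) \<Longrightarrow> frechet_derivative f (at u) = f'"
  using frechet_derivative_at by metis

lemma differentiable_on_openI:
  assumes "\<And>u. u \<in> S \<Longrightarrow> (f has_derivative f' u) (at u)"
  shows "f differentiable_on S"
  using assms unfolding differentiable_on_def differentiable_def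
  by (meson has_derivative_at_withinI)

section \<open>Closure properties of C^k and smooth maps on open sets\<close>

lemma Ck_on_cong:
  assumes "open S" "\<And>u. u \<in> S \<Longrightarrow> f u = g u" "Ck_on k S f"
  shows "Ck_on k S g"
  using assms(2,3)
proof (induction k arbitrary: f g)
  case 0
  then show ?case by (metis Ck_on.simps(1) continuous_on_cong)
next
  case (Suc k)
  have g: "(g has_derivative frechet_derivative f (at u)) (at u)" if "u \<in> S" for u
    using has_derivative_transform_within_open[OF has_derivative_frechet[OF _ assms(1) that] assms(1) that]
      Suc.prems by (metis Ck_on.simps(2))
  have "Ck_on k S (\<lambda>u. frechet_derivative g (at u) v)" for v
    by (rule Suc.IH[of "\<lambda>u. frechet_derivative f (at u) v"]) (use Suc.prems frechet_derivativeI[OF g] in auto)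
  with differentiable_on_openI[OF g] show ?case by simp
qed

text \<open>\<open>Ck_on\<close> is phrased with the chosen \<open>frechet_derivative\<close>; this
  rule accepts any explicit formula for the derivative, so the product and chain rules can feed the
  inductions below.\<close>

lemma Ck_on_SucI:
  assumes "open S" "\<And>u. u \<in> S \<Longrightarrow> (f has_derivative f' u) (at u)"
    and "\<And>v. Ck_on k S (\<lambda>u. f' u v)"
  shows "Ck_on (Suc k) S f"
proof -
  have "Ck_on k S (\<lambda>u. frechet_derivative f (at u) v)" for v
    by (rule Ck_on_cong[OF assms(1) _ assms(3)[of v]]) (simp add: frechet_derivativeI[OF assms(2)])
  with differentiable_on_openI[OF assms(2)] show ?thesis by simp
qed

lemma Ck_on_SucD: "Ck_on (Suc k) S f \<Longrightarrow> Ck_on k S f"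
  by (induction k arbitrary: f) (auto intro: differentiable_imp_continuous_on)

lemma Ck_on_subset: "Ck_on k S f \<Longrightarrow> T \<subseteq> S \<Longrightarrow> Ck_on k T f"
  by (induction k arbitrary: f) (auto intro: continuous_on_subset differentiable_on_subset)

lemma Ck_on_const: "open S \<Longrightarrow> Ck_on k S (\<lambda>u. a)"
  by (induction k arbitrary: a) (auto intro!: Ck_on_SucI derivative_intros continuous_intros)

lemma Ck_on_linear:
  assumes "open S" "bounded_linear L" "Ck_on k S f"
  shows "Ck_on k S (\<lambda>u. L (f u))"
  using assms(3)
proof (induction k arbitrary: f)
  case 0
  then show ?case using assms(2) by (simp add: bounded_linear.continuous_on)
next
  case (Suc k)
  show ?case
  proof (rule Ck_on_SucI[OF assms(1)])
    show "((\<lambda>u. L (f u)) has_derivative (\<lambda>v. L (frechet_derivative f (at u) v))) (at u)" if "u \<in> S" for u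
      using has_derivative_frechet[OF _ assms(1) that] Suc.prems
      by (auto intro: bounded_linear.has_derivative[OF assms(2)])
  qed (use Suc in auto)
qed

lemma Ck_on_add:
  assumes "open S" "Ck_on k S f" "Ck_on k S g"
  shows "Ck_on k S (\<lambda>u. f u + g u)"
  using assms(2,3)
proof (induction k arbitrary: f g)
  case 0
  then show ?case by (auto intro: continuous_intros)
next
  case (Suc k)
  show ?case
  proof (rule Ck_on_SucI[OF assms(1)])
    show "((\<lambda>u. f u + g u) has_derivative (\<lambda>v. frechet_derivative f (at u) v + frechet_derivative g (at u) v)) (at u)" if "u \<in> S" for u
      using has_derivative_frechet[OF _ assms(1) that] Suc.prems
      by (auto intro: derivative_intros)
  qed (use Suc in auto)
qed

lemma Ck_on_bilinear:
  assumes "open S" "bounded_bilinear B" "Ck_on k S f" "Ck_on k S g"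
  shows "Ck_on k S (\<lambda>u. B (f u) (g u))"
  using assms(3,4)
proof (induction k arbitrary: f g)
  case 0
  then show ?case using assms(2) by (simp add: bounded_bilinear.continuous_on)
next
  case (Suc k)
  show ?case
  proof (rule Ck_on_SucI[OF assms(1)])
    show "((\<lambda>u. B (f u) (g u)) has_derivative (\<lambda>v. B (f u) (frechet_derivative g (at u) v)
       + B (frechet_derivative f (at u) v) (g u))) (at u)" if "u \<in> S" for u
      using has_derivative_frechet[of f, OF _ assms(1) that] has_derivative_frechet[of g, OF _ assms(1) that] Suc.prems
      by (intro bounded_bilinear.FDERIV[OF assms(2)]) auto
    \<comment> \<open>Each summand of the product rule keeps one undifferentiated factor, which is
      of order \<open>Suc k\<close> and has to be lowered to \<open>k\<close> before the induction
      hypothesis applies.\<close>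
    show "Ck_on k S (\<lambda>u. B (f u) (frechet_derivative g (at u) v)
       + B (frechet_derivative f (at u) v) (g u))" for v
      using Suc.prems Ck_on_SucD[OF Suc.prems(1)] Ck_on_SucD[OF Suc.prems(2)]
      by (intro Ck_on_add[OF assms(1)] Suc.IH) auto
  qed
qed

lemma Ck_on_sum:
  assumes "open S" "\<And>i. i \<in> I \<Longrightarrow> Ck_on k S (f i)"
  shows "Ck_on k S (\<lambda>u. \<Sum>i\<in>I. f i u)"
  using assms(2)
  by (induction I rule: infinite_finite_induct) (auto intro: Ck_on_const Ck_on_add assms(1))

lemma linear_euclidean_expand:
  fixes w :: "'e::euclidean_space"
  assumes "linear L"
  shows "L w = (\<Sum>b\<in>Basis. (w \<bullet> b) *\<^sub>R L b)"
  by (metis (no_types, lifting) assms euclidean_representation linear_scale linear_sum sum.cong)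

lemma Ck_on_compose:
  fixes f :: "'d::real_normed_vector \<Rightarrow> 'e::euclidean_space"
  assumes "open S" "open T" "f ` S \<subseteq> T" "Ck_on k S f" "Ck_on k T g"
  shows "Ck_on k S (\<lambda>u. g (f u))"
  using assms(4,5)
proof (induction k arbitrary: g)
  case 0
  then show ?case using assms(3) continuous_on_compose2 by auto
next
  case (Suc k)
  show ?case
  proof (rule Ck_on_SucI[OF assms(1)])
    \<comment> \<open>The direction in which \<open>g\<close> is differentiated varies with
      \<open>u\<close>, while the induction hypothesis covers fixed directions only; the basis
      expansion separates the two.\<close>
    let ?d = "\<lambda>u v. \<Sum>b\<in>Basis. (frechet_derivative f (at u) v \<bullet> b) *\<^sub>R frechet_derivative g (at (f u)) b"
    show "((\<lambda>u. g (f u)) has_derivative ?d u) (at u)" if u: "u \<in> S" for u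
    proof -
      have "f u \<in> T" using u assms(3) by auto
      then have g: "(g has_derivative frechet_derivative g (at (f u))) (at (f u))"
        using has_derivative_frechet[OF _ assms(2)] Suc.prems by auto
      have f: "(f has_derivative frechet_derivative f (at u)) (at u)"
        using has_derivative_frechet[OF _ assms(1) u] Suc.prems by auto
      have "((\<lambda>u. g (f u)) has_derivative (\<lambda>v. frechet_derivative g (at (f u)) (frechet_derivative f (at u) v))) (at u)"
        using has_derivative_compose[OF f g] .
      then show ?thesis
        by (subst (asm) linear_euclidean_expand[OF has_derivative_linear[OF g]])
    qed
    show "Ck_on k S (\<lambda>u. ?d u v)" for v
    proof (intro Ck_on_sum assms(1) Ck_on_bilinear[OF assms(1) bounded_bilinear_scaleR])
      fix b :: 'e
      show "Ck_on k S (\<lambda>u. frechet_derivative f (at u) v \<bullet> b)"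
        using Suc.prems by (intro Ck_on_linear[OF assms(1) bounded_linear_inner_left]) auto
      show "Ck_on k S (\<lambda>u. frechet_derivative g (at (f u)) b)"
        using Suc.prems Ck_on_SucD[OF Suc.prems(1)] by (intro Suc.IH) auto
    qed
  qed
qed

lemma smooth_on_cong:
  "open S \<Longrightarrow> smooth_on S f \<Longrightarrow> (\<And>u. u \<in> S \<Longrightarrow> f u = g u) \<Longrightarrow> smooth_on S g"
  unfolding smooth_on_def using Ck_on_cong by blast

lemma smooth_on_subset: "smooth_on S f \<Longrightarrow> T \<subseteq> S \<Longrightarrow> smooth_on T f"
  unfolding smooth_on_def using Ck_on_subset by blast

lemma smooth_on_const: "open S \<Longrightarrow> smooth_on S (\<lambda>u. a)"
  unfolding smooth_on_def using Ck_on_const by blast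

lemma smooth_on_linear:
  "open S \<Longrightarrow> bounded_linear L \<Longrightarrow> smooth_on S f \<Longrightarrow> smooth_on S (\<lambda>u. L (f u))"
  unfolding smooth_on_def using Ck_on_linear by blast

lemma smooth_on_ident: "open S \<Longrightarrow> smooth_on S (\<lambda>u. u)"
  unfolding smooth_on_def
proof
  show "Ck_on k S (\<lambda>u. u)" if "open S" for k
    using that by (cases k) (auto intro!: Ck_on_const continuous_intros)
qed

lemma smooth_on_bounded_linear: "open S \<Longrightarrow> bounded_linear L \<Longrightarrow> smooth_on S L"
  using smooth_on_linear smooth_on_ident by blast

lemma smooth_on_add:
  "open S \<Longrightarrow> smooth_on S f \<Longrightarrow> smooth_on S g \<Longrightarrow> smooth_on S (\<lambda>u. f u + g u)"
  unfolding smooth_on_def using Ck_on_add by blast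

lemma smooth_on_bilinear:
  "open S \<Longrightarrow> bounded_bilinear B \<Longrightarrow> smooth_on S f \<Longrightarrow> smooth_on S g \<Longrightarrow> smooth_on S (\<lambda>u. B (f u) (g u))"
  unfolding smooth_on_def using Ck_on_bilinear by blast

lemmas smooth_on_scaleR = smooth_on_bilinear[OF _ bounded_bilinear_scaleR]
lemmas smooth_on_inner = smooth_on_bilinear[OF _ bounded_bilinear_inner]

lemma smooth_on_sum:
  "open S \<Longrightarrow> (\<And>i. i \<in> I \<Longrightarrow> smooth_on S (f i)) \<Longrightarrow> smooth_on S (\<lambda>u. \<Sum>i\<in>I. f i u)"
  unfolding smooth_on_def by (simp add: Ck_on_sum)

lemma smooth_on_compose:
  fixes f :: "'d::real_normed_vector \<Rightarrow> 'e::euclidean_space"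
  shows "open S \<Longrightarrow> open T \<Longrightarrow> f ` S \<subseteq> T \<Longrightarrow> smooth_on S f \<Longrightarrow> smooth_on T g \<Longrightarrow> smooth_on S (\<lambda>u. g (f u))"
  unfolding smooth_on_def using Ck_on_compose by blast

lemma smooth_on_Pair:
  assumes "open S" "smooth_on S f" "smooth_on S g"
  shows "smooth_on S (\<lambda>u. (f u, g u))"
proof -
  have "bounded_linear (\<lambda>a::'b. (a, 0::'c))" "bounded_linear (\<lambda>a::'c. (0::'b, a))"
    by (intro bounded_linear_Pair bounded_linear_ident bounded_linear_zero)+
  then have "smooth_on S (\<lambda>u. (f u, 0) + (0, g u))"
    using assms by (intro smooth_on_add) (auto intro: smooth_on_linear)
  then show ?thesis by simp
qed

lemma smooth_on_differentiable: "smooth_on S f \<Longrightarrow> f differentiable_on S"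
  unfolding smooth_on_def using Ck_on.simps(2) by blast

lemma smooth_on_has_derivative:
  "smooth_on S f \<Longrightarrow> open S \<Longrightarrow> u \<in> S \<Longrightarrow> (f has_derivative frechet_derivative f (at u)) (at u)"
  using has_derivative_frechet smooth_on_differentiable by blast

lemma smooth_on_frechet_const: "smooth_on S f \<Longrightarrow> smooth_on S (\<lambda>u. frechet_derivative f (at u) v)"
  unfolding smooth_on_def using Ck_on.simps(2) by blast

lemma linear_frechet_smooth:
  "smooth_on S f \<Longrightarrow> open S \<Longrightarrow> u \<in> S \<Longrightarrow> linear (frechet_derivative f (at u))"
  using smooth_on_has_derivative has_derivative_linear by blast

text \<open>Tensor components are assumed smooth on basis vectors only; expanding the argument in
  the basis passes from these to arguments varying smoothly.\<close>

lemma smooth_on_linear_family: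
  fixes L :: "'d::real_normed_vector \<Rightarrow> 'e::euclidean_space \<Rightarrow> 'f::real_normed_vector"
  assumes "open S" "\<And>u. u \<in> S \<Longrightarrow> linear (L u)"
    and "\<And>b. b \<in> Basis \<Longrightarrow> smooth_on S (\<lambda>u. L u b)" "smooth_on S X"
  shows "smooth_on S (\<lambda>u. L u (X u))"
proof -
  have "smooth_on S (\<lambda>u. \<Sum>b\<in>Basis. (X u \<bullet> b) *\<^sub>R L u b)"
    by (intro smooth_on_sum smooth_on_scaleR smooth_on_const smooth_on_inner assms)
  then show ?thesis
    by (rule smooth_on_cong[OF assms(1)]) (rule linear_euclidean_expand[OF assms(2), symmetric])
qed

lemma smooth_on_frechet:
  fixes f :: "'e::euclidean_space \<Rightarrow> 'f::real_normed_vector"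
  assumes "open S" "smooth_on S f" "smooth_on S X"
  shows "smooth_on S (\<lambda>u. frechet_derivative f (at u) (X u))"
  by (rule smooth_on_linear_family[OF assms(1) linear_frechet_smooth[OF assms(2,1)] smooth_on_frechet_const[OF assms(2)] assms(3)])

text \<open>Leibniz rule for a linear map depending on the point. Differentiability is assumed for
  each fixed vector separately, the form in which the equations for the metric, \<open>J\<close> and
  the Christoffel symbols are available.\<close>

lemma has_derivative_linear_family:
  fixes L :: "'d::real_normed_vector \<Rightarrow> 'e::euclidean_space \<Rightarrow> 'f::real_normed_vector"
  assumes "open S" "u \<in> S" "\<And>u. u \<in> S \<Longrightarrow> linear (L u)"
    and "\<And>b. ((\<lambda>u. L u b) has_derivative L' b) (at u)" "(X has_derivative X') (at u)"
  shows "((\<lambda>u. L u (X u)) has_derivative (\<lambda>v. L' (X u) v + L u (X' v))) (at u)"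
proof -
  \<comment> \<open>Linearity of \<open>L'\<close> in its first argument is recovered from
    uniqueness of derivatives.\<close>
  have L'lin: "L' w v = (\<Sum>b\<in>Basis. (w \<bullet> b) *\<^sub>R L' b v)" for w v
  proof -
    have "((\<lambda>u. \<Sum>b\<in>Basis. (w \<bullet> b) *\<^sub>R L u b) has_derivative (\<lambda>v. \<Sum>b\<in>Basis. (w \<bullet> b) *\<^sub>R L' b v)) (at u)"
      by (auto intro!: derivative_eq_intros assms)
    then have "((\<lambda>u. L u w) has_derivative (\<lambda>v. \<Sum>b\<in>Basis. (w \<bullet> b) *\<^sub>R L' b v)) (at u)"
      by (rule has_derivative_transform_within_open[OF _ assms(1,2)])
        (simp add: linear_euclidean_expand[OF assms(3), of _ w])
    from has_derivative_unique[OF this assms(4)] show ?thesis by metis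
  qed
  have "((\<lambda>u. \<Sum>b\<in>Basis. (X u \<bullet> b) *\<^sub>R L u b) has_derivative
     (\<lambda>v. \<Sum>b\<in>Basis. (X u \<bullet> b) *\<^sub>R L' b v + (X' v \<bullet> b) *\<^sub>R L u b)) (at u)"
    by (auto intro!: derivative_eq_intros assms)
  then have "((\<lambda>u. L u (X u)) has_derivative
     (\<lambda>v. \<Sum>b\<in>Basis. (X u \<bullet> b) *\<^sub>R L' b v + (X' v \<bullet> b) *\<^sub>R L u b)) (at u)"
    by (rule has_derivative_transform_within_open[OF _ assms(1,2)])
      (simp add: linear_euclidean_expand[OF assms(3), of _ "X _"])
  moreover have "(\<Sum>b\<in>Basis. (X u \<bullet> b) *\<^sub>R L' b v + (X' v \<bullet> b) *\<^sub>R L u b) = L' (X u) v + L u (X' v)" for v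
    using L'lin[of "X u" v] linear_euclidean_expand[OF assms(3)[OF assms(2)], of "X' v"]
    by (simp add: sum.distrib)
  ultimately show ?thesis by simp
qed

section \<open>Symmetry of second derivatives\<close>

text \<open>The mean value theorem, once in each direction; symmetry of the second derivative follows by
  exchanging the directions and letting \<open>t\<close> tend to \<open>0\<close>.\<close>

lemma mixed_difference:
  fixes f :: "'e::real_normed_vector \<Rightarrow> real"
  assumes B: "\<And>a b. 0 \<le> a \<Longrightarrow> a \<le> t \<Longrightarrow> 0 \<le> b \<Longrightarrow> b \<le> t \<Longrightarrow> u + a *\<^sub>R v + b *\<^sub>R w \<in> S"
    and S: "open S" and f: "smooth_on S f" and t: "t > 0"
  obtains a b where "0 \<le> a" "a \<le> t" "0 \<le> b" "b \<le> t"
    "f (u + t *\<^sub>R v + t *\<^sub>R w) - f (u + t *\<^sub>R v) - f (u + t *\<^sub>R w) + f u =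
      t * (t * frechet_derivative (\<lambda>u. frechet_derivative f (at u) v) (at (u + a *\<^sub>R v + b *\<^sub>R w)) w)"
proof -
  let ?F = "\<lambda>u. frechet_derivative f (at u) v"
  have d1: "((\<lambda>a. f (u + a *\<^sub>R v + b *\<^sub>R w)) has_field_derivative ?F (u + a *\<^sub>R v + b *\<^sub>R w)) (at a)"
    if ab: "0 \<le> a" "a \<le> t" "0 \<le> b" "b \<le> t" for a b
  proof -
    have f': "(f has_derivative frechet_derivative f (at (u + a *\<^sub>R v + b *\<^sub>R w))) (at (u + a *\<^sub>R v + b *\<^sub>R w))"
      using smooth_on_has_derivative[OF f S B[OF ab]] .
    have "((\<lambda>a. u + a *\<^sub>R v + b *\<^sub>R w) has_derivative (\<lambda>h. h *\<^sub>R v)) (at a)"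
      by (auto intro!: derivative_eq_intros)
    from has_derivative_compose[OF this f'] show ?thesis
      by (simp add: has_field_derivative_def linear_scale[OF has_derivative_linear[OF f']] mult_commute_abs)
  qed
  have d2: "((\<lambda>b. ?F (u + a *\<^sub>R v + b *\<^sub>R w)) has_field_derivative
      frechet_derivative ?F (at (u + a *\<^sub>R v + b *\<^sub>R w)) w) (at b)"
    if ab: "0 \<le> a" "a \<le> t" "0 \<le> b" "b \<le> t" for a b
  proof -
    have f': "(?F has_derivative frechet_derivative ?F (at (u + a *\<^sub>R v + b *\<^sub>R w))) (at (u + a *\<^sub>R v + b *\<^sub>R w))"
      using smooth_on_has_derivative[OF smooth_on_frechet_const[OF f] S B[OF ab]] .
    have "((\<lambda>b. u + a *\<^sub>R v + b *\<^sub>R w) has_derivative (\<lambda>h. h *\<^sub>R w)) (at b)"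
      by (auto intro!: derivative_eq_intros)
    from has_derivative_compose[OF this f'] show ?thesis
      by (simp add: has_field_derivative_def linear_scale[OF has_derivative_linear[OF f']] mult_commute_abs)
  qed
  have "\<exists>a. 0 < a \<and> a < t \<and>
      (f (u + t *\<^sub>R v + t *\<^sub>R w) - f (u + t *\<^sub>R v + 0 *\<^sub>R w)) - (f (u + 0 *\<^sub>R v + t *\<^sub>R w) - f (u + 0 *\<^sub>R v + 0 *\<^sub>R w)) =
       (t - 0) * (?F (u + a *\<^sub>R v + t *\<^sub>R w) - ?F (u + a *\<^sub>R v + 0 *\<^sub>R w))"
    by (rule MVT2[OF t, where f = "\<lambda>a. f (u + a *\<^sub>R v + t *\<^sub>R w) - f (u + a *\<^sub>R v + 0 *\<^sub>R w)"])
      (use t in \<open>auto simp del: scaleR_zero_left intro!: DERIV_diff d1\<close>)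
  then obtain a where a: "0 < a" "a < t" and eq1:
      "(f (u + t *\<^sub>R v + t *\<^sub>R w) - f (u + t *\<^sub>R v)) - (f (u + t *\<^sub>R w) - f u) =
       t * (?F (u + a *\<^sub>R v + t *\<^sub>R w) - ?F (u + a *\<^sub>R v + 0 *\<^sub>R w))"
    by auto
  have "\<exists>b. 0 < b \<and> b < t \<and> ?F (u + a *\<^sub>R v + t *\<^sub>R w) - ?F (u + a *\<^sub>R v + 0 *\<^sub>R w) =
      (t - 0) * frechet_derivative ?F (at (u + a *\<^sub>R v + b *\<^sub>R w)) w"
    by (rule MVT2[OF t, where f = "\<lambda>b. ?F (u + a *\<^sub>R v + b *\<^sub>R w)"]) (use a in \<open>auto intro!: d2\<close>)
  then obtain b where b: "0 < b" "b < t" and eq2: "?F (u + a *\<^sub>R v + t *\<^sub>R w) - ?F (u + a *\<^sub>R v + 0 *\<^sub>R w) =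
      t * frechet_derivative ?F (at (u + a *\<^sub>R v + b *\<^sub>R w)) w" by auto
  show ?thesis
    by (rule that[of a b]) (use a b eq1 eq2 in auto)
qed

lemma second_derivative_symmetric_real:
  fixes f :: "'e::real_normed_vector \<Rightarrow> real"
  assumes S: "open S" and f: "smooth_on S f" and u: "u \<in> S"
  shows "frechet_derivative (\<lambda>u. frechet_derivative f (at u) v) (at u) w =
         frechet_derivative (\<lambda>u. frechet_derivative f (at u) w) (at u) v"
proof -
  let ?A = "\<lambda>z. frechet_derivative (\<lambda>u. frechet_derivative f (at u) v) (at z) w"
  let ?B = "\<lambda>z. frechet_derivative (\<lambda>u. frechet_derivative f (at u) w) (at z) v"
  have "continuous_on S ?A" "continuous_on S ?B"
    by (rule differentiable_imp_continuous_on smooth_on_differentiable smooth_on_frechet_const f)+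
  then have cont: "isCont ?A u" "isCont ?B u"
    using u S by (auto simp: continuous_on_eq_continuous_at)
  obtain r where r: "r > 0" "ball u r \<subseteq> S"
    using S u open_contains_ball by blast
  have tend: "((\<lambda>t. u + a t *\<^sub>R v + b t *\<^sub>R w) \<longlongrightarrow> u) (at_right 0)"
    if ab: "\<forall>\<^sub>F t in at_right (0::real). 0 \<le> a t \<and> a t \<le> t \<and> 0 \<le> b t \<and> b t \<le> t" for a b :: "real \<Rightarrow> real"
  proof -
    have id: "((\<lambda>t. t) \<longlongrightarrow> 0) (at_right (0::real))" by (rule tendsto_ident_at)
    have "(a \<longlongrightarrow> 0) (at_right 0)"
      by (rule tendsto_sandwich[OF _ _ tendsto_const id]) (use ab in \<open>auto elim: eventually_mono\<close>)
    moreover have "(b \<longlongrightarrow> 0) (at_right 0)"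
      by (rule tendsto_sandwich[OF _ _ tendsto_const id]) (use ab in \<open>auto elim: eventually_mono\<close>)
    ultimately have "((\<lambda>t. u + a t *\<^sub>R v + b t *\<^sub>R w) \<longlongrightarrow> u + 0 *\<^sub>R v + 0 *\<^sub>R w) (at_right 0)"
      by (intro tendsto_intros)
    then show ?thesis by simp
  qed
  \<comment> \<open>One mixed difference is evaluated twice. In the second evaluation
    \<open>w\<close> comes first, so \<open>a'\<close> belongs to \<open>w\<close> and
    \<open>b'\<close> to \<open>v\<close>.\<close>
  have small: "\<exists>a b a' b'. 0 \<le> a \<and> a \<le> t \<and> 0 \<le> b \<and> b \<le> t \<and> 0 \<le> a' \<and> a' \<le> t \<and> 0 \<le> b' \<and> b' \<le> t \<and>
      ?A (u + a *\<^sub>R v + b *\<^sub>R w) = ?B (u + b' *\<^sub>R v + a' *\<^sub>R w)"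
    if t: "0 < t" "t * (norm v + norm w) < r" for t
  proof -
    have in_S: "u + a *\<^sub>R v + b *\<^sub>R w \<in> S" if "0 \<le> a" "a \<le> t" "0 \<le> b" "b \<le> t" for a b
    proof -
      have "norm (a *\<^sub>R v + b *\<^sub>R w) \<le> a * norm v + b * norm w"
        using norm_triangle_ineq[of "a *\<^sub>R v" "b *\<^sub>R w"] that by simp
      also have "\<dots> \<le> t * norm v + t * norm w"
        using that by (intro add_mono mult_right_mono) auto
      finally have "norm (a *\<^sub>R v + b *\<^sub>R w) < r" using t by (simp add: distrib_left)
      moreover have "dist u (u + a *\<^sub>R v + b *\<^sub>R w) = norm (a *\<^sub>R v + b *\<^sub>R w)"
        by (metis add.assoc add_diff_cancel_left' dist_commute dist_norm)
      ultimately have "u + a *\<^sub>R v + b *\<^sub>R w \<in> ball u r" by simp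
      then show ?thesis using r by blast
    qed
    obtain a b where ab: "0 \<le> a" "a \<le> t" "0 \<le> b" "b \<le> t"
       "f (u + t *\<^sub>R v + t *\<^sub>R w) - f (u + t *\<^sub>R v) - f (u + t *\<^sub>R w) + f u = t * (t * ?A (u + a *\<^sub>R v + b *\<^sub>R w))"
      by (rule mixed_difference[OF in_S S f t(1)]) auto
    have in_S': "u + a *\<^sub>R w + b *\<^sub>R v \<in> S" if "0 \<le> a" "a \<le> t" "0 \<le> b" "b \<le> t" for a b
      using in_S[OF that(3,4,1,2)] by (simp add: ac_simps)
    obtain a' b' where ab': "0 \<le> a'" "a' \<le> t" "0 \<le> b'" "b' \<le> t"
       "f (u + t *\<^sub>R w + t *\<^sub>R v) - f (u + t *\<^sub>R w) - f (u + t *\<^sub>R v) + f u = t * (t * ?B (u + a' *\<^sub>R w + b' *\<^sub>R v))"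
      by (rule mixed_difference[OF in_S' S f t(1)]) auto
    have "f (u + t *\<^sub>R v + t *\<^sub>R w) = f (u + t *\<^sub>R w + t *\<^sub>R v)" by (simp add: ac_simps)
    then have "t * (t * ?A (u + a *\<^sub>R v + b *\<^sub>R w)) = t * (t * ?B (u + a' *\<^sub>R w + b' *\<^sub>R v))"
      using ab(5) ab'(5) by linarith
    then have "?A (u + a *\<^sub>R v + b *\<^sub>R w) = ?B (u + a' *\<^sub>R w + b' *\<^sub>R v)" using t by simp
    then have "?A (u + a *\<^sub>R v + b *\<^sub>R w) = ?B (u + b' *\<^sub>R v + a' *\<^sub>R w)" by (simp add: ac_simps)
    then show ?thesis using ab ab' by blast
  qed
  have "((\<lambda>t. t * (norm v + norm w)) \<longlongrightarrow> 0 * (norm v + norm w)) (at_right (0::real))"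
    by (intro tendsto_intros)
  then have "\<forall>\<^sub>F t in at_right (0::real). t * (norm v + norm w) < r"
    using r by (auto dest: order_tendstoD)
  then have ev: "\<forall>\<^sub>F t in at_right (0::real). 0 < t \<and> t * (norm v + norm w) < r"
    using eventually_at_right_less[of "0::real"] by (rule eventually_conj_iff[THEN iffD2, OF conjI, rotated])
  \<comment> \<open>The four parameters are packed into one tuple so that a single choice yields all
    of them as functions of \<open>t\<close>.\<close>
  define P where "P t z = (case z of (a, b, a', b') \<Rightarrow> 0 \<le> a \<and> a \<le> t \<and> 0 \<le> b \<and> b \<le> t \<and> 0 \<le> a' \<and> a' \<le> t \<and> 0 \<le> b' \<and> b' \<le> t \<and>
      ?A (u + a *\<^sub>R v + b *\<^sub>R w) = ?B (u + b' *\<^sub>R v + a' *\<^sub>R w))" for t z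
  have "\<exists>z. P t z" if "0 < t \<and> t * (norm v + norm w) < r" for t
    using small[of t] that unfolding P_def by auto
  then obtain z where z: "\<And>t. 0 < t \<and> t * (norm v + norm w) < r \<Longrightarrow> P t (z t)" by metis
  define a b a' b' where "a t = fst (z t)" and "b t = fst (snd (z t))"
    and "a' t = fst (snd (snd (z t)))" and "b' t = snd (snd (snd (z t)))" for t
  have evP: "\<forall>\<^sub>F t in at_right (0::real). 0 \<le> a t \<and> a t \<le> t \<and> 0 \<le> b t \<and> b t \<le> t \<and> 0 \<le> a' t \<and> a' t \<le> t \<and> 0 \<le> b' t \<and> b' t \<le> t \<and>
      ?A (u + a t *\<^sub>R v + b t *\<^sub>R w) = ?B (u + b' t *\<^sub>R v + a' t *\<^sub>R w)"
    using ev by (rule eventually_mono, drule_tac z) (auto simp: P_def a_def b_def a'_def b'_def split: prod.splits)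
  have lA: "((\<lambda>t. ?A (u + a t *\<^sub>R v + b t *\<^sub>R w)) \<longlongrightarrow> ?A u) (at_right 0)"
    by (rule isCont_tendsto_compose[OF cont(1)], rule tend) (use evP in \<open>auto elim: eventually_mono\<close>)
  have lB: "((\<lambda>t. ?B (u + b' t *\<^sub>R v + a' t *\<^sub>R w)) \<longlongrightarrow> ?B u) (at_right 0)"
    by (rule isCont_tendsto_compose[OF cont(2)], rule tend) (use evP in \<open>auto elim: eventually_mono\<close>)
  have "((\<lambda>t. ?A (u + a t *\<^sub>R v + b t *\<^sub>R w)) \<longlongrightarrow> ?B u) (at_right 0)"
    by (rule Lim_transform_eventually[OF lB]) (use evP in \<open>auto elim: eventually_mono\<close>)
  from tendsto_unique[OF _ lA this] show ?thesis by (simp add: trivial_limit_at_right_real)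
qed

text \<open>The mean value argument concerns real functions; vector values reduce to it
  componentwise, since the inner product with a fixed vector commutes with both derivatives.\<close>

lemma second_derivative_symmetric:
  fixes f :: "'e::real_normed_vector \<Rightarrow> 'f::euclidean_space"
  assumes S: "open S" and f: "smooth_on S f" and u: "u \<in> S"
  shows "frechet_derivative (\<lambda>u. frechet_derivative f (at u) v) (at u) w =
         frechet_derivative (\<lambda>u. frechet_derivative f (at u) w) (at u) v"
proof (rule euclidean_eqI)
  fix b :: 'f
  have comp: "frechet_derivative (\<lambda>u. h u \<bullet> b) (at z) v = frechet_derivative h (at z) v \<bullet> b"
    if "smooth_on S h" "z \<in> S" for h :: "'e \<Rightarrow> 'f" and z v
    using frechet_derivativeI[OF has_derivative_inner_left[OF smooth_on_has_derivative[OF that(1) S that(2)]], of b]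
    by simp
  have fb: "smooth_on S (\<lambda>u. f u \<bullet> b)"
    by (intro smooth_on_inner smooth_on_const S f)
  have two: "frechet_derivative (\<lambda>u. frechet_derivative (\<lambda>u. f u \<bullet> b) (at u) v) (at u) w =
    frechet_derivative (\<lambda>u. frechet_derivative f (at u) v) (at u) w \<bullet> b" for v w
  proof -
    have "((\<lambda>u. frechet_derivative f (at u) v \<bullet> b) has_derivative
       (\<lambda>w. frechet_derivative (\<lambda>u. frechet_derivative f (at u) v) (at u) w \<bullet> b)) (at u)"
      by (intro has_derivative_inner_left smooth_on_has_derivative[OF smooth_on_frechet_const[OF f] S u])
    then have "((\<lambda>u. frechet_derivative (\<lambda>u. f u \<bullet> b) (at u) v) has_derivative
       (\<lambda>w. frechet_derivative (\<lambda>u. frechet_derivative f (at u) v) (at u) w \<bullet> b)) (at u)"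
      by (rule has_derivative_transform_within_open[OF _ S u]) (simp add: comp[OF f])
    from frechet_derivativeI[OF this] show ?thesis by simp
  qed
  show "frechet_derivative (\<lambda>u. frechet_derivative f (at u) v) (at u) w \<bullet> b =
         frechet_derivative (\<lambda>u. frechet_derivative f (at u) w) (at u) v \<bullet> b"
    using second_derivative_symmetric_real[OF S fb u, of v w] by (simp add: two)
qed

section \<open>Charts\<close>

definition dtrans ::
  "('a, 'e::euclidean_space) chart \<Rightarrow> ('a, 'e) chart \<Rightarrow> 'a \<Rightarrow> 'e \<Rightarrow> 'e" where
  "dtrans c d x = frechet_derivative (transition c d) (at (coords c x))"

text \<open>The axioms about charts alone. Both the base manifold and its cotangent bundle become
  instances, so each lemma of this locale serves twice.\<close>

locale smooth_charts =
  fixes M :: "('a, 'e::euclidean_space) manifold"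
  assumes chart_inj: "c \<in> atlas M \<Longrightarrow> inj_on (coords c) (dom_of c)"
    and open_chart_image: "c \<in> atlas M \<Longrightarrow> open (coords c ` dom_of c)"
    and open_overlap: "c \<in> atlas M \<Longrightarrow> d \<in> atlas M \<Longrightarrow> open (coords c ` (dom_of c \<inter> dom_of d))"
    and smooth_transition: "c \<in> atlas M \<Longrightarrow> d \<in> atlas M \<Longrightarrow>
      smooth_on (coords c ` (dom_of c \<inter> dom_of d)) (transition c d)"
    and chart_at: "x \<in> points M \<Longrightarrow> chart_at M x \<in> atlas M \<and> x \<in> dom_of (chart_at M x)"

lemma smooth_manifold_charts: "smooth_manifold M \<Longrightarrow> smooth_charts M"
  unfolding smooth_manifold_def smooth_charts_def by blast

context smooth_charts
begin

lemma points_of_chart: "c \<in> atlas M \<Longrightarrow> x \<in> dom_of c \<Longrightarrow> x \<in> points M"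
  by (auto simp: points_def)

lemma chart_inv_coords: "c \<in> atlas M \<Longrightarrow> x \<in> dom_of c \<Longrightarrow> chart_inv c (coords c x) = x"
  by (simp add: chart_inv_def chart_inj)

lemma coords_chart_inv: "u \<in> coords c ` dom_of c \<Longrightarrow> coords c (chart_inv c u) = u"
  unfolding chart_inv_def by (rule f_inv_into_f)

lemma chart_inv_mem: "c \<in> atlas M \<Longrightarrow> U \<subseteq> dom_of c \<Longrightarrow> u \<in> coords c ` U \<Longrightarrow> chart_inv c u \<in> U"
  by (auto simp: chart_inv_coords subset_iff)

lemma image_Int: "c \<in> atlas M \<Longrightarrow> U \<subseteq> dom_of c \<Longrightarrow> V \<subseteq> dom_of c \<Longrightarrow>
    coords c ` (U \<inter> V) = coords c ` U \<inter> coords c ` V"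
  using chart_inj inj_on_image_Int by metis

lemma transition_coords:
  "c \<in> atlas M \<Longrightarrow> x \<in> dom_of c \<Longrightarrow> transition c d (coords c x) = coords d x"
  by (simp add: transition_def chart_inv_coords)

lemma transition_has_derivative:
  assumes "c \<in> atlas M" "d \<in> atlas M" "x \<in> dom_of c" "x \<in> dom_of d"
  shows "(transition c d has_derivative dtrans c d x) (at (coords c x))"
  unfolding dtrans_def
  by (rule smooth_on_has_derivative[OF smooth_transition open_overlap]) (use assms in auto)

lemma linear_dtrans:
  "c \<in> atlas M \<Longrightarrow> d \<in> atlas M \<Longrightarrow> x \<in> dom_of c \<Longrightarrow> x \<in> dom_of d \<Longrightarrow> linear (dtrans c d x)"
  using transition_has_derivative has_derivative_linear by blast

text \<open>The chain rule for transition maps. Since \<open>tcomp\<close> and \<open>tvec\<close>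
  are \<open>dtrans\<close> with \<open>chart_at M x\<close> as one of the charts, this cocycle
  identity yields every conversion between components.\<close>

lemma dtrans_comp:
  assumes c: "c \<in> atlas M" "x \<in> dom_of c" and d: "d \<in> atlas M" "x \<in> dom_of d"
    and e: "e \<in> atlas M" "x \<in> dom_of e"
  shows "dtrans d e x (dtrans c d x v) = dtrans c e x v"
proof -
  let ?T = "coords c ` (dom_of c \<inter> dom_of d)"
  have "(transition d e has_derivative dtrans d e x) (at (transition c d (coords c x)))"
    using transition_has_derivative[OF d(1) e(1) d(2) e(2)] transition_coords[OF c] by simp
  from has_derivative_compose[OF transition_has_derivative[OF c(1) d(1) c(2) d(2)] this]
  have "((\<lambda>u. transition d e (transition c d u)) has_derivative
      (\<lambda>v. dtrans d e x (dtrans c d x v))) (at (coords c x))" .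
  moreover have "coords c x \<in> ?T" using c d by auto
  moreover have "transition d e (transition c d u) = transition c e u" if "u \<in> ?T" for u
    using that c d e by (auto simp: transition_coords)
  ultimately have "(transition c e has_derivative (\<lambda>v. dtrans d e x (dtrans c d x v))) (at (coords c x))"
    using has_derivative_transform_within_open[OF _ open_overlap[OF c(1) d(1)]] by blast
  from has_derivative_unique[OF this transition_has_derivative[OF c(1) e(1) c(2) e(2)]] show ?thesis
    by metis
qed

lemma dtrans_self:
  assumes c: "c \<in> atlas M" "x \<in> dom_of c"
  shows "dtrans c c x v = v"
proof -
  have "((\<lambda>u. u) has_derivative (\<lambda>v. v)) (at (coords c x))" by (rule has_derivative_ident)
  then have "(transition c c has_derivative (\<lambda>v. v)) (at (coords c x))"
    by (rule has_derivative_transform_within_open[OF _ open_chart_image[OF c(1)]])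
      (use c in \<open>auto simp: transition_coords\<close>)
  from has_derivative_unique[OF this transition_has_derivative[OF c(1) c(1) c(2) c(2)]] show ?thesis
    by metis
qed

lemma tcomp_dtrans: "tcomp M c x = dtrans (chart_at M x) c x"
  by (simp add: tcomp_def dtrans_def)

lemma tvec_dtrans: "tvec M c x = dtrans c (chart_at M x) x"
  by (simp add: tvec_def dtrans_def)

lemma
  assumes c: "c \<in> atlas M" "x \<in> dom_of c"
  shows linear_tcomp: "linear (tcomp M c x)" and linear_tvec: "linear (tvec M c x)"
    and tcomp_tvec: "tcomp M c x (tvec M c x v) = v" and tvec_tcomp: "tvec M c x (tcomp M c x v) = v"
  using c chart_at[OF points_of_chart[OF c]]
  by (simp_all add: tcomp_dtrans tvec_dtrans dtrans_comp dtrans_self linear_dtrans)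

lemma
  assumes c: "c \<in> atlas M" "x \<in> dom_of c" and d: "d \<in> atlas M" "x \<in> dom_of d"
  shows tcomp_tvec_dtrans: "tcomp M d x (tvec M c x v) = dtrans c d x v"
    and dtrans_tcomp: "dtrans c d x (tcomp M c x v) = tcomp M d x v"
  using c d chart_at[OF points_of_chart[OF c]]
  by (simp_all add: tcomp_dtrans tvec_dtrans dtrans_comp)

lemma
  assumes "x \<in> points M"
  shows tcomp_chart_at: "tcomp M (chart_at M x) x v = v"
    and tvec_chart_at: "tvec M (chart_at M x) x v = v"
  using chart_at[OF assms] by (simp_all add: tcomp_dtrans tvec_dtrans dtrans_self)

lemma open_in_mfdD: "open_in_mfd M U \<Longrightarrow> c \<in> atlas M \<Longrightarrow> open (coords c ` (U \<inter> dom_of c))"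
  by (simp add: open_in_mfd_def)

lemma open_in_mfd_image: "open_in_mfd M U \<Longrightarrow> c \<in> atlas M \<Longrightarrow> U \<subseteq> dom_of c \<Longrightarrow> open (coords c ` U)"
  using open_in_mfdD[of U c] by (simp add: Int_absorb2)

lemma open_in_mfd_dom: "c \<in> atlas M \<Longrightarrow> open_in_mfd M (dom_of c)"
  unfolding open_in_mfd_def using open_overlap by (auto simp: Int_commute points_of_chart)

lemma transition_image:
  assumes "d \<in> atlas M" "U \<subseteq> dom_of c"
  shows "transition d c ` (coords d ` (U \<inter> dom_of d)) = coords c ` (U \<inter> dom_of d)"
  using assms by (force simp: transition_coords)

lemma vfield_rep_coords:
  "c \<in> atlas M \<Longrightarrow> x \<in> dom_of c \<Longrightarrow> vfield_rep M c X (coords c x) = tcomp M c x (X x)"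
  by (simp add: vfield_rep_def chart_inv_coords)

text \<open>In another chart \<open>d\<close> the representative is the Jacobian of the transition
  applied to the representative in \<open>c\<close>, read off at the transported point; both
  ingredients are smooth.\<close>

lemma smooth_vfield_chartI:
  assumes c: "c \<in> atlas M" and U: "open_in_mfd M U" "U \<subseteq> dom_of c"
    and X: "smooth_on (coords c ` U) (vfield_rep M c X)"
  shows "smooth_vfield_on M U X"
  unfolding smooth_vfield_on_def
proof
  fix d assume d: "d \<in> atlas M"
  let ?S = "coords d ` (U \<inter> dom_of d)" and ?T = "coords c ` (U \<inter> dom_of d)"
  have S: "open ?S" using open_in_mfdD[OF U(1) d] .
  have "?T = coords c ` U \<inter> coords c ` (dom_of c \<inter> dom_of d)"
    using U(2) image_Int[OF c U(2), of "dom_of c \<inter> dom_of d"] by (simp add: Int_absorb2 Int_assoc[symmetric])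
  then have T: "open ?T"
    using open_in_mfd_image[OF U(1) c U(2)] open_overlap[OF c d] by (simp add: open_Int)
  have 1: "smooth_on ?T (\<lambda>w. frechet_derivative (transition c d) (at w) (vfield_rep M c X w))"
    by (rule smooth_on_frechet[OF T smooth_on_subset[OF smooth_transition[OF c d]] smooth_on_subset[OF X]])
      (use U(2) in auto)
  have 2: "smooth_on ?S (\<lambda>u. frechet_derivative (transition c d) (at (transition d c u)) (vfield_rep M c X (transition d c u)))"
    by (rule smooth_on_compose[OF S T _ smooth_on_subset[OF smooth_transition[OF d c]] 1])
      (use transition_image[OF d U(2)] U(2) in auto)
  show "smooth_on ?S (vfield_rep M d X)"
  proof (rule smooth_on_cong[OF S 2])
    fix u assume "u \<in> ?S"
    then obtain x where x: "x \<in> U" "x \<in> dom_of d" "u = coords d x" by auto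
    then have "x \<in> dom_of c" using U(2) by auto
    then show "frechet_derivative (transition c d) (at (transition d c u)) (vfield_rep M c X (transition d c u)) = vfield_rep M d X u"
      using x c d dtrans_tcomp[OF c _ d] by (simp add: transition_coords vfield_rep_coords dtrans_def)
  qed
qed

lemma smooth_fun_chartI:
  assumes c: "c \<in> atlas M" and U: "open_in_mfd M U" "U \<subseteq> dom_of c"
    and f: "smooth_on (coords c ` U) (f \<circ> chart_inv c)"
  shows "smooth_fun_on M U f"
  unfolding smooth_fun_on_def
proof
  fix d assume d: "d \<in> atlas M"
  let ?S = "coords d ` (U \<inter> dom_of d)"
  have S: "open ?S" using open_in_mfdD[OF U(1) d] .
  have 2: "smooth_on ?S (\<lambda>u. (f \<circ> chart_inv c) (transition d c u))"
    by (rule smooth_on_compose[OF S open_in_mfd_image[OF U(1) c U(2)] _ smooth_on_subset[OF smooth_transition[OF d c]] f])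
      (use transition_image[OF d U(2)] U(2) in auto)
  show "smooth_on ?S (f \<circ> chart_inv d)"
    by (rule smooth_on_cong[OF S 2]) (use U(2) c d in \<open>auto simp: transition_coords chart_inv_coords subset_iff\<close>)
qed

lemma smooth_vfield_chartD:
  "smooth_vfield_on M U X \<Longrightarrow> c \<in> atlas M \<Longrightarrow> U \<subseteq> dom_of c \<Longrightarrow> smooth_on (coords c ` U) (vfield_rep M c X)"
  unfolding smooth_vfield_on_def by (metis Int_absorb2)

lemma smooth_vfield_subset: "smooth_vfield_on M U X \<Longrightarrow> V \<subseteq> U \<Longrightarrow> smooth_vfield_on M V X"
  unfolding smooth_vfield_on_def by (meson Int_mono image_mono order_refl smooth_on_subset)

lemma smooth_vfield_cong:
  assumes "open_in_mfd M U" "smooth_vfield_on M U X" "\<And>x. x \<in> U \<Longrightarrow> X x = Y x"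
  shows "smooth_vfield_on M U Y"
  unfolding smooth_vfield_on_def
proof
  fix c assume c: "c \<in> atlas M"
  show "smooth_on (coords c ` (U \<inter> dom_of c)) (vfield_rep M c Y)"
    by (rule smooth_on_cong[OF open_in_mfdD[OF assms(1) c], of "vfield_rep M c X"])
      (use assms c in \<open>auto simp: smooth_vfield_on_def vfield_rep_coords\<close>)
qed

lemma dir_deriv_chart:
  assumes c: "c \<in> atlas M" "x \<in> dom_of c"
    and F: "(f \<circ> chart_inv c has_derivative F) (at (coords c x))"
  shows "dir_deriv M x v f = F (tcomp M c x v)"
proof -
  let ?d = "chart_at M x"
  have d: "?d \<in> atlas M" "x \<in> dom_of ?d" using chart_at[OF points_of_chart[OF c]] by auto
  have "(f \<circ> chart_inv c has_derivative F) (at (transition ?d c (coords ?d x)))"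
    using F by (simp add: transition_coords[OF d])
  from has_derivative_compose[OF transition_has_derivative[OF d(1) c(1) d(2) c(2)] this]
  have "((\<lambda>u. (f \<circ> chart_inv c) (transition ?d c u)) has_derivative (\<lambda>v. F (dtrans ?d c x v))) (at (coords ?d x))" .
  then have "((f \<circ> chart_inv ?d) has_derivative (\<lambda>v. F (dtrans ?d c x v))) (at (coords ?d x))"
    by (rule has_derivative_transform_within_open[OF _ open_overlap[OF d(1) c(1)]])
      (use c d in \<open>auto simp: transition_coords chart_inv_coords\<close>)
  from frechet_derivativeI[OF this] show ?thesis
    by (simp add: dir_deriv_def tcomp_dtrans)
qed

lemma smooth_chart_field:
  assumes c: "c \<in> atlas M"
  shows "smooth_vfield_on M (dom_of c) (\<lambda>y. tvec M c y v)"
  by (rule smooth_vfield_chartI[OF c open_in_mfd_dom[OF c] order_refl],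
      rule smooth_on_cong[OF open_chart_image[OF c] smooth_on_const[OF open_chart_image[OF c], of v]])
    (use c in \<open>auto simp: vfield_rep_coords tcomp_tvec\<close>)

end

section \<open>Connections in a chart\<close>

lemma (in smooth_charts) smooth_fun_compD:
  "smooth_vfield_on M U X \<Longrightarrow> open_in_mfd M U \<Longrightarrow> c \<in> atlas M \<Longrightarrow> U \<subseteq> dom_of c \<Longrightarrow>
    smooth_fun_on M U (\<lambda>z. tcomp M c z (X z) \<bullet> b)"
  apply (rule smooth_fun_chartI, assumption+)
  apply (rule smooth_on_cong[OF open_in_mfd_image smooth_on_inner[OF open_in_mfd_image smooth_vfield_chartD smooth_on_const[OF open_in_mfd_image]]], assumption+)
  apply (simp add: vfield_rep_def)
  done

lemma (in smooth_charts) smooth_vfield_zero: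
  assumes "open_in_mfd M U"
  shows "smooth_vfield_on M U (\<lambda>_. 0)"
  unfolding smooth_vfield_on_def
proof
  fix c assume c: "c \<in> atlas M"
  show "smooth_on (coords c ` (U \<inter> dom_of c)) (vfield_rep M c (\<lambda>_. 0))"
    by (rule smooth_on_cong[OF open_in_mfdD[OF assms c] smooth_on_const[OF open_in_mfdD[OF assms c], of 0]])
      (use c in \<open>auto simp: vfield_rep_coords linear_0[OF linear_tcomp]\<close>)
qed

text \<open>Constancy is asked for on \<open>U\<close> only, so that the indicator function of the
  complement of \<open>U\<close> counts as smooth on \<open>U\<close>.\<close>

lemma (in smooth_charts) smooth_fun_local_const:
  assumes "open_in_mfd M U" "\<And>x. x \<in> U \<Longrightarrow> f x = a"
  shows "smooth_fun_on M U f"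
  unfolding smooth_fun_on_def
proof
  fix c assume c: "c \<in> atlas M"
  show "smooth_on (coords c ` (U \<inter> dom_of c)) (f \<circ> chart_inv c)"
    by (rule smooth_on_cong[OF open_in_mfdD[OF assms(1) c] smooth_on_const[OF open_in_mfdD[OF assms(1) c], of a]])
      (use c assms in \<open>auto simp: chart_inv_coords\<close>)
qed

lemma (in smooth_charts) smooth_vfield_sum:
  assumes c: "c \<in> atlas M" and U: "open_in_mfd M U" "U \<subseteq> dom_of c"
    and E: "\<And>b. b \<in> B \<Longrightarrow> smooth_vfield_on M U (E b)" and f: "\<And>b. b \<in> B \<Longrightarrow> smooth_fun_on M U (f b)"
  shows "smooth_vfield_on M U (\<lambda>z. \<Sum>b\<in>B. f b z *\<^sub>R E b z)"
proof (rule smooth_vfield_chartI[OF c U])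
  have S: "open (coords c ` U)" using open_in_mfd_image[OF U(1) c U(2)] .
  have "smooth_on (coords c ` U) (f b \<circ> chart_inv c)" if "b \<in> B" for b
    using f[OF that] c U(2) unfolding smooth_fun_on_def by (metis Int_absorb2)
  then have "smooth_on (coords c ` U) (\<lambda>u. \<Sum>b\<in>B. (f b \<circ> chart_inv c) u *\<^sub>R vfield_rep M c (E b) u)"
    by (intro smooth_on_sum smooth_on_scaleR S smooth_vfield_chartD[OF E c U(2)])
  then show "smooth_on (coords c ` U) (vfield_rep M c (\<lambda>z. \<Sum>b\<in>B. f b z *\<^sub>R E b z))"
  proof (rule smooth_on_cong[OF S])
    fix u assume "u \<in> coords c ` U"
    then obtain x where x: "x \<in> U" "u = coords c x" by auto
    with U(2) have "x \<in> dom_of c" by auto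
    then show "(\<Sum>b\<in>B. (f b \<circ> chart_inv c) u *\<^sub>R vfield_rep M c (E b) u) =
      vfield_rep M c (\<lambda>z. \<Sum>b\<in>B. f b z *\<^sub>R E b z) u"
      using x c linear_tcomp[OF c] by (simp add: vfield_rep_coords chart_inv_coords linear_sum linear_scale)
  qed
qed

locale chart_connection = smooth_charts M
  for M :: "('a, 'e::euclidean_space) manifold" +
  fixes D :: "('a \<Rightarrow> 'e) \<Rightarrow> ('a \<Rightarrow> 'e) \<Rightarrow> 'a \<Rightarrow> 'e"
  assumes affine: "affine_connection M D"
begin

lemma
  assumes "open_in_mfd M U" "smooth_vfield_on M U X" "smooth_vfield_on M U Y"
  shows smooth_conn: "smooth_vfield_on M U (D X Y)"
    and conn_add_left: "smooth_vfield_on M U Z \<Longrightarrow> x \<in> U \<Longrightarrow> D (\<lambda>y. X y + Z y) Y x = D X Y x + D Z Y x"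
    and conn_add_right: "smooth_vfield_on M U Z \<Longrightarrow> x \<in> U \<Longrightarrow> D X (\<lambda>y. Y y + Z y) x = D X Y x + D X Z x"
    and conn_scale_left: "smooth_fun_on M U f \<Longrightarrow> x \<in> U \<Longrightarrow> D (\<lambda>y. f y *\<^sub>R X y) Y x = f x *\<^sub>R D X Y x"
    and conn_scale_right: "smooth_fun_on M U f \<Longrightarrow> x \<in> U \<Longrightarrow>
      D X (\<lambda>y. f y *\<^sub>R Y y) x = dir_deriv M x (X x) f *\<^sub>R Y x + f x *\<^sub>R D X Y x"
proof -
  have aff: "smooth_vfield_on M U X \<Longrightarrow> smooth_vfield_on M U Y \<Longrightarrow> smooth_vfield_on M U Z \<Longrightarrow> smooth_fun_on M U f \<Longrightarrow>
      smooth_vfield_on M U (D X Y) \<and>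
      (\<forall>x\<in>U. D (\<lambda>y. X y + Y y) Z x = D X Z x + D Y Z x \<and>
           D (\<lambda>y. f y *\<^sub>R X y) Z x = f x *\<^sub>R D X Z x \<and>
           D X (\<lambda>y. Y y + Z y) x = D X Y x + D X Z x \<and>
           D X (\<lambda>y. f y *\<^sub>R Y y) x = dir_deriv M x (X x) f *\<^sub>R Y x + f x *\<^sub>R D X Y x)" for X Y Z f
    using affine assms(1) unfolding affine_connection_def by blast
  \<comment> \<open>The axiom bundles all rules under one list of hypotheses; repeated fields and
    the zero function fill the places that a single rule leaves open.\<close>
  have one: "smooth_fun_on M U (\<lambda>_. 0)"
    by (rule smooth_fun_local_const[OF assms(1) refl])
  show "smooth_vfield_on M U (D X Y)" using aff[OF assms(2,3,3) one] by blast
  show "D (\<lambda>y. X y + Z y) Y x = D X Y x + D Z Y x" if "smooth_vfield_on M U Z" "x \<in> U"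
    using aff[OF assms(2) that(1) assms(3) one] that(2) by blast
  show "D X (\<lambda>y. Y y + Z y) x = D X Y x + D X Z x" if "smooth_vfield_on M U Z" "x \<in> U"
    using aff[OF assms(2,3) that(1) one] that(2) by blast
  show "D (\<lambda>y. f y *\<^sub>R X y) Y x = f x *\<^sub>R D X Y x" if "smooth_fun_on M U f" "x \<in> U"
    using aff[OF assms(2,3,3) that(1)] that(2) by blast
  show "D X (\<lambda>y. f y *\<^sub>R Y y) x = dir_deriv M x (X x) f *\<^sub>R Y x + f x *\<^sub>R D X Y x" if "smooth_fun_on M U f" "x \<in> U"
    using aff[OF assms(2,3,3) that(1)] that(2) by blast
qed

text \<open>Locality: such a \<open>Z\<close> equals \<open>f Z\<close> for the indicator function \<open>f\<close> of the complement of \<open>U\<close>.\<close>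

lemma conn_vanish:
  assumes U: "open_in_mfd M U" and X: "smooth_vfield_on M U X" and Z: "\<And>x. x \<in> U \<Longrightarrow> Z x = 0" and x: "x \<in> U"
  shows "D X Z x = 0" and "D Z X x = 0"
proof -
  let ?f = "\<lambda>y. if y \<in> U then 0 else 1 :: real"
  have f: "smooth_fun_on M U ?f" by (rule smooth_fun_local_const[OF U, of _ 0]) simp
  have Zs: "smooth_vfield_on M U Z"
    by (rule smooth_vfield_cong[OF U smooth_vfield_zero[OF U]]) (simp add: Z)
  have eq: "(\<lambda>y. ?f y *\<^sub>R Z y) = Z" using Z by auto
  show "D X Z x = 0" using conn_scale_right[OF U X Zs f x] x Z[OF x] unfolding eq by simp
  show "D Z X x = 0" using conn_scale_left[OF U Zs X f x] x unfolding eq by simp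
qed

text \<open>Write \<open>Y'\<close> as \<open>Y\<close> plus a difference that vanishes on
  \<open>U\<close> and contributes nothing by \<open>conn_vanish\<close>; likewise for
  \<open>X'\<close>. A field may thus be replaced by an expansion that is valid only in a
  chart.\<close>

lemma conn_cong:
  assumes U: "open_in_mfd M U" and X: "smooth_vfield_on M U X" and Y: "smooth_vfield_on M U Y"
    and XX: "\<And>x. x \<in> U \<Longrightarrow> X x = X' x" and YY: "\<And>x. x \<in> U \<Longrightarrow> Y x = Y' x" and x: "x \<in> U"
  shows "D X Y x = D X' Y' x"
proof -
  have van: "smooth_vfield_on M U Z" if "\<And>x. x \<in> U \<Longrightarrow> Z x = 0" for Z
    by (rule smooth_vfield_cong[OF U smooth_vfield_zero[OF U]]) (simp add: that)
  have Y': "smooth_vfield_on M U Y'" by (rule smooth_vfield_cong[OF U Y YY])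
  have "D X (\<lambda>y. Y y + (Y' y - Y y)) x = D X Y x + D X (\<lambda>y. Y' y - Y y) x"
    by (rule conn_add_right[OF U X Y van x]) (simp add: YY)
  then have 1: "D X Y' x = D X Y x"
    using conn_vanish(1)[OF U X _ x, of "\<lambda>y. Y' y - Y y"] YY by simp
  have "D (\<lambda>y. X y + (X' y - X y)) Y' x = D X Y' x + D (\<lambda>y. X' y - X y) Y' x"
    by (rule conn_add_left[OF U X Y' van x]) (simp add: XX)
  then have 2: "D X' Y' x = D X Y' x"
    using conn_vanish(2)[OF U Y' _ x, of "\<lambda>y. X' y - X y"] XX by simp
  from 1 2 show ?thesis by simp
qed

lemma conn_sum:
  assumes c: "c \<in> atlas M" and U: "open_in_mfd M U" "U \<subseteq> dom_of c" and x: "x \<in> U"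
    and X: "smooth_vfield_on M U X"
    and E: "\<And>b. b \<in> B \<Longrightarrow> smooth_vfield_on M U (E b)" and f: "\<And>b. b \<in> B \<Longrightarrow> smooth_fun_on M U (f b)"
    and B: "finite B"
  shows "D X (\<lambda>z. \<Sum>b\<in>B. f b z *\<^sub>R E b z) x =
      (\<Sum>b\<in>B. dir_deriv M x (X x) (f b) *\<^sub>R E b x + f b x *\<^sub>R D X (E b) x)"
    and "D (\<lambda>z. \<Sum>b\<in>B. f b z *\<^sub>R E b z) X x = (\<Sum>b\<in>B. f b x *\<^sub>R D (E b) X x)"
  using B E f
proof (induction B)
  case empty
  { case 1 show ?case using conn_vanish(1)[OF U(1) X _ x] by simp }
  { case 2 show ?case using conn_vanish(2)[OF U(1) X _ x] by simp }
next
  case (insert a B)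
  have s1: "smooth_vfield_on M U (\<lambda>z. f a z *\<^sub>R E a z)" if "smooth_vfield_on M U (E a)" "smooth_fun_on M U (f a)"
    using smooth_vfield_sum[OF c U, of "{a}" E f] that by simp
  have s2: "smooth_vfield_on M U (\<lambda>z. \<Sum>b\<in>B. f b z *\<^sub>R E b z)"
    if "\<And>b. b \<in> insert a B \<Longrightarrow> smooth_vfield_on M U (E b)" "\<And>b. b \<in> insert a B \<Longrightarrow> smooth_fun_on M U (f b)"
    using smooth_vfield_sum[OF c U, of B E f] that by blast
  { case 1
    then show ?case
      using insert.hyps insert.IH(1) conn_add_right[OF U(1) X s1 s2 x] conn_scale_right[OF U(1) X _ _ x] by simp }
  { case 2
    then show ?case
      using insert.hyps insert.IH(2) conn_add_left[OF U(1) s1 X s2 x] conn_scale_left[OF U(1) _ X _ x] by simp }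
qed

text \<open>The Christoffel symbols of an arbitrary chart at an arbitrary point of it, extended
  bilinearly from basis vectors; bilinearity is then immediate, and agreement with \<open>D\<close>
  on all constant fields is \<open>conn_chart_fields\<close>.\<close>

definition gam :: "('a, 'e) chart \<Rightarrow> 'a \<Rightarrow> 'e \<Rightarrow> 'e \<Rightarrow> 'e" where
  "gam c y v w = (\<Sum>a\<in>Basis. \<Sum>b\<in>Basis. ((v \<bullet> a) * (w \<bullet> b)) *\<^sub>R
     tcomp M c y (D (\<lambda>z. tvec M c z a) (\<lambda>z. tvec M c z b) y))"

lemma bilinear_gam: "bilinear (gam c y)"
  unfolding bilinear_def gam_def
  by (auto intro!: linearI simp: inner_add_left algebra_simps sum.distrib scaleR_sum_right)

text \<open>Both fields are expanded in the coordinate frame of \<open>c\<close>. The Leibniz rule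
  differentiates the components of \<open>Y\<close>, and the derivatives of the frame fields
  assemble to \<open>gam\<close>.\<close>

lemma conn_chart:
  assumes c: "c \<in> atlas M" and U: "open_in_mfd M U" "U \<subseteq> dom_of c" and y: "y \<in> U"
    and X: "smooth_vfield_on M U X" and Y: "smooth_vfield_on M U Y"
  shows "tcomp M c y (D X Y y) = frechet_derivative (vfield_rep M c Y) (at (coords c y)) (tcomp M c y (X y)) +
    gam c y (tcomp M c y (X y)) (tcomp M c y (Y y))"
proof -
  define E where "E b = (\<lambda>z. tvec M c z b)" for b
  define f where "f X b = (\<lambda>z. tcomp M c z (X z) \<bullet> b)" for X and b :: 'e
  have yc: "y \<in> dom_of c" using y U(2) by blast
  have E: "smooth_vfield_on M U (E b)" for b
    unfolding E_def by (rule smooth_vfield_subset[OF smooth_chart_field[OF c] U(2)])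
  have f: "smooth_fun_on M U (f X b)" if "smooth_vfield_on M U X" for X b
    unfolding f_def by (rule smooth_fun_compD[OF that U(1) c U(2)])
  have expand: "X z = (\<Sum>b\<in>Basis. f X b z *\<^sub>R E b z)" if z: "z \<in> U" for X z
  proof -
    have zc: "z \<in> dom_of c" using z U(2) by blast
    have "X z = tvec M c z (tcomp M c z (X z))" by (simp add: tvec_tcomp[OF c zc])
    also have "\<dots> = (\<Sum>b\<in>Basis. f X b z *\<^sub>R E b z)"
      unfolding f_def E_def by (rule linear_euclidean_expand[OF linear_tvec[OF c zc]])
    finally show ?thesis .
  qed
  have right: "D Z Y y = (\<Sum>b\<in>Basis. dir_deriv M y (Z y) (f Y b) *\<^sub>R E b y + f Y b y *\<^sub>R D Z (E b) y)"
    if Z: "smooth_vfield_on M U Z" for Z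
    by (subst conn_cong[OF U(1) Z Y refl expand[of _ Y] y], assumption)
      (rule conn_sum[OF c U y Z E f[OF Y] finite_Basis])
  have left: "D X Z y = (\<Sum>a\<in>Basis. f X a y *\<^sub>R D (E a) Z y)" if Z: "smooth_vfield_on M U Z" for Z
    by (subst conn_cong[OF U(1) X Z expand[of _ X] refl y], assumption)
      (rule conn_sum[OF c U y Z E f[OF X] finite_Basis])
  have dd: "dir_deriv M y (X y) (f Y b) = frechet_derivative (vfield_rep M c Y) (at (coords c y)) (tcomp M c y (X y)) \<bullet> b" for b
  proof (rule dir_deriv_chart[OF c(1) yc])
    have "coords c y \<in> coords c ` U" using y by blast
    from smooth_on_has_derivative[OF smooth_vfield_chartD[OF Y c U(2)] open_in_mfd_image[OF U(1) c U(2)] this]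
    have "((\<lambda>u. vfield_rep M c Y u \<bullet> b) has_derivative (\<lambda>v. frechet_derivative (vfield_rep M c Y) (at (coords c y)) v \<bullet> b)) (at (coords c y))"
      by (rule has_derivative_inner_left)
    then show "(f Y b \<circ> chart_inv c has_derivative (\<lambda>v. frechet_derivative (vfield_rep M c Y) (at (coords c y)) v \<bullet> b)) (at (coords c y))"
      unfolding f_def o_def vfield_rep_def .
  qed
  note lin = linear_tcomp[OF c yc]
  have eq: "D X Y y = (\<Sum>b\<in>Basis. dir_deriv M y (X y) (f Y b) *\<^sub>R E b y) +
    (\<Sum>b\<in>Basis. \<Sum>a\<in>Basis. (f X a y * f Y b y) *\<^sub>R D (E a) (E b) y)"
    unfolding right[OF X] left[OF E] by (simp add: sum.distrib scaleR_sum_right mult.commute)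
  have "tcomp M c y (D X Y y) = (\<Sum>b\<in>Basis. dir_deriv M y (X y) (f Y b) *\<^sub>R b) +
    (\<Sum>b\<in>Basis. \<Sum>a\<in>Basis. (f X a y * f Y b y) *\<^sub>R tcomp M c y (D (E a) (E b) y))"
    unfolding eq by (simp add: linear_add[OF lin] linear_sum[OF lin] linear_scale[OF lin] E_def tcomp_tvec[OF c yc])
  also have "(\<Sum>b\<in>Basis. \<Sum>a\<in>Basis. (f X a y * f Y b y) *\<^sub>R tcomp M c y (D (E a) (E b) y)) =
    gam c y (tcomp M c y (X y)) (tcomp M c y (Y y))"
    unfolding gam_def f_def E_def by (rule sum.swap)
  also have "(\<Sum>b\<in>Basis. dir_deriv M y (X y) (f Y b) *\<^sub>R b) =
    frechet_derivative (vfield_rep M c Y) (at (coords c y)) (tcomp M c y (X y))"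
    unfolding dd by (rule euclidean_representation)
  finally show ?thesis .
qed

lemma frechet_vfield_rep_const:
  assumes c: "c \<in> atlas M" and y: "y \<in> dom_of c"
  shows "frechet_derivative (vfield_rep M c (\<lambda>z. tvec M c z w)) (at (coords c y)) v = 0"
proof -
  have "((\<lambda>u. w) has_derivative (\<lambda>v. 0)) (at (coords c y))" by simp
  then have "(vfield_rep M c (\<lambda>z. tvec M c z w) has_derivative (\<lambda>v. 0)) (at (coords c y))"
    by (rule has_derivative_transform_within_open[OF _ open_chart_image[OF c]])
      (use c y in \<open>auto simp: vfield_rep_coords tcomp_tvec\<close>)
  from frechet_derivativeI[OF this] show ?thesis by simp
qed

lemma conn_chart_fields:
  assumes c: "c \<in> atlas M" and y: "y \<in> dom_of c"
  shows "tcomp M c y (D (\<lambda>z. tvec M c z v) (\<lambda>z. tvec M c z w) y) = gam c y v w"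
  using conn_chart[OF c open_in_mfd_dom[OF c] order_refl y smooth_chart_field[OF c] smooth_chart_field[OF c]]
  by (simp add: frechet_vfield_rep_const[OF c y] tcomp_tvec[OF c y])

lemma smooth_gam:
  assumes c: "c \<in> atlas M"
  shows "smooth_on (coords c ` dom_of c) (\<lambda>u. gam c (chart_inv c u) v w)"
  unfolding gam_def
  by (intro smooth_on_sum smooth_on_scaleR smooth_on_const open_chart_image[OF c]
    smooth_vfield_chartD[OF smooth_conn[OF open_in_mfd_dom[OF c] smooth_chart_field[OF c] smooth_chart_field[OF c]] c order_refl, unfolded vfield_rep_def])

text \<open>The bracket at \<open>y\<close> is computed in \<open>chart_at M y\<close>, where the
  coordinate fields of \<open>c\<close> need not be constant. Their derivatives there are second
  derivatives of the transition map, and these are symmetric.\<close>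

lemma lie_bracket_chart_fields:
  assumes c: "c \<in> atlas M" and y: "y \<in> dom_of c"
  shows "lie_bracket M (\<lambda>z. tvec M c z v) (\<lambda>z. tvec M c z w) y = 0"
proof -
  define d where "d = chart_at M y"
  have d: "d \<in> atlas M" "y \<in> dom_of d" using chart_at[OF points_of_chart[OF c y]] by (auto simp: d_def)
  let ?T = "coords c ` (dom_of c \<inter> dom_of d)"
  let ?t = "transition c d"
  have T: "open ?T" using open_overlap[OF c d(1)] .
  have yT: "coords c y \<in> ?T" using y d by auto
  note sm = smooth_transition[OF c d(1)]
  have der: "frechet_derivative (vfield_rep M d (\<lambda>z. tvec M c z w)) (at (coords d y)) (tvec M c y v) =
    frechet_derivative (\<lambda>u. frechet_derivative ?t (at u) w) (at (coords c y)) v" for v w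
  proof -
    have 1: "((\<lambda>u. frechet_derivative ?t (at u) w) has_derivative
        frechet_derivative (\<lambda>u. frechet_derivative ?t (at u) w) (at (coords c y))) (at (transition d c (coords d y)))"
      using smooth_on_has_derivative[OF smooth_on_frechet_const[OF sm] T yT] by (simp add: transition_coords[OF d])
    have 2: "((\<lambda>u. frechet_derivative ?t (at (transition d c u)) w) has_derivative
       (\<lambda>v. frechet_derivative (\<lambda>u. frechet_derivative ?t (at u) w) (at (coords c y)) (dtrans d c y v))) (at (coords d y))"
      using has_derivative_compose[OF transition_has_derivative[OF d(1) c d(2) y] 1] .
    have "(vfield_rep M d (\<lambda>z. tvec M c z w) has_derivative
       (\<lambda>v. frechet_derivative (\<lambda>u. frechet_derivative ?t (at u) w) (at (coords c y)) (dtrans d c y v))) (at (coords d y))"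
      by (rule has_derivative_transform_within_open[OF 2 open_overlap[OF d(1) c]])
        (use c y d in \<open>auto simp: transition_coords vfield_rep_coords tcomp_tvec_dtrans dtrans_def\<close>)
    from frechet_derivativeI[OF this] show ?thesis
      using dtrans_comp[OF c y d c y] dtrans_self[OF c y]
      by (simp add: tvec_dtrans d_def[symmetric])
  qed
  show ?thesis
    unfolding lie_bracket_def Let_def d_def[symmetric] der
    using second_derivative_symmetric[OF T sm yT, of w v] by simp
qed

lemma gam_sym:
  assumes tf: "torsion_free M D" and c: "c \<in> atlas M" and y: "y \<in> dom_of c"
  shows "gam c y v w = gam c y w v"
proof -
  have "D (\<lambda>z. tvec M c z v) (\<lambda>z. tvec M c z w) y = D (\<lambda>z. tvec M c z w) (\<lambda>z. tvec M c z v) y"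
    using tf open_in_mfd_dom[OF c] smooth_chart_field[OF c] y lie_bracket_chart_fields[OF c y, of v w]
    unfolding torsion_free_def by (metis eq_iff_diff_eq_0)
  then show ?thesis by (simp add: conn_chart_fields[OF c y, symmetric])
qed

end

section \<open>The cotangent bundle\<close>

lemma smooth_on_fst:
  fixes f :: "'d::euclidean_space \<Rightarrow> 'f::real_normed_vector"
  assumes "open S" "smooth_on S f"
  shows "smooth_on (S \<times> (UNIV :: 'e::euclidean_space set)) (\<lambda>z. f (fst z))"
  by (rule smooth_on_compose[OF open_Times[OF assms(1) open_UNIV] assms(1) _
    smooth_on_bounded_linear[OF open_Times[OF assms(1) open_UNIV] bounded_linear_fst] assms(2)]) auto

definition cotangent_over :: "'a set \<Rightarrow> ('a \<times> ('e::real_vector \<Rightarrow> real)) set" where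
  "cotangent_over U = {(x, p). x \<in> U \<and> linear p}"

text \<open>Encodes a covector as an element of \<open>'e\<close>: evaluation becomes an inner
  product (\<open>fcomp_inner_tcomp\<close>), and a 1-form can be differentiated like a
  vector-valued map.\<close>

definition fcomp :: "('a, 'e::euclidean_space) manifold \<Rightarrow> ('a, 'e) chart \<Rightarrow> 'a \<Rightarrow> ('e \<Rightarrow> real) \<Rightarrow> 'e" where
  "fcomp M c x p = (\<Sum>i\<in>Basis. p (tvec M c x i) *\<^sub>R i)"

lemma linear_functional_rep:
  assumes "linear (p :: 'e::euclidean_space \<Rightarrow> real)"
  shows "(\<Sum>i\<in>Basis. p i *\<^sub>R i) \<bullet> w = p w"
  using linear_euclidean_expand[OF assms, of w]
  by (simp add: inner_sum_left inner_commute[of w] mult.commute)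

lemma dom_cotangent_chart: "dom_of (cotangent_chart M c) = cotangent_over (dom_of c)"
  by (simp add: cotangent_chart_def cotangent_over_def)

lemma coords_cotangent_chart: "coords (cotangent_chart M c) (x, p) = (coords c x, fcomp M c x p)"
  by (simp add: cotangent_chart_def fcomp_def)

lemma atlas_cotangent_bundle: "atlas (cotangent_bundle M) = cotangent_chart M ` atlas M"
  by (simp add: cotangent_bundle_def)

lemma chart_at_cotangent_bundle: "chart_at (cotangent_bundle M) (x, p) = cotangent_chart M (chart_at M x)"
  by (simp add: cotangent_bundle_def)

lemma points_cotangent_bundle: "points (cotangent_bundle M) = cotangent_over (points M)"
  by (auto simp: points_def atlas_cotangent_bundle dom_cotangent_chart cotangent_over_def)

lemma cotangent_over_Int: "cotangent_over U \<inter> cotangent_over V = cotangent_over (U \<inter> V)"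
  by (auto simp: cotangent_over_def)

context smooth_charts
begin

lemma open_in_mfd_Int:
  assumes "open_in_mfd M U" "open_in_mfd M V"
  shows "open_in_mfd M (U \<inter> V)"
  unfolding open_in_mfd_def
proof
  show "U \<inter> V \<subseteq> points M" using assms by (auto simp: open_in_mfd_def)
  show "\<forall>c\<in>atlas M. open (coords c ` (U \<inter> V \<inter> dom_of c))"
  proof
    fix c assume c: "c \<in> atlas M"
    have "U \<inter> V \<inter> dom_of c = (U \<inter> dom_of c) \<inter> (V \<inter> dom_of c)" by blast
    then show "open (coords c ` (U \<inter> V \<inter> dom_of c))"
      using image_Int[OF c, of "U \<inter> dom_of c" "V \<inter> dom_of c"] open_in_mfdD[OF assms(1) c] open_in_mfdD[OF assms(2) c]
      by (simp add: open_Int)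
  qed
qed

lemma fcomp_inner:
  assumes "c \<in> atlas M" "x \<in> dom_of c" "linear p"
  shows "fcomp M c x p \<bullet> v = p (tvec M c x v)"
  using linear_functional_rep[OF linear_compose[OF linear_tvec[OF assms(1,2)] assms(3)], of v]
  by (simp add: fcomp_def)

lemma fcomp_inner_tcomp:
  assumes "c \<in> atlas M" "x \<in> dom_of c" "linear p"
  shows "fcomp M c x p \<bullet> tcomp M c x w = p w"
  by (simp add: fcomp_inner[OF assms] tvec_tcomp[OF assms(1,2)])

lemma linear_inner_tcomp:
  assumes "c \<in> atlas M" "x \<in> dom_of c"
  shows "linear (\<lambda>w. q \<bullet> tcomp M c x w)"
  using linear_compose[OF linear_tcomp[OF assms] bounded_linear.linear[OF bounded_linear_inner_right]]
  by (simp add: o_def)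

lemma fcomp_inner_tcomp_form:
  assumes "c \<in> atlas M" "x \<in> dom_of c"
  shows "fcomp M c x (\<lambda>w. q \<bullet> tcomp M c x w) = q"
  unfolding fcomp_def by (simp add: tcomp_tvec[OF assms] euclidean_representation)

text \<open>Every \<open>q\<close> is the fibre coordinate of some covector, namely of the one
  pairing components with \<open>q\<close>. Chart images are therefore full products, and openness
  in the bundle reduces to openness in the base.\<close>

lemma cotangent_image:
  assumes "c \<in> atlas M" "U \<subseteq> dom_of c"
  shows "coords (cotangent_chart M c) ` cotangent_over U = coords c ` U \<times> UNIV"
proof (rule equalityI; rule subsetI)
  fix z assume "z \<in> coords c ` U \<times> (UNIV :: 'e set)"
  then obtain x q where z: "x \<in> U" "z = (coords c x, q)" by auto
  then have x: "x \<in> dom_of c" using assms by auto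
  have "z = coords (cotangent_chart M c) (x, \<lambda>w. q \<bullet> tcomp M c x w)"
    by (simp only: coords_cotangent_chart fcomp_inner_tcomp_form[OF assms(1) x] z)
  then show "z \<in> coords (cotangent_chart M c) ` cotangent_over U"
    using z(1) linear_inner_tcomp[OF assms(1) x] by (auto simp: cotangent_over_def)
qed (auto simp: cotangent_over_def coords_cotangent_chart)

lemma cotangent_chart_inj:
  assumes "c \<in> atlas M"
  shows "inj_on (coords (cotangent_chart M c)) (dom_of (cotangent_chart M c))"
proof (rule inj_onI)
  fix P Q
  assume P: "P \<in> dom_of (cotangent_chart M c)" and Q: "Q \<in> dom_of (cotangent_chart M c)"
    and eq: "coords (cotangent_chart M c) P = coords (cotangent_chart M c) Q"
  obtain x p y q where PQ: "P = (x, p)" "Q = (y, q)" by (meson surj_pair)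
  have "x = y"
    using P Q eq chart_inj[OF assms]
    by (auto simp: PQ dom_cotangent_chart coords_cotangent_chart cotangent_over_def inj_on_def)
  moreover have "p w = q w" for w
    using P Q eq fcomp_inner_tcomp[OF assms] \<open>x = y\<close>
    by (auto simp: PQ dom_cotangent_chart coords_cotangent_chart cotangent_over_def) metis
  ultimately show "P = Q" by (auto simp: PQ)
qed

lemma cotangent_chart_inv:
  assumes "c \<in> atlas M" "x \<in> dom_of c"
  shows "chart_inv (cotangent_chart M c) (coords c x, q) = (x, \<lambda>w. q \<bullet> tcomp M c x w)"
proof -
  have "(x, \<lambda>w. q \<bullet> tcomp M c x w) \<in> dom_of (cotangent_chart M c)"
    using assms linear_inner_tcomp[OF assms] by (simp add: dom_cotangent_chart cotangent_over_def)
  from inv_into_f_f[OF cotangent_chart_inj[OF assms(1)] this] show ?thesis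
    by (simp only: chart_inv_def coords_cotangent_chart fcomp_inner_tcomp_form[OF assms])
qed

text \<open>The coordinate change of the induced charts: the new fibre components are the values of
  the covector on the coordinate vectors of \<open>d\<close>, which are expressed in the chart
  \<open>c\<close>.\<close>

definition cotangent_trans :: "('a, 'e) chart \<Rightarrow> ('a, 'e) chart \<Rightarrow> 'e \<times> 'e \<Rightarrow> 'e \<times> 'e" where
  "cotangent_trans c d z = (transition c d (fst z),
     \<Sum>i\<in>Basis. (snd z \<bullet> vfield_rep M c (\<lambda>y. tvec M d y i) (fst z)) *\<^sub>R i)"

lemma transition_cotangent:
  assumes "c \<in> atlas M" "d \<in> atlas M" and z: "z \<in> coords c ` (dom_of c \<inter> dom_of d) \<times> UNIV"
  shows "transition (cotangent_chart M c) (cotangent_chart M d) z = cotangent_trans c d z"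
proof -
  obtain x q where x: "x \<in> dom_of c" "x \<in> dom_of d" and z: "z = (coords c x, q)"
    using z by auto
  show ?thesis
    unfolding transition_def z o_def cotangent_chart_inv[OF assms(1) x(1)] coords_cotangent_chart
    using assms x by (simp add: cotangent_trans_def transition_coords[unfolded transition_def o_def] transition_def
        chart_inv_coords vfield_rep_coords fcomp_def)
qed

lemma smooth_vfield_rep_chart_field:
  assumes "c \<in> atlas M" "d \<in> atlas M"
  shows "smooth_on (coords c ` (dom_of c \<inter> dom_of d)) (vfield_rep M c (\<lambda>y. tvec M d y i))"
  using smooth_chart_field[OF assms(2), of i] assms(1) by (auto simp: smooth_vfield_on_def Int_commute)

lemma smooth_cotangent_trans:
  assumes "c \<in> atlas M" "d \<in> atlas M"
  shows "smooth_on (coords c ` (dom_of c \<inter> dom_of d) \<times> UNIV) (cotangent_trans c d)"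
proof -
  let ?S = "coords c ` (dom_of c \<inter> dom_of d)"
  have S: "open ?S" "open (?S \<times> (UNIV :: 'e set))" using open_overlap[OF assms] by (auto intro: open_Times)
  show ?thesis
    unfolding cotangent_trans_def
    by (intro smooth_on_Pair smooth_on_sum smooth_on_scaleR smooth_on_inner smooth_on_const S
        smooth_on_fst[OF S(1)] smooth_transition assms smooth_vfield_rep_chart_field
        smooth_on_bounded_linear[OF S(2) bounded_linear_snd])
qed

lemma smooth_charts_cotangent: "smooth_charts (cotangent_bundle M)"
proof
  fix c' d' assume "c' \<in> atlas (cotangent_bundle M)" "d' \<in> atlas (cotangent_bundle M)"
  then obtain c d where c: "c \<in> atlas M" "c' = cotangent_chart M c" and d: "d \<in> atlas M" "d' = cotangent_chart M d"
    by (auto simp: atlas_cotangent_bundle)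
  show "inj_on (coords c') (dom_of c')" using cotangent_chart_inj c by simp
  show "open (coords c' ` dom_of c')"
    using c by (simp add: dom_cotangent_chart cotangent_image open_Times open_chart_image)
  have im: "coords c' ` (dom_of c' \<inter> dom_of d') = coords c ` (dom_of c \<inter> dom_of d) \<times> UNIV"
    using c d by (simp add: dom_cotangent_chart cotangent_over_Int cotangent_image)
  have o: "open (coords c ` (dom_of c \<inter> dom_of d) \<times> (UNIV :: 'e set))"
    using open_overlap[OF c(1) d(1)] by (auto intro: open_Times)
  then show "open (coords c' ` (dom_of c' \<inter> dom_of d'))" by (simp add: im)
  show "smooth_on (coords c' ` (dom_of c' \<inter> dom_of d')) (transition c' d')"
    unfolding im
    by (rule smooth_on_cong[OF o smooth_cotangent_trans[OF c(1) d(1)]])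
      (simp add: transition_cotangent c d)
next
  fix P assume "P \<in> points (cotangent_bundle M)"
  then show "chart_at (cotangent_bundle M) P \<in> atlas (cotangent_bundle M) \<and> P \<in> dom_of (chart_at (cotangent_bundle M) P)"
    using chart_at by (auto simp: points_cotangent_bundle cotangent_over_def chart_at_cotangent_bundle
      atlas_cotangent_bundle dom_cotangent_chart)
qed

lemma open_in_cotangent:
  assumes "open_in_mfd M U"
  shows "open_in_mfd (cotangent_bundle M) (cotangent_over U)"
proof -
  have "coords (cotangent_chart M c) ` (cotangent_over U \<inter> cotangent_over (dom_of c)) =
      coords c ` (U \<inter> dom_of c) \<times> UNIV" if "c \<in> atlas M" for c
    using that by (simp add: cotangent_over_Int cotangent_image)
  then show ?thesis
    using assms by (auto simp: open_in_mfd_def atlas_cotangent_bundle points_cotangent_bundle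
      dom_cotangent_chart open_Times) (auto simp: cotangent_over_def)
qed

text \<open>The fibre coordinates of the chart induced by \<open>c\<close> are the functions \<open>p \<mapsto> p(\<partial>\<^sub>i)\<close>, so the second
  component is their derivative in the direction \<open>\<xi>\<close>.\<close>

lemma tcomp_cotangent:
  assumes c: "c \<in> atlas M" "x \<in> dom_of c" and p: "linear p"
  shows "tcomp (cotangent_bundle M) (cotangent_chart M c) (x, p) \<xi> =
    (tcomp M c x (fst \<xi>), \<Sum>i\<in>Basis. (snd \<xi> \<bullet> tvec M c x i +
      p (frechet_derivative (vfield_rep M (chart_at M x) (\<lambda>y. tvec M c y i)) (at (coords (chart_at M x) x)) (fst \<xi>))) *\<^sub>R i)"
proof -
  define d where "d = chart_at M x"
  have xM: "x \<in> points M" using points_of_chart[OF c] .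
  have d: "d \<in> atlas M" "x \<in> dom_of d" using chart_at[OF xM] by (auto simp: d_def)
  have S: "open (coords d ` (dom_of d \<inter> dom_of c))" "open (coords d ` (dom_of d \<inter> dom_of c) \<times> (UNIV :: 'e set))"
    using open_overlap[OF d(1) c(1)] by (auto intro: open_Times)
  have xS: "coords d x \<in> coords d ` (dom_of d \<inter> dom_of c)" using c d by auto
  let ?z = "(coords d x, fcomp M d x p)"
  have zS: "?z \<in> coords d ` (dom_of d \<inter> dom_of c) \<times> UNIV" using xS by auto
  let ?W = "\<lambda>i. vfield_rep M d (\<lambda>y. tvec M c y i)"
  have W: "((\<lambda>z. ?W i (fst z)) has_derivative (\<lambda>\<xi>. frechet_derivative (?W i) (at (coords d x)) (fst \<xi>))) (at ?z)" for i
    by (rule has_derivative_compose[where g="?W i", OF bounded_linear_imp_has_derivative[OF bounded_linear_fst]])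
      (simp add: smooth_on_has_derivative[OF smooth_vfield_rep_chart_field[OF d(1) c(1)] S(1) xS])
  have t: "((\<lambda>z::'e \<times> 'e. transition d c (fst z)) has_derivative (\<lambda>\<xi>. dtrans d c x (fst \<xi>))) (at ?z)"
    by (rule has_derivative_compose[where g="transition d c", OF bounded_linear_imp_has_derivative[OF bounded_linear_fst]])
      (simp add: transition_has_derivative[OF d(1) c(1) d(2) c(2)])
  have "(cotangent_trans d c has_derivative (\<lambda>\<xi>. (dtrans d c x (fst \<xi>),
     \<Sum>i\<in>Basis. (fcomp M d x p \<bullet> frechet_derivative (?W i) (at (coords d x)) (fst \<xi>) + snd \<xi> \<bullet> ?W i (coords d x)) *\<^sub>R i))) (at ?z)"
    unfolding cotangent_trans_def
    by (rule has_derivative_Pair[OF t]) (auto intro!: derivative_eq_intros W)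
  then have "(transition (cotangent_chart M d) (cotangent_chart M c) has_derivative (\<lambda>\<xi>. (dtrans d c x (fst \<xi>),
     \<Sum>i\<in>Basis. (fcomp M d x p \<bullet> frechet_derivative (?W i) (at (coords d x)) (fst \<xi>) + snd \<xi> \<bullet> ?W i (coords d x)) *\<^sub>R i))) (at ?z)"
    by (rule has_derivative_transform_within_open[OF _ S(2) zS]) (simp add: transition_cotangent[OF d(1) c(1)])
  from frechet_derivativeI[OF this] show ?thesis
    unfolding tcomp_def chart_at_cotangent_bundle d_def[symmetric] coords_cotangent_chart
    using d tvec_chart_at[OF xM, folded d_def] tcomp_chart_at[OF xM, folded d_def]
    by (simp add: dtrans_def fcomp_inner[OF d p] vfield_rep_coords[OF d] add.commute)
qed

lemma linear_form_at: "smooth_form_on M U \<omega> \<Longrightarrow> x \<in> U \<Longrightarrow> linear (\<omega> x)"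
  by (simp add: smooth_form_on_def)

lemma tcomp_vlift:
  assumes c: "c \<in> atlas M" "x \<in> dom_of c" and p: "linear p" and \<omega>: "linear \<omega>"
  shows "tcomp (cotangent_bundle M) (cotangent_chart M c) (x, p) (vlift \<omega>) = (0, fcomp M c x \<omega>)"
proof -
  have d: "chart_at M x \<in> atlas M" "x \<in> dom_of (chart_at M x)"
    using chart_at[OF points_of_chart[OF c]] by auto
  have xS: "coords (chart_at M x) x \<in> coords (chart_at M x) ` (dom_of (chart_at M x) \<inter> dom_of c)" using c d by auto
  show ?thesis
    unfolding tcomp_cotangent[OF c p]
    using linear_0[OF linear_tcomp[OF c]] linear_0[OF p]
      linear_0[OF linear_frechet_smooth[OF smooth_vfield_rep_chart_field[OF d(1) c(1)] open_overlap[OF d(1) c(1)] xS]]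
    by (simp add: vlift_def linear_functional_rep[OF \<omega>] fcomp_def)
qed

lemma vfield_rep_vlift:
  assumes c: "c \<in> atlas M" "x \<in> dom_of c" and \<omega>: "linear (\<omega> x)"
  shows "vfield_rep (cotangent_bundle M) (cotangent_chart M c) (vlift_field \<omega>) (coords c x, q) = (0, fcomp M c x (\<omega> x))"
  unfolding vfield_rep_def cotangent_chart_inv[OF c] vlift_field_def
  by (simp add: tcomp_vlift[OF c linear_inner_tcomp[OF c] \<omega>])

definition form_rep :: "('a, 'e) chart \<Rightarrow> ('a \<Rightarrow> 'e \<Rightarrow> real) \<Rightarrow> 'e \<Rightarrow> 'e" where
  "form_rep c \<omega> u = fcomp M c (chart_inv c u) (\<omega> (chart_inv c u))"

lemma smooth_form_rep:
  assumes c: "c \<in> atlas M" and U: "open_in_mfd M U" "U \<subseteq> dom_of c" and \<omega>: "smooth_form_on M U \<omega>"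
  shows "smooth_on (coords c ` U) (form_rep c \<omega>)"
proof -
  have S: "open (coords c ` U)" using open_in_mfd_image[OF U(1) c U(2)] .
  have "smooth_on (coords c ` U) (\<lambda>u. \<omega> (chart_inv c u) (tvec M c (chart_inv c u) b))" if "b \<in> Basis" for b
    using \<omega> c U(2) that unfolding smooth_form_on_def by (metis Int_absorb2)
  then show ?thesis
    unfolding form_rep_def fcomp_def by (intro smooth_on_sum smooth_on_scaleR smooth_on_const S)
qed

lemma smooth_vlift_field:
  assumes c: "c \<in> atlas M" and U: "open_in_mfd M U" "U \<subseteq> dom_of c"
    and \<omega>: "smooth_on (coords c ` U) (form_rep c \<omega>)" "\<And>x. x \<in> U \<Longrightarrow> linear (\<omega> x)"
  shows "smooth_vfield_on (cotangent_bundle M) (cotangent_over U) (vlift_field \<omega>)"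
proof -
  interpret N: smooth_charts "cotangent_bundle M" by (rule smooth_charts_cotangent)
  have S: "open (coords c ` U)" "open (coords c ` U \<times> (UNIV :: 'e set))"
    using open_in_mfd_image[OF U(1) c U(2)] by (auto intro: open_Times)
  have sm: "smooth_on (coords c ` U \<times> (UNIV :: 'e set)) (\<lambda>z. (0 :: 'e, form_rep c \<omega> (fst z)))"
    by (intro smooth_on_Pair smooth_on_const smooth_on_fst S \<omega>)
  show ?thesis
  proof (rule N.smooth_vfield_chartI)
    show "cotangent_chart M c \<in> atlas (cotangent_bundle M)" using c by (simp add: atlas_cotangent_bundle)
    show "open_in_mfd (cotangent_bundle M) (cotangent_over U)" by (rule open_in_cotangent[OF U(1)])
    show "cotangent_over U \<subseteq> dom_of (cotangent_chart M c)"
      using U(2) by (auto simp: dom_cotangent_chart cotangent_over_def)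
    show "smooth_on (coords (cotangent_chart M c) ` cotangent_over U)
      (vfield_rep (cotangent_bundle M) (cotangent_chart M c) (vlift_field \<omega>))"
      unfolding cotangent_image[OF c U(2)]
    proof (rule smooth_on_cong[OF S(2) sm])
      fix z assume "z \<in> coords c ` U \<times> (UNIV :: 'e set)"
      then obtain x q where x: "x \<in> U" "z = (coords c x, q)" by auto
      moreover from x have "x \<in> dom_of c" using U(2) by auto
      ultimately show "(0, form_rep c \<omega> (fst z)) = vfield_rep (cotangent_bundle M) (cotangent_chart M c) (vlift_field \<omega>) z"
        by (simp add: vfield_rep_vlift[OF c, of x \<omega>] \<omega>(2) form_rep_def chart_inv_coords[OF c])
    qed
  qed
qed

end

section \<open>Horizontal lifts in arbitrary charts\<close>

context chart_connection
begin

lemma christoffel_gam: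
  assumes "x \<in> points M"
  shows "christoffel M D x k i j = gam (chart_at M x) x i j \<bullet> k"
  using conn_chart_fields[of "chart_at M x" x i j] chart_at[OF assms] tcomp_chart_at[OF assms]
  by (simp add: christoffel_def extension_def)

lemma hlift_gam:
  assumes x: "x \<in> points M" and p: "linear p"
  shows "hlift M D (x, p) v = (v, \<Sum>i\<in>Basis. p (gam (chart_at M x) x i v) *\<^sub>R i)"
proof -
  have "(\<Sum>h\<in>Basis. \<Sum>j\<in>Basis. p h * christoffel M D x h i j * (v \<bullet> j)) = p (gam (chart_at M x) x i v)" for i
  proof -
    let ?G = "gam (chart_at M x) x i"
    have lG: "linear ?G" using bilinear_gam by (simp add: bilinear_def)
    have "p (?G v) = (\<Sum>j\<in>Basis. (v \<bullet> j) *\<^sub>R p (?G j))"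
      using linear_euclidean_expand[OF linear_compose[OF lG p], of v] by (simp add: o_def)
    also have "\<dots> = (\<Sum>j\<in>Basis. \<Sum>h\<in>Basis. p h * (?G j \<bullet> h) * (v \<bullet> j))"
    proof (rule sum.cong[OF refl])
      fix j :: 'e
      show "(v \<bullet> j) *\<^sub>R p (?G j) = (\<Sum>h\<in>Basis. p h * (?G j \<bullet> h) * (v \<bullet> j))"
        using linear_euclidean_expand[OF p, of "?G j"]
        by (simp add: sum_distrib_left mult.commute mult.left_commute)
    qed
    finally show ?thesis
      unfolding christoffel_gam[OF x] by (subst sum.swap) simp
  qed
  then show ?thesis by (simp add: hlift_def)
qed

text \<open>The lift is defined through \<open>chart_at M x\<close>; it has the same shape in every
  chart because the second derivative of the coordinate change in \<open>tcomp_cotangent\<close> is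
  the inhomogeneous term in the transformation law of the Christoffel symbols. Torsion-freeness
  exchanges the lower indices, since the lift contracts its argument with the second one.\<close>

lemma tcomp_hlift:
  assumes tf: "torsion_free M D" and c: "c \<in> atlas M" "x \<in> dom_of c" and p: "linear p"
  shows "tcomp (cotangent_bundle M) (cotangent_chart M c) (x, p) (hlift M D (x, p) v) =
    (tcomp M c x v, \<Sum>i\<in>Basis. (fcomp M c x p \<bullet> gam c x (tcomp M c x v) i) *\<^sub>R i)"
proof -
  define d where "d = chart_at M x"
  have xM: "x \<in> points M" using points_of_chart[OF c] .
  have d: "d \<in> atlas M" "x \<in> dom_of d" using chart_at[OF xM] by (auto simp: d_def)
  have comp_d: "tcomp M d x w = w" for w using tcomp_chart_at[OF xM] by (simp add: d_def)
  let ?U = "dom_of c \<inter> dom_of d"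
  have U: "open_in_mfd M ?U"
    by (intro open_in_mfd_Int open_in_mfd_dom c(1) d(1))
  define a where "a = tcomp M c x v"
  have va: "v = tvec M c x a" by (simp add: a_def tvec_tcomp[OF c])
  let ?E = "\<lambda>a y. tvec M c y a"
  have E: "smooth_vfield_on M ?U (?E a)" for a
    using smooth_vfield_subset[OF smooth_chart_field[OF c(1)]] by blast
  let ?W = "\<lambda>i. frechet_derivative (vfield_rep M d (?E i)) (at (coords d x))"
  have "p (gam d x (tvec M c x i) v) + p (?W i v) = fcomp M c x p \<bullet> gam c x a i" for i
  proof -
    \<comment> \<open>The transformation law: the derivative of one coordinate field of
      \<open>c\<close> along another is computed in \<open>d\<close> and in \<open>c\<close>, and
      the results are compared.\<close>
    have "D (?E a) (?E i) x = ?W i v + gam d x v (tvec M c x i)"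
      using conn_chart[OF d(1) U _ _ E E, of x a i] c d by (simp add: comp_d va)
    moreover have "D (?E a) (?E i) x = tvec M c x (gam c x a i)"
      using conn_chart_fields[OF c, of a i] tvec_tcomp[OF c] by metis
    ultimately have "p (tvec M c x (gam c x a i)) = p (?W i v) + p (gam d x v (tvec M c x i))"
      using linear_add[OF p] by metis
    then show ?thesis by (simp add: fcomp_inner[OF c p] gam_sym[OF tf d, of v])
  qed
  moreover have "(\<Sum>i\<in>Basis. p (gam d x i v) *\<^sub>R i) \<bullet> w = p (gam d x w v)" for w
  proof -
    have "linear (\<lambda>w. p (gam d x w v))"
      using linear_compose[OF _ p, of "\<lambda>w. gam d x w v"] bilinear_gam by (simp add: bilinear_def o_def)
    from linear_functional_rep[OF this] show ?thesis .
  qed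
  ultimately show ?thesis
    unfolding tcomp_cotangent[OF c p] hlift_gam[OF xM p] d_def[symmetric]
    by (simp add: a_def)
qed

lemma vfield_rep_hlift:
  assumes tf: "torsion_free M D" and c: "c \<in> atlas M" "x \<in> dom_of c"
  shows "vfield_rep (cotangent_bundle M) (cotangent_chart M c) (hlift_field M D X) (coords c x, q) =
    (tcomp M c x (X x), \<Sum>i\<in>Basis. (q \<bullet> gam c x (tcomp M c x (X x)) i) *\<^sub>R i)"
  unfolding vfield_rep_def cotangent_chart_inv[OF c] hlift_field_def
  by (simp add: tcomp_hlift[OF tf c linear_inner_tcomp[OF c]] fcomp_inner_tcomp_form[OF c])

lemma smooth_hlift_field:
  assumes tf: "torsion_free M D" and c: "c \<in> atlas M" and U: "open_in_mfd M U" "U \<subseteq> dom_of c"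
    and X: "smooth_vfield_on M U X"
  shows "smooth_vfield_on (cotangent_bundle M) (cotangent_over U) (hlift_field M D X)"
proof -
  interpret N: smooth_charts "cotangent_bundle M" by (rule smooth_charts_cotangent)
  have S: "open (coords c ` U)" "open (coords c ` U \<times> (UNIV :: 'e set))"
    using open_in_mfd_image[OF U(1) c U(2)] by (auto intro: open_Times)
  have lin: "linear (\<lambda>v. gam c y v i)" for y i using bilinear_gam by (simp add: bilinear_def)
  have g: "smooth_on (coords c ` U) (\<lambda>u. gam c (chart_inv c u) (vfield_rep M c X u) i)" for i
    by (rule smooth_on_linear_family[OF S(1) lin smooth_on_subset[OF smooth_gam[OF c]] smooth_vfield_chartD[OF X c U(2)]])
      (use U(2) in auto)
  have sm: "smooth_on (coords c ` U \<times> (UNIV :: 'e set)) (\<lambda>z. (vfield_rep M c X (fst z),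
      \<Sum>i\<in>Basis. (snd z \<bullet> gam c (chart_inv c (fst z)) (vfield_rep M c X (fst z)) i) *\<^sub>R i))"
    by (intro smooth_on_Pair smooth_on_sum smooth_on_scaleR smooth_on_inner smooth_on_const S
       smooth_on_fst[OF S(1) smooth_vfield_chartD[OF X c U(2)]] smooth_on_fst[OF S(1) g]
       smooth_on_bounded_linear[OF S(2) bounded_linear_snd])
  show ?thesis
  proof (rule N.smooth_vfield_chartI)
    show "cotangent_chart M c \<in> atlas (cotangent_bundle M)" using c by (simp add: atlas_cotangent_bundle)
    show "open_in_mfd (cotangent_bundle M) (cotangent_over U)" by (rule open_in_cotangent[OF U(1)])
    show "cotangent_over U \<subseteq> dom_of (cotangent_chart M c)"
      using U(2) by (auto simp: dom_cotangent_chart cotangent_over_def)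
    show "smooth_on (coords (cotangent_chart M c) ` cotangent_over U)
      (vfield_rep (cotangent_bundle M) (cotangent_chart M c) (hlift_field M D X))"
      unfolding cotangent_image[OF c U(2)]
    proof (rule smooth_on_cong[OF S(2) sm])
      fix z assume "z \<in> coords c ` U \<times> (UNIV :: 'e set)"
      then obtain x q where x: "x \<in> U" "z = (coords c x, q)" by auto
      moreover from x have "x \<in> dom_of c" using U(2) by auto
      ultimately show "(vfield_rep M c X (fst z), \<Sum>i\<in>Basis. (snd z \<bullet> gam c (chart_inv c (fst z)) (vfield_rep M c X (fst z)) i) *\<^sub>R i) =
         vfield_rep (cotangent_bundle M) (cotangent_chart M c) (hlift_field M D X) z"
        by (simp add: vfield_rep_hlift[OF tf c] vfield_rep_coords[OF c] chart_inv_coords[OF c])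
    qed
  qed
qed

end

section \<open>Kaehler geometry in coordinates\<close>

text \<open>\<open>G u v w\<close> is \<open>\<Gamma>\<^sup>k\<^sub>i\<^sub>j v\<^sup>i w\<^sup>j\<close>, and \<open>deriv_g\<close> and \<open>deriv_J\<close> say that \<open>g\<close> and \<open>J\<close> are parallel.\<close>

locale kaehler_coords =
  fixes S :: "'e::euclidean_space set" and G :: "'e \<Rightarrow> 'e \<Rightarrow> 'e \<Rightarrow> 'e"
    and g :: "'e \<Rightarrow> 'e \<Rightarrow> 'e \<Rightarrow> real" and J :: "'e \<Rightarrow> 'e \<Rightarrow> 'e"
  assumes open_S: "open S"
    and bilinear_G: "u \<in> S \<Longrightarrow> bilinear (G u)" and G_sym: "u \<in> S \<Longrightarrow> G u v w = G u w v"
    and smooth_G: "smooth_on S (\<lambda>u. G u v w)"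
    and bilinear_g: "u \<in> S \<Longrightarrow> bilinear (g u)" and g_sym: "u \<in> S \<Longrightarrow> g u v w = g u w v"
    and g_pos: "u \<in> S \<Longrightarrow> v \<noteq> 0 \<Longrightarrow> g u v v > 0"
    and smooth_g: "smooth_on S (\<lambda>u. g u v w)"
    and deriv_g: "u \<in> S \<Longrightarrow> ((\<lambda>u. g u v w) has_derivative (\<lambda>a. g u (G u a v) w + g u v (G u a w))) (at u)"
    and linear_J: "u \<in> S \<Longrightarrow> linear (J u)" and J_J: "u \<in> S \<Longrightarrow> J u (J u v) = - v"
    and g_J_J: "u \<in> S \<Longrightarrow> g u (J u v) (J u w) = g u v w"
    and deriv_J: "u \<in> S \<Longrightarrow> ((\<lambda>u. J u w) has_derivative (\<lambda>a. J u (G u a w) - G u a (J u w))) (at u)"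
begin

lemma
  assumes "u \<in> S"
  shows linear_g_left: "linear (\<lambda>v. g u v w)" and linear_g_right: "linear (g u v)"
    and linear_G_left: "linear (\<lambda>v. G u v w)" and linear_G_right: "linear (G u v)"
  using bilinear_g[OF assms] bilinear_G[OF assms] by (auto simp: bilinear_def)

lemma
  assumes "u \<in> S"
  shows g_add_left: "g u (v + v') w = g u v w + g u v' w" and g_add_right: "g u w (v + v') = g u w v + g u w v'"
    and g_diff_left: "g u (v - v') w = g u v w - g u v' w"
    and g_scale_left: "g u (a *\<^sub>R v) w = a * g u v w"
    and g_minus_left: "g u (- v) w = - g u v w" and g_minus_right: "g u w (- v) = - g u w v"
    and g_zero_left: "g u 0 w = 0" and g_zero_right: "g u w 0 = 0"
proof -
  note L = linear_g_left[OF assms, of w] and R = linear_g_right[OF assms, of w]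
  show "g u (v + v') w = g u v w + g u v' w" "g u w (v + v') = g u w v + g u w v'"
    "g u (v - v') w = g u v w - g u v' w" "g u (a *\<^sub>R v) w = a * g u v w"
    "g u (- v) w = - g u v w" "g u w (- v) = - g u w v" "g u 0 w = 0" "g u w 0 = 0"
    using linear_add[OF L] linear_add[OF R] linear_diff[OF L] linear_scale[OF L]
      linear_neg[OF L] linear_neg[OF R] linear_0[OF L] linear_0[OF R] by simp_all
qed

section \<open>Curvature identities in coordinates\<close>

definition dG :: "'e \<Rightarrow> 'e \<Rightarrow> 'e \<Rightarrow> 'e \<Rightarrow> 'e" where
  "dG u a v w = frechet_derivative (\<lambda>u. G u v w) (at u) a"

lemma deriv_G: "u \<in> S \<Longrightarrow> ((\<lambda>u. G u v w) has_derivative (\<lambda>a. dG u a v w)) (at u)"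
  unfolding dG_def by (rule smooth_on_has_derivative[OF smooth_G open_S])

lemma dG_sym:
  assumes "u \<in> S"
  shows "dG u a v w = dG u a w v"
proof -
  have "((\<lambda>u. G u v w) has_derivative (\<lambda>a. dG u a w v)) (at u)"
    by (rule has_derivative_transform_within_open[OF deriv_G[OF assms] open_S assms]) (rule G_sym)
  from has_derivative_unique[OF this deriv_G[OF assms]] show ?thesis by metis
qed

lemma linear_dG_right:
  assumes u: "u \<in> S"
  shows "linear (dG u a v)"
proof (rule linearI)
  fix w w' and r :: real
  have "((\<lambda>u. G u v (w + w')) has_derivative (\<lambda>a. dG u a v w + dG u a v w')) (at u)"
    by (rule has_derivative_transform_within_open[OF has_derivative_add[OF deriv_G[OF u] deriv_G[OF u]] open_S u])
      (simp add: linear_add[OF linear_G_right])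
  from has_derivative_unique[OF this deriv_G[OF u]] show "dG u a v (w + w') = dG u a v w + dG u a v w'" by metis
  have "((\<lambda>u. G u v (r *\<^sub>R w)) has_derivative (\<lambda>a. r *\<^sub>R dG u a v w)) (at u)"
    by (rule has_derivative_transform_within_open[OF has_derivative_scaleR_right[OF deriv_G[OF u]] open_S u])
      (simp add: linear_scale[OF linear_G_right])
  from has_derivative_unique[OF this deriv_G[OF u]] show "dG u a v (r *\<^sub>R w) = r *\<^sub>R dG u a v w" by metis
qed

text \<open>The curvature tensor in coordinates: second covariant derivatives of a constant field
  along constant fields, antisymmetrised; the bracket of constant fields vanishes.\<close>

definition curv :: "'e \<Rightarrow> 'e \<Rightarrow> 'e \<Rightarrow> 'e \<Rightarrow> 'e" where
  "curv u a b w = dG u a b w - dG u b a w + G u a (G u b w) - G u b (G u a w)"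

lemma linear_curv: "u \<in> S \<Longrightarrow> linear (curv u a b)"
  unfolding curv_def
  by (rule linearI) (simp_all add: linear_add[OF linear_dG_right] linear_add[OF linear_G_right]
    linear_scale[OF linear_dG_right] linear_scale[OF linear_G_right] algebra_simps)

lemma curv_antisym: "curv u a b w = - curv u b a w"
  by (simp add: curv_def)

lemma bianchi: "u \<in> S \<Longrightarrow> curv u a b w + curv u b w a + curv u w a b = 0"
  by (simp add: curv_def G_sym[of u a b] G_sym[of u w a] G_sym[of u w b] dG_sym[of u _ b a] dG_sym[of u _ w a] dG_sym[of u _ w b])

text \<open>The second derivatives of \<open>g u w z\<close> in \<open>u\<close> commute. After
  expansion by \<open>deriv_g\<close>, the terms with one \<open>G\<close> on each argument are
  symmetric in the two directions, and what remains is the asserted sum.\<close>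

lemma curv_skew:
  assumes u: "u \<in> S"
  shows "g u (curv u a b w) z + g u (curv u a b z) w = 0"
proof -
  let ?F = "\<lambda>b u. g u (G u b w) z + g u w (G u b z)"
  have dF: "(?F b has_derivative (\<lambda>a. (g u (G u a (G u b w)) z + g u (G u b w) (G u a z) + g u (dG u a b w) z)
      + (g u (G u a w) (G u b z) + g u w (G u a (G u b z)) + g u w (dG u a b z)))) (at u)" for b
    by (intro has_derivative_add
      has_derivative_linear_family[where L="\<lambda>u v. g u v z", OF open_S u linear_g_left deriv_g[OF u] deriv_G[OF u]]
      has_derivative_linear_family[where L="\<lambda>u v. g u w v", OF open_S u linear_g_right deriv_g[OF u] deriv_G[OF u]])
  have "frechet_derivative (\<lambda>u. frechet_derivative (\<lambda>u. g u w z) (at u) b) (at u) a =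
      (g u (G u a (G u b w)) z + g u (G u b w) (G u a z) + g u (dG u a b w) z)
      + (g u (G u a w) (G u b z) + g u w (G u a (G u b z)) + g u w (dG u a b z))" for a b
  proof -
    have "((\<lambda>u. frechet_derivative (\<lambda>u. g u w z) (at u) b) has_derivative
      (\<lambda>a. (g u (G u a (G u b w)) z + g u (G u b w) (G u a z) + g u (dG u a b w) z)
      + (g u (G u a w) (G u b z) + g u w (G u a (G u b z)) + g u w (dG u a b z)))) (at u)"
      by (rule has_derivative_transform_within_open[OF dF open_S u]) (simp add: frechet_derivativeI[OF deriv_g])
    from frechet_derivativeI[OF this] show ?thesis by simp
  qed
  with second_derivative_symmetric[OF open_S smooth_g u, of w z b a] show ?thesis
    by (simp add: curv_def g_add_left[OF u] g_diff_left[OF u] g_sym[OF u, of w])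
qed

lemma curv_pair_sym:
  assumes u: "u \<in> S"
  shows "g u (curv u a b v) w = g u (curv u v w a) b"
proof -
  let ?R = "\<lambda>a b v w. g u (curv u a b v) w"
  have s1: "?R a b v w = - ?R b a v w" for a b v w
    by (subst curv_antisym) (rule g_minus_left[OF u])
  have s2: "?R a b v w = - ?R a b w v" for a b v w
    using curv_skew[OF u, of a b v w] by simp
  have s3: "?R a b v w + ?R b v a w + ?R v a b w = 0" for a b v w
    using arg_cong[OF bianchi[OF u, of a b v], of "\<lambda>z. g u z w"] by (simp add: g_add_left[OF u] g_zero_left[OF u])
  show ?thesis
    \<comment> \<open>Four Bianchi identities, in which each of the four vectors is the fixed last
      argument once; the skew symmetries cancel the other terms of their sum.\<close>
    using s3[of a w b v] s3[of w b v a] s3[of b v a w] s3[of v a w b]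
      s2[of w b a v] s2[of b v w a] s2[of v a b w] s2[of a w b v] s1[of b a w v] s2[of a b w v]
      s1[of v w b a] s2[of w v b a] s2[of v w b a]
    by linarith
qed

section \<open>Raising and lowering indices, and parallelism of the inverse metric\<close>

definition K :: "'e \<Rightarrow> 'e \<Rightarrow> 'e" where
  "K u q = (THE v. \<forall>w. g u v w = q \<bullet> w)"

lemma g_eqI:
  assumes u: "u \<in> S" and "\<And>w. g u v w = g u v' w"
  shows "v = v'"
  using assms(2)[of "v - v'"] g_pos[OF u, of "v - v'"] by (auto simp: g_diff_left[OF u])

definition lower :: "'e \<Rightarrow> 'e \<Rightarrow> 'e" where
  "lower u v = (\<Sum>i\<in>Basis. g u v i *\<^sub>R i)"

lemma lower_inner: "u \<in> S \<Longrightarrow> lower u v \<bullet> w = g u v w"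
  unfolding lower_def by (rule linear_functional_rep[OF linear_g_right])

lemma linear_lower: "u \<in> S \<Longrightarrow> linear (lower u)"
  unfolding lower_def
  by (rule linearI) (simp_all add: g_add_left g_scale_left algebra_simps sum.distrib scaleR_sum_right)

text \<open>Lowering an index is injective by positive definiteness, hence surjective in finite
  dimension; so the description defining \<open>K\<close> denotes a vector.\<close>

lemma g_K:
  assumes u: "u \<in> S"
  shows "g u (K u q) w = q \<bullet> w"
proof -
  have "inj (lower u)"
    using g_eqI[OF u] lower_inner[OF u] by (metis injI)
  then have "surj (lower u)"
    using linear_injective_imp_surjective[OF linear_lower[OF u]] by blast
  then obtain v where "q = lower u v" by (rule surjE)
  then have "\<forall>w. g u v w = q \<bullet> w" using lower_inner[OF u] by simp
  then have "\<exists>!v. \<forall>w. g u v w = q \<bullet> w"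
    by (intro ex1I[of _ v] g_eqI[OF u]) simp_all
  from theI'[OF this] have "\<forall>w. g u (K u q) w = q \<bullet> w"
    unfolding K_def .
  then show ?thesis by blast
qed

lemma K_eqI:
  assumes "u \<in> S" "\<And>w. g u v w = q \<bullet> w"
  shows "K u q = v"
  by (rule g_eqI[OF assms(1)]) (simp add: g_K assms)

lemma linear_K: "u \<in> S \<Longrightarrow> linear (K u)"
  by (rule linearI) (auto intro!: K_eqI simp: g_add_left g_scale_left g_K inner_add_left)

lemma lower_K: "u \<in> S \<Longrightarrow> lower u (K u q) = q"
  by (rule euclidean_eqI) (simp add: lower_inner g_K)

lemma K_lower: "u \<in> S \<Longrightarrow> K u (lower u v) = v"
  by (rule K_eqI) (simp_all add: lower_inner)

lemma inner_K_sym: "u \<in> S \<Longrightarrow> a \<bullet> K u b = b \<bullet> K u a"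
  using g_K[of u a "K u b"] g_K[of u b "K u a"] g_sym by metis

lemma g_J_skew: "u \<in> S \<Longrightarrow> g u (J u v) w = - g u v (J u w)"
  using g_J_J[of u v "J u w"] by (simp add: J_J g_minus_right)

text \<open>The skewness of \<open>J\<close> carried over to covectors; it produces the sign changes
  in the derivative of one vertical lift along another.\<close>

lemma K_J:
  assumes u: "u \<in> S"
  shows "a \<bullet> J u (K u b) = - (b \<bullet> J u (K u a))"
  using g_J_skew[OF u, of "K u a" "K u b"] g_sym[OF u, of "J u (K u a)" "K u b"] by (simp add: g_K[OF u])

text \<open>In indices \<open>q_h Gamma^h_ij v^j\<close>. This is both the fibre part of the
  horizontal lift of \<open>v\<close> at \<open>q\<close> and the correction that turns the
  derivative of a form into its covariant derivative.\<close>

definition N :: "'e \<Rightarrow> 'e \<Rightarrow> 'e \<Rightarrow> 'e" where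
  "N u v q = (\<Sum>i\<in>Basis. (q \<bullet> G u v i) *\<^sub>R i)"

lemma N_inner:
  assumes "u \<in> S"
  shows "N u v q \<bullet> w = q \<bullet> G u v w"
  using linear_functional_rep[OF linear_compose[OF linear_G_right[OF assms, of v] bounded_linear.linear[OF bounded_linear_inner_right[of q]]]]
  by (simp add: N_def o_def)

lemma linear_N_left: "u \<in> S \<Longrightarrow> linear (\<lambda>v. N u v q)"
  by (rule linearI; rule euclidean_eqI)
    (simp_all add: N_inner inner_add_left inner_add_right linear_add[OF linear_G_left] linear_scale[OF linear_G_left])

text \<open>\<open>K\<close> raises an index.  Its differentiability comes from the inverse function theorem applied to
  \<open>(u, v) \<mapsto> (u, g\<^sub>u(v, \<cdot>))\<close>.\<close>

lemma deriv_K: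
  assumes u: "u \<in> S"
  shows "((\<lambda>z. K (fst z) (snd z)) has_derivative (\<lambda>h. K u (snd h - N u (fst h) q) - G u (fst h) (K u q))) (at (u, q))"
proof -
  define f where "f z = (fst z, lower (fst z) (snd z))" for z :: "'e \<times> 'e"
  define f' where "f' v h = (fst h, \<Sum>i\<in>Basis. (g u (G u (fst h) v) i + g u v (G u (fst h) i) + g u (snd h) i) *\<^sub>R i)" for v h
  define k where "k z = (fst z, K (fst z) (snd z))" for z
  \<comment> \<open>Found by differentiating \<open>g u v w = q \<bullet> w\<close> with
    \<open>v = K u q\<close>: by \<open>deriv_g\<close> the derivative of \<open>v\<close> pairs
    with \<open>w\<close> as \<open>snd h - N u (fst h) q\<close> does, up to the term
    \<open>G u (fst h) v\<close>.\<close>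
  define k' where "k' h = (fst h, K u (snd h - N u (fst h) q) - G u (fst h) (K u q))" for h
  have T: "open (S \<times> (UNIV :: 'e set))" using open_S by (simp add: open_Times)
  have df: "((\<lambda>z. (fst z, lower (fst z) (snd z))) has_derivative (\<lambda>h. (fst h, \<Sum>i\<in>Basis. (g w (G w (fst h) v) i + g w v (G w (fst h) i) + g w (snd h) i) *\<^sub>R i))) (at (w, v))"
    if w: "w \<in> S" for w v
  proof -
    have 1: "((\<lambda>z::'e\<times>'e. g (fst z) b i) has_derivative (\<lambda>h. g w (G w (fst h) b) i + g w b (G w (fst h) i))) (at (w, v))" for b i
      by (rule has_derivative_compose[where g="\<lambda>u. g u b i", OF bounded_linear_imp_has_derivative[OF bounded_linear_fst]])
        (simp add: deriv_g[OF w])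
    have "((\<lambda>z. g (fst z) (snd z) i) has_derivative (\<lambda>h. g w (G w (fst h) v) i + g w v (G w (fst h) i) + g w (snd h) i)) (at (w, v))" for i
      using has_derivative_linear_family[where L="\<lambda>z v. g (fst z) v i" and X=snd and X'=snd, OF T _ _ 1
        bounded_linear_imp_has_derivative[OF bounded_linear_snd]] w linear_g_left by auto
    then show ?thesis
      unfolding lower_def by (auto intro!: derivative_eq_intros)
  qed
  have "(k has_derivative k') (at (f (u, K u q)))"
  proof (rule has_derivative_inverse_strong[where f=f and x="(u, K u q)" and f' = "f' (K u q)" and S="S \<times> UNIV"])
    show "continuous_on (S \<times> UNIV) f"
      by (rule continuous_at_imp_continuous_on) (auto simp: f_def[abs_def] intro: has_derivative_continuous[OF df])
    show "k (f z) = z" if "z \<in> S \<times> UNIV" for z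
      using that by (auto simp: k_def f_def K_lower)
    show "(f has_derivative f' (K u q)) (at (u, K u q))"
      using df[OF u] by (simp add: f_def[abs_def] f'_def[abs_def])
    show "f' (K u q) \<circ> k' = id"
    proof
      fix h :: "'e \<times> 'e"
      have "snd (f' (K u q) (k' h)) = snd h"
        by (rule euclidean_eqI)
          (simp add: f'_def k'_def g_diff_left[OF u] g_K[OF u] inner_diff_left N_inner[OF u])
      then show "(f' (K u q) \<circ> k') h = id h" by (simp add: prod_eq_iff f'_def k'_def)
    qed
  qed (use u T in auto)
  then have "((\<lambda>z. snd (k z)) has_derivative (\<lambda>h. snd (k' h))) (at (u, q))"
    by (intro has_derivative_snd) (simp add: f_def lower_K[OF u])
  then show ?thesis by (simp add: k_def k'_def)
qed

text \<open>The Christoffel terms of \<open>deriv_K\<close> regroup into covariant derivatives of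
  the two forms. The function is taken on pairs because the derivative is later needed on the
  bundle.\<close>

lemma deriv_inner_K:
  assumes u: "u \<in> S" and \<omega>: "(\<omega> has_derivative \<omega>') (at u)" and \<theta>: "(\<theta> has_derivative \<theta>') (at u)"
  shows "((\<lambda>z. \<omega> (fst z) \<bullet> K (fst z) (\<theta> (fst z))) has_derivative
    (\<lambda>h. (\<omega>' (fst h) - N u (fst h) (\<omega> u)) \<bullet> K u (\<theta> u) + (\<theta>' (fst h) - N u (fst h) (\<theta> u)) \<bullet> K u (\<omega> u))) (at (u, q :: 'e))"
proof -
  have fst: "((fst :: 'e \<times> 'e \<Rightarrow> 'e) has_derivative fst) (at (u, q))" by (rule bounded_linear_imp_has_derivative[OF bounded_linear_fst])
  have o: "((\<lambda>z::'e\<times>'e. \<omega> (fst z)) has_derivative (\<lambda>h. \<omega>' (fst h))) (at (u, q))"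
    by (rule has_derivative_compose[where g=\<omega>, OF fst]) (simp add: \<omega>)
  have t: "((\<lambda>z::'e\<times>'e. \<theta> (fst z)) has_derivative (\<lambda>h. \<theta>' (fst h))) (at (u, q))"
    by (rule has_derivative_compose[where g=\<theta>, OF fst]) (simp add: \<theta>)
  have "((\<lambda>z. K (fst z) (\<theta> (fst z))) has_derivative (\<lambda>h. K u (\<theta>' (fst h) - N u (fst h) (\<theta> u)) - G u (fst h) (K u (\<theta> u)))) (at (u, q))"
    by (rule has_derivative_eq_rhs[OF has_derivative_compose[where g="\<lambda>z. K (fst z) (snd z)", OF has_derivative_Pair[OF fst t], simplified, OF deriv_K[OF u]]]) simp
  from has_derivative_inner[OF o this] show ?thesis
    by (rule has_derivative_eq_rhs)
      (simp add: fun_eq_iff inner_diff_left inner_diff_right N_inner[OF u] linear_diff[OF linear_K[OF u]] inner_K_sym[OF u, of "\<omega> u"])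
qed

text \<open>Up to sign this is the pairing of the form with pJ. The last summand sees only the
  vertical part \<open>snd h - N u (fst h) q\<close> of the direction, so along horizontal
  directions only the form is differentiated, covariantly.\<close>

lemma deriv_inner_J_K:
  assumes u: "u \<in> S" and \<omega>: "(\<omega> has_derivative \<omega>') (at u)"
  shows "((\<lambda>z. \<omega> (fst z) \<bullet> J (fst z) (K (fst z) (snd z))) has_derivative
    (\<lambda>h. (\<omega>' (fst h) - N u (fst h) (\<omega> u)) \<bullet> J u (K u q) + \<omega> u \<bullet> J u (K u (snd h - N u (fst h) q)))) (at (u, q))"
proof -
  have T: "open (S \<times> (UNIV :: 'e set))" using open_S by (simp add: open_Times)
  have fst: "((fst :: 'e \<times> 'e \<Rightarrow> 'e) has_derivative fst) (at (u, q))" by (rule bounded_linear_imp_has_derivative[OF bounded_linear_fst])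
  have o: "((\<lambda>z::'e\<times>'e. \<omega> (fst z)) has_derivative (\<lambda>h. \<omega>' (fst h))) (at (u, q))"
    by (rule has_derivative_compose[where g=\<omega>, OF fst]) (simp add: \<omega>)
  have j: "((\<lambda>z::'e\<times>'e. J (fst z) w) has_derivative (\<lambda>h. J u (G u (fst h) w) - G u (fst h) (J u w))) (at (u, q))" for w
    by (rule has_derivative_compose[where g="\<lambda>u. J u w", OF fst]) (simp add: deriv_J[OF u])
  have "((\<lambda>z. J (fst z) (K (fst z) (snd z))) has_derivative
     (\<lambda>h. (J u (G u (fst h) (K u q)) - G u (fst h) (J u (K u q))) + J u (K u (snd h - N u (fst h) q) - G u (fst h) (K u q)))) (at (u, q))"
    using has_derivative_linear_family[where L="\<lambda>z. J (fst z)", OF T _ _ j deriv_K[OF u, of q]] u linear_J by auto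
  from has_derivative_inner[OF o this] show ?thesis
    by (rule has_derivative_eq_rhs)
      (simp add: fun_eq_iff inner_diff_left inner_diff_right inner_add_right N_inner[OF u] linear_diff[OF linear_J[OF u]])
qed

end

section \<open>Kaehler manifolds in charts\<close>

lemma lie_bracket_antisym: "lie_bracket M Y X x = - lie_bracket M X Y x"
  by (simp add: lie_bracket_def Let_def)

lemma (in smooth_charts) smooth_form_subset:
  assumes "smooth_form_on M U \<omega>" "V \<subseteq> U"
  shows "smooth_form_on M V \<omega>"
  using assms unfolding smooth_form_on_def
  by (meson Int_mono image_mono order_refl smooth_on_subset subsetD)

text \<open>Metric compatibility is added for \<open>X\<close> and \<open>Y\<close> and subtracted
  for \<open>Z\<close>; torsion-freeness rewrites the brackets. Algebraic properties of the metric
  are requested at \<open>x\<close> only, where \<open>berger_sasaki\<close> has the explicit form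
  \<open>BS_eq\<close>.\<close>

lemma koszul:
  assumes lc: "levi_civita_connection M g D" and U: "open_in_mfd M U" "x \<in> U"
    and X: "smooth_vfield_on M U X" and Y: "smooth_vfield_on M U Y" and Z: "smooth_vfield_on M U Z"
    and g: "\<And>a b c. g x (a - b) c = g x a c - g x b c" "\<And>a b. g x a b = g x b a"
  shows "2 * g x (D X Y x) (Z x) =
    dir_deriv M x (X x) (\<lambda>y. g y (Y y) (Z y)) + dir_deriv M x (Y x) (\<lambda>y. g y (X y) (Z y))
    - dir_deriv M x (Z x) (\<lambda>y. g y (X y) (Y y))
    + g x (lie_bracket M X Y x) (Z x) - g x (lie_bracket M X Z x) (Y x) - g x (lie_bracket M Y Z x) (X x)"
proof -
  have mc: "dir_deriv M x (A x) (\<lambda>y. g y (B y) (C y)) = g x (D A B x) (C x) + g x (B x) (D A C x)"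
    if "smooth_vfield_on M U A" "smooth_vfield_on M U B" "smooth_vfield_on M U C" for A B C
    using lc that U unfolding levi_civita_connection_def metric_compatible_def by blast
  have tf: "lie_bracket M A B x = D A B x - D B A x" if "smooth_vfield_on M U A" "smooth_vfield_on M U B" for A B
    using lc that U unfolding levi_civita_connection_def torsion_free_def by metis
  show ?thesis
    unfolding mc[OF X Y Z] mc[OF Y X Z] mc[OF Z X Y] tf[OF X Y] tf[OF X Z] tf[OF Y Z] g(1)
    using g(2)[of "Y x"] g(2)[of "X x"] by simp
qed

locale kaehler = chart_connection M D
  for M :: "('a, 'e::euclidean_space) manifold" and D +
  fixes J :: "'a \<Rightarrow> 'e \<Rightarrow> 'e" and g :: "'a \<Rightarrow> 'e \<Rightarrow> 'e \<Rightarrow> real"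
  assumes kaehler: "standard_kaehler M J g D"
begin

lemma torsion_free: "torsion_free M D" and metric_compatible: "metric_compatible M g D"
  and parallel_J: "parallel_endomorphism M D J" and riemannian: "riemannian_metric M g"
  and complex_J: "almost_complex_structure M J"
  using kaehler by (auto simp: standard_kaehler_def levi_civita_connection_def)

lemma
  assumes "x \<in> points M"
  shows bilinear_metric: "bilinear (g x)" and metric_sym: "g x v w = g x w v"
    and metric_pos: "v \<noteq> 0 \<Longrightarrow> g x v v > 0"
    and linear_complex: "linear (J x)" and complex_sq: "J x (J x v) = - v"
    and metric_complex: "g x (J x v) (J x w) = g x v w"
  using assms kaehler
  by (auto simp: standard_kaehler_def riemannian_metric_def almost_complex_structure_def)

definition gc :: "('a, 'e) chart \<Rightarrow> 'e \<Rightarrow> 'e \<Rightarrow> 'e \<Rightarrow> real" where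
  "gc c u v w = g (chart_inv c u) (tvec M c (chart_inv c u) v) (tvec M c (chart_inv c u) w)"

definition Jc :: "('a, 'e) chart \<Rightarrow> 'e \<Rightarrow> 'e \<Rightarrow> 'e" where
  "Jc c u v = tcomp M c (chart_inv c u) (J (chart_inv c u) (tvec M c (chart_inv c u) v))"

abbreviation Gc :: "('a, 'e) chart \<Rightarrow> 'e \<Rightarrow> 'e \<Rightarrow> 'e \<Rightarrow> 'e" where
  "Gc c \<equiv> \<lambda>u. gam c (chart_inv c u)"

text \<open>Metric compatibility and parallelism of \<open>J\<close>, evaluated on coordinate
  fields, are the two derivative formulas; smoothness on basis vectors extends to all constant
  vectors by linearity.\<close>

lemma kaehler_coords:
  assumes c: "c \<in> atlas M"
  shows "kaehler_coords (coords c ` dom_of c) (Gc c) (gc c) (Jc c)"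
proof -
  let ?S = "coords c ` dom_of c"
  have S: "open ?S" by (rule open_chart_image[OF c])
  have mem: "chart_inv c u \<in> dom_of c" "chart_inv c u \<in> points M" "coords c (chart_inv c u) = u" if "u \<in> ?S" for u
    using chart_inv_mem[OF c order_refl that] points_of_chart[OF c] coords_chart_inv[OF that] by auto
  have bil: "bilinear (gc c u)" if u: "u \<in> ?S" for u
  proof -
    have l: "linear (\<lambda>v. g (chart_inv c u) v w)" "linear (g (chart_inv c u) v)" for v w
      using bilinear_metric[OF mem(2)[OF u]] by (auto simp: bilinear_def)
    show ?thesis
      unfolding bilinear_def gc_def
      by (intro allI conjI linear_compose[OF linear_tvec[OF c mem(1)[OF u]] l(1), unfolded o_def]
        linear_compose[OF linear_tvec[OF c mem(1)[OF u]] l(2), unfolded o_def])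
  qed
  have linJ: "linear (Jc c u)" if "u \<in> ?S" for u
    using linear_compose[OF linear_compose[OF linear_tvec[OF c mem(1)[OF that]] linear_complex[OF mem(2)[OF that]]]
      linear_tcomp[OF c mem(1)[OF that]]]
    unfolding Jc_def by (simp add: o_def)
  have sg0: "smooth_on ?S (\<lambda>u. gc c u a b)" if "a \<in> Basis" "b \<in> Basis" for a b
    using riemannian c that unfolding riemannian_metric_def gc_def by blast
  have sg1: "smooth_on ?S (\<lambda>u. gc c u a w)" if "a \<in> Basis" for a w
    by (rule smooth_on_linear_family[where L="\<lambda>u w. gc c u a w", OF S _ sg0 smooth_on_const[OF S]])
      (use bil that in \<open>auto simp: bilinear_def\<close>)
  have sg: "smooth_on ?S (\<lambda>u. gc c u v w)" for v w
    by (rule smooth_on_linear_family[where L="\<lambda>u v. gc c u v w", OF S _ sg1 smooth_on_const[OF S]])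
      (use bil in \<open>auto simp: bilinear_def\<close>)
  have sJ0: "smooth_on ?S (\<lambda>u. Jc c u b)" if "b \<in> Basis" for b
    using complex_J c that unfolding almost_complex_structure_def Jc_def by blast
  have sJ: "smooth_on ?S (\<lambda>u. Jc c u w)" for w
    by (rule smooth_on_linear_family[where L="\<lambda>u w. Jc c u w", OF S linJ sJ0 smooth_on_const[OF S]])
  have dc: "open_in_mfd M (dom_of c)" by (rule open_in_mfd_dom[OF c])
  let ?E = "\<lambda>a z. tvec M c z a"
  note E = smooth_chart_field[OF c]
  have conn_E: "D (?E a) (?E b) y = tvec M c y (gam c y a b)" if "y \<in> dom_of c" for a b y
    using conn_chart_fields[OF c that, of a b] tvec_tcomp[OF c that] by metis
  show ?thesis
  proof (rule kaehler_coords.intro)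
    fix u v w assume u: "u \<in> ?S"
    define y where "y = chart_inv c u"
    have y: "y \<in> dom_of c" "y \<in> points M" "coords c y = u" using mem[OF u] by (auto simp: y_def)
    show "linear (Jc c u)" by (rule linJ[OF u])
    show "bilinear (Gc c u)" by (rule bilinear_gam)
    show "Gc c u v w = Gc c u w v" using gam_sym[OF torsion_free c y(1)] by (simp add: y_def)
    show "gc c u v w = gc c u w v" unfolding gc_def by (rule metric_sym[OF mem(2)[OF u]])
    show "gc c u v v > 0" if "v \<noteq> 0"
      unfolding gc_def y_def[symmetric]
      by (rule metric_pos[OF y(2)]) (use that tcomp_tvec[OF c y(1), of v] linear_0[OF linear_tcomp[OF c y(1)]] in auto)
    show "Jc c u (Jc c u v) = - v"
      unfolding Jc_def y_def[symmetric]
      by (simp add: tvec_tcomp[OF c y(1)] complex_sq[OF y(2)] linear_neg[OF linear_tcomp[OF c y(1)]] tcomp_tvec[OF c y(1)])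
    show "gc c u (Jc c u v) (Jc c u w) = gc c u v w"
      unfolding Jc_def gc_def y_def[symmetric]
      by (simp add: tvec_tcomp[OF c y(1)] metric_complex[OF y(2)])
    show "((\<lambda>u. gc c u v w) has_derivative (\<lambda>a. gc c u (Gc c u a v) w + gc c u v (Gc c u a w))) (at u)"
    proof (rule has_derivative_eq_rhs[OF smooth_on_has_derivative[OF sg S u]], rule ext)
      fix a
      have "((\<lambda>z. g z (?E v z) (?E w z)) \<circ> chart_inv c has_derivative frechet_derivative (\<lambda>u. gc c u v w) (at u)) (at (coords c y))"
        unfolding y(3) using smooth_on_has_derivative[OF sg S u] by (simp add: gc_def o_def)
      from dir_deriv_chart[OF c y(1) this, of "?E a y"]
      have "frechet_derivative (\<lambda>u. gc c u v w) (at u) a = dir_deriv M y (?E a y) (\<lambda>z. g z (?E v z) (?E w z))"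
        by (simp add: tcomp_tvec[OF c y(1)])
      also have "\<dots> = g y (D (?E a) (?E v) y) (?E w y) + g y (?E v y) (D (?E a) (?E w) y)"
        using metric_compatible dc E y(1) unfolding metric_compatible_def by blast
      finally show "frechet_derivative (\<lambda>u. gc c u v w) (at u) a = gc c u (Gc c u a v) w + gc c u v (Gc c u a w)"
        unfolding conn_E[OF y(1)] by (simp add: gc_def y_def)
    qed
    show "((\<lambda>u. Jc c u w) has_derivative (\<lambda>a. Jc c u (Gc c u a w) - Gc c u a (Jc c u w))) (at u)"
    proof (rule has_derivative_eq_rhs[OF smooth_on_has_derivative[OF sJ S u]], rule ext)
      fix a
      have rep: "vfield_rep M c (\<lambda>z. J z (?E w z)) = (\<lambda>u. Jc c u w)"
        by (simp add: vfield_rep_def Jc_def)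
      have sJE: "smooth_vfield_on M (dom_of c) (\<lambda>z. J z (?E w z))"
        by (rule smooth_vfield_chartI[OF c dc order_refl]) (simp add: rep sJ)
      have "D (?E a) (\<lambda>z. J z (?E w z)) y = J y (D (?E a) (?E w) y)"
        using parallel_J dc E y(1) unfolding parallel_endomorphism_def by blast
      then have "tcomp M c y (D (?E a) (\<lambda>z. J z (?E w z)) y) = Jc c u (Gc c u a w)"
        unfolding conn_E[OF y(1)] by (simp add: Jc_def y_def)
      moreover have "tcomp M c y (D (?E a) (\<lambda>z. J z (?E w z)) y) = frechet_derivative (\<lambda>u. Jc c u w) (at u) a + Gc c u a (Jc c u w)"
        using conn_chart[OF c dc order_refl y(1) E sJE, of a] unfolding rep
        by (simp add: tcomp_tvec[OF c y(1)] y(3)) (simp add: Jc_def y_def)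
      ultimately show "frechet_derivative (\<lambda>u. Jc c u w) (at u) a = Jc c u (Gc c u a w) - Gc c u a (Jc c u w)"
        by (simp add: eq_diff_eq)
    qed
  qed (simp_all add: S bil sg smooth_gam[OF c])
qed

end

section \<open>The Levi-Civita connection of the cotangent bundle\<close>

locale kaehler_point = kaehler M D J g
  for M :: "('a, 'e::euclidean_space) manifold" and D J g +
  fixes \<delta> :: real and x :: 'a and p :: "'e \<Rightarrow> real"
  assumes point: "x \<in> points M" and linear_p: "linear p"
begin

abbreviation "TM \<equiv> cotangent_bundle M"
abbreviation "BS \<equiv> berger_sasaki M J g D \<delta>"
abbreviation "c \<equiv> chart_at M x"
abbreviation "c' \<equiv> cotangent_chart M c"
abbreviation "u0 \<equiv> coords c x"
abbreviation "q \<equiv> fcomp M c x p"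

lemma chart_c: "c \<in> atlas M" "x \<in> dom_of c"
  using chart_at[OF point] by auto

sublocale N: smooth_charts TM
  by (rule smooth_charts_cotangent)

sublocale kaehler_coords "coords c ` dom_of c" "Gc c" "gc c" "Jc c"
  by (rule kaehler_coords[OF chart_c(1)])

lemma u0_mem: "u0 \<in> coords c ` dom_of c" using chart_c by blast

lemma inv_o: "chart_inv c u0 = x" by (rule chart_inv_coords[OF chart_c])

text \<open>In the chart chosen at \<open>x\<close>, vectors at \<open>x\<close> coincide with their
  components, so conversions disappear at the base point.\<close>

lemma tvec_c: "tvec M c x v = v" and tcomp_c: "tcomp M c x v = v"
  using tvec_chart_at[OF point] tcomp_chart_at[OF point] by auto

lemma chart_c': "c' \<in> atlas TM" "(x, p) \<in> dom_of c'" "chart_at TM (x, p) = c'"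
  using chart_c linear_p by (auto simp: atlas_cotangent_bundle dom_cotangent_chart cotangent_over_def chart_at_cotangent_bundle)

lemma point': "(x, p) \<in> points TM"
  using point linear_p by (simp add: points_cotangent_bundle cotangent_over_def)

lemma tcomp_c': "tcomp TM c' (x, p) \<xi> = \<xi>"
  using N.tcomp_chart_at[OF point'] chart_c'(3) by simp

lemma coords_c': "coords c' (x, p) = (u0, q)"
  by (simp add: coords_cotangent_chart)

lemma hlift_eq: "hlift M D (x, p) v = (v, N u0 v q)"
  using tcomp_hlift[OF torsion_free chart_c linear_p, of v]
  by (simp add: tcomp_c' tcomp_c N_def inv_o)

lemma vlift_eq: "vlift \<alpha> = (0, fcomp M c x \<alpha>)"
  by (simp add: vlift_def fcomp_def tvec_c)

lemma fcomp_at: "linear \<alpha> \<Longrightarrow> fcomp M c x \<alpha> \<bullet> w = \<alpha> w"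
  by (simp add: fcomp_inner[OF chart_c] tvec_c)

text \<open>The vertical part of a tangent vector at \<open>(x, p)\<close>, and below \<open>h\<close>, the metric on vertical parts.\<close>

definition vp :: "'e \<times> 'e \<Rightarrow> 'e" where "vp \<xi> = snd \<xi> - N u0 (fst \<xi>) q"

lemma vp_linear: "linear vp"
  unfolding vp_def
  by (rule linearI) (simp_all add: linear_add[OF linear_N_left[OF u0_mem]] linear_scale[OF linear_N_left[OF u0_mem]] algebra_simps)

lemma vp_lifts: "vp (hlift M D (x, p) v) = 0" "vp (vlift \<alpha>) = fcomp M c x \<alpha>"
    "fst (hlift M D (x, p) v) = v" "fst (vlift \<alpha>) = 0"
  using linear_0[OF linear_N_left[OF u0_mem]] by (auto simp: vp_def hlift_eq vlift_eq)

lemma sharp_chart: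
  assumes y: "y \<in> dom_of c" and \<beta>: "linear \<beta>"
  shows "sharp g y \<beta> = tvec M c y (K (coords c y) (fcomp M c y \<beta>))"
proof -
  let ?u = "coords c y" and ?k = "K (coords c y) (fcomp M c y \<beta>)"
  have u: "?u \<in> coords c ` dom_of c" using y by blast
  have inv: "chart_inv c ?u = y" by (rule chart_inv_coords[OF chart_c(1) y])
  have yM: "y \<in> points M" by (rule points_of_chart[OF chart_c(1) y])
  have e: "g y (tvec M c y ?k) w = \<beta> w" for w
    using g_K[OF u, of "fcomp M c y \<beta>" "tcomp M c y w"]
    by (simp add: gc_def inv tvec_tcomp[OF chart_c(1) y] fcomp_inner_tcomp[OF chart_c(1) y \<beta>])
  have lin: "linear (\<lambda>v. g y v w)" for w using bilinear_metric[OF yM] by (simp add: bilinear_def)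
  show ?thesis
    unfolding sharp_def
  proof (rule the_equality)
    show "\<forall>w. g y (tvec M c y ?k) w = \<beta> w" using e by blast
    fix v assume v: "\<forall>w. g y v w = \<beta> w"
    have "g y (v - tvec M c y ?k) (v - tvec M c y ?k) = 0"
      by (simp add: linear_diff[OF lin] v e)
    then show "v = tvec M c y ?k" using metric_pos[OF yM, of "v - tvec M c y ?k"] by force
  qed
qed

lemma ginv_chart:
  assumes y: "y \<in> dom_of c" and \<alpha>: "linear \<alpha>" and \<beta>: "linear \<beta>"
  shows "ginv g y \<alpha> \<beta> = fcomp M c y \<alpha> \<bullet> K (coords c y) (fcomp M c y \<beta>)"
proof -
  have u: "coords c y \<in> coords c ` dom_of c" using y by blast
  show ?thesis
    using g_K[OF u, of "fcomp M c y \<alpha>" "K (coords c y) (fcomp M c y \<beta>)"]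
    by (simp add: ginv_def sharp_chart[OF y] \<alpha> \<beta> gc_def chart_inv_coords[OF chart_c(1) y])
qed

lemma linear_comp_J: "y \<in> dom_of c \<Longrightarrow> linear \<alpha> \<Longrightarrow> linear (\<alpha> \<circ> J y)"
  by (intro linear_compose linear_complex points_of_chart[OF chart_c(1)])

lemma fcomp_comp_J:
  assumes y: "y \<in> dom_of c" and \<alpha>: "linear \<alpha>"
  shows "fcomp M c y (\<alpha> \<circ> J y) \<bullet> w = fcomp M c y \<alpha> \<bullet> Jc c (coords c y) w"
  by (simp add: fcomp_inner[OF chart_c(1) y linear_comp_J[OF y \<alpha>]] Jc_def chart_inv_coords[OF chart_c(1) y] fcomp_inner_tcomp[OF chart_c(1) y \<alpha>])

text \<open>Composing a covector with \<open>J\<close> amounts to applying the adjoint of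
  \<open>J\<close> to the raised vector, and this adjoint is \<open>-J\<close>.\<close>

lemma K_comp_J:
  assumes y: "y \<in> dom_of c" and \<alpha>: "linear \<alpha>"
  shows "K (coords c y) (fcomp M c y (\<alpha> \<circ> J y)) = - Jc c (coords c y) (K (coords c y) (fcomp M c y \<alpha>))"
proof -
  have u: "coords c y \<in> coords c ` dom_of c" using y by blast
  show ?thesis
    by (rule K_eqI[OF u]) (simp add: fcomp_comp_J[OF y \<alpha>] g_minus_left[OF u] g_J_skew[OF u] g_K[OF u])
qed

lemma linear_inner: "linear (\<lambda>w. a \<bullet> w :: real)"
  by (rule bounded_linear.linear[OF bounded_linear_inner_right])

lemma fcomp_inner_form: "fcomp M c x (\<lambda>w. a \<bullet> w) = a"
  by (simp add: fcomp_def tvec_c euclidean_representation)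

definition h :: "'e \<Rightarrow> 'e \<Rightarrow> real" where
  "h a b = a \<bullet> K u0 b + \<delta>\<^sup>2 * (a \<bullet> Jc c u0 (K u0 q)) * (b \<bullet> Jc c u0 (K u0 q))"

text \<open>The sign from \<open>K_comp_J\<close> cancels here, because the deforming term is a
  product of two pairings with pJ.\<close>

lemma BS_eq: "BS (x, p) \<xi> \<eta> = gc c u0 (fst \<xi>) (fst \<eta>) + h (vp \<xi>) (vp \<eta>)"
proof -
  have vert: "vert_part M D (x, p) \<xi> = (\<lambda>w. vp \<xi> \<bullet> w)" for \<xi>
    by (simp add: vert_part_def hlift_eq vp_def)
  show ?thesis
    unfolding berger_sasaki_def Let_def prod.case vert
    by (simp add: ginv_chart[OF chart_c(2)] linear_inner linear_comp_J[OF chart_c(2) linear_p] fcomp_inner_form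
       K_comp_J[OF chart_c(2) linear_p] h_def gc_def inv_o tvec_c)
qed

lemma h_sym: "h a b = h b a"
  by (simp add: h_def inner_K_sym[OF u0_mem, of a])

lemma linear_h: "linear (\<lambda>a. h a b)" "linear (h b)"
proof -
  show 1: "linear (\<lambda>a. h a b)" for b
    by (rule linearI) (simp_all add: h_def algebra_simps)
  have "h b = (\<lambda>a. h a b)" by (rule ext) (rule h_sym)
  with 1[of b] show "linear (h b)" by simp
qed

lemma h_pos: "a \<noteq> 0 \<Longrightarrow> h a a > 0"
proof -
  assume a: "a \<noteq> 0"
  then have "K u0 a \<noteq> 0" using g_K[OF u0_mem, of a] g_zero_left[OF u0_mem] by (metis inner_eq_zero_iff)
  then have "a \<bullet> K u0 a > 0" using g_pos[OF u0_mem, of "K u0 a"] g_K[OF u0_mem, of a "K u0 a"] by simp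
  then show "h a a > 0" by (simp add: h_def add_pos_nonneg mult.assoc)
qed

text \<open>Nondegeneracy of the deformed metric, split to match the Koszul formula: horizontal test
  fields detect \<open>fst\<close>, vertical ones detect \<open>vp\<close>.\<close>

lemma tangent_eqI:
  assumes "\<And>z. gc c u0 (fst \<xi>) z = gc c u0 (fst \<eta>) z" and "\<And>z. h (vp \<xi>) z = h (vp \<eta>) z"
  shows "\<xi> = \<eta>"
proof -
  have 1: "fst \<xi> = fst \<eta>" by (rule g_eqI[OF u0_mem]) (rule assms(1))
  have "h (vp \<xi> - vp \<eta>) (vp \<xi> - vp \<eta>) = 0" using assms(2) by (simp add: linear_diff[OF linear_h(1)])
  then have "vp \<xi> = vp \<eta>" using h_pos[of "vp \<xi> - vp \<eta>"] by force
  with 1 show ?thesis by (simp add: vp_def prod_eq_iff)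
qed

text \<open>\<open>nab X a\<close> is \<open>\<nabla>\<^sub>a X\<close> and \<open>nabf \<omega> a\<close> is \<open>\<nabla>\<^sub>a \<omega>\<close> at \<open>x\<close>; \<open>rho a b\<close> is \<open>pR(a, b)\<close>.\<close>

definition nab :: "('a \<Rightarrow> 'e) \<Rightarrow> 'e \<Rightarrow> 'e" where
  "nab X a = frechet_derivative (vfield_rep M c X) (at u0) a + Gc c u0 a (X x)"

definition nabf :: "('a \<Rightarrow> 'e \<Rightarrow> real) \<Rightarrow> 'e \<Rightarrow> 'e" where
  "nabf \<omega> a = frechet_derivative (form_rep c \<omega>) (at u0) a - N u0 a (fcomp M c x (\<omega> x))"

definition rho :: "'e \<Rightarrow> 'e \<Rightarrow> 'e" where
  "rho a b = (\<Sum>i\<in>Basis. (q \<bullet> curv u0 a b i) *\<^sub>R i)"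

lemma rho_inner: "rho a b \<bullet> w = q \<bullet> curv u0 a b w"
  using linear_functional_rep[OF linear_compose[OF linear_curv[OF u0_mem, of a b] linear_inner[of q]]]
  by (simp add: rho_def o_def)

abbreviation "W \<equiv> cotangent_over (dom_of c) :: ('a \<times> ('e \<Rightarrow> real)) set"

lemma open_W: "open_in_mfd TM W" and P_W: "(x, p) \<in> W"
  using open_in_cotangent[OF open_in_mfd_dom[OF chart_c(1)]] chart_c linear_p by (auto simp: cotangent_over_def)

lemma chart_inv_c': 
  assumes "u \<in> coords c ` dom_of c"
  shows "chart_inv c' (u, r) = (chart_inv c u, \<lambda>w. r \<bullet> tcomp M c (chart_inv c u) w)"
  using cotangent_chart_inv[OF chart_c(1) chart_inv_mem[OF chart_c(1) order_refl assms]] coords_chart_inv[OF assms] by simp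

lemma open_SU: "open (coords c ` dom_of c \<times> (UNIV :: 'e set))"
  using open_S by (simp add: open_Times)

lemma o_SU: "(u0, r) \<in> coords c ` dom_of c \<times> (UNIV :: 'e set)" using u0_mem by auto

section \<open>Derivatives of the deformed metric on lifted fields\<close>

lemma dir_deriv_TM:
  assumes F: "(F has_derivative F') (at (u0, q))"
    and eq: "\<And>u r. u \<in> coords c ` dom_of c \<Longrightarrow> f (chart_inv c u, \<lambda>w. r \<bullet> tcomp M c (chart_inv c u) w) = F (u, r)"
  shows "dir_deriv TM (x, p) \<xi> f = F' \<xi>"
proof -
  have "((f \<circ> chart_inv c') has_derivative F') (at (u0, q))"
    by (rule has_derivative_transform_within_open[OF F open_SU o_SU])
      (use eq chart_inv_c' in auto)
  then have "((f \<circ> chart_inv c') has_derivative F') (at (coords c' (x, p)))"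
    by (simp add: coords_c')
  from N.dir_deriv_chart[OF chart_c'(1,2) this, of \<xi>] show ?thesis by (simp add: tcomp_c')
qed

lemma smooth_rep_deriv:
  assumes "smooth_vfield_on M (dom_of c) X"
  shows "(vfield_rep M c X has_derivative frechet_derivative (vfield_rep M c X) (at u0)) (at u0)"
  by (rule smooth_on_has_derivative[OF smooth_vfield_chartD[OF assms chart_c(1) order_refl] open_S u0_mem])

lemma rep_o: "vfield_rep M c X u0 = X x"
  by (simp add: vfield_rep_coords[OF chart_c] tcomp_c)

lemma form_rep_o: "form_rep c \<omega> u0 = fcomp M c x (\<omega> x)"
  by (simp add: form_rep_def inv_o)

lemma BS_hh: "y \<in> dom_of c \<Longrightarrow> BS (y, r) (hlift_field M D X (y, r)) (hlift_field M D Y (y, r)) = g y (X y) (Y y)"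
  unfolding hlift_field_def prod.case
  \<comment> \<open>The three defining equations share their hypotheses; zero covectors fill the
    places for covectors.\<close>
  using berger_sasaki_lifts(1)[OF riemannian points_of_chart[OF chart_c(1)], of y "\<lambda>_. 0" "\<lambda>_. 0"] by (simp add: linear_zero)

lemma BS_hv: "y \<in> dom_of c \<Longrightarrow> linear (\<theta> y) \<Longrightarrow> BS (y, r) (hlift_field M D X (y, r)) (vlift_field \<theta> (y, r)) = 0"
  unfolding hlift_field_def vlift_field_def prod.case
  using berger_sasaki_lifts(2)[OF riemannian points_of_chart[OF chart_c(1)], of y "\<theta> y" "\<theta> y"] by simp

lemma ginv_sym: "y \<in> dom_of c \<Longrightarrow> ginv g y \<alpha> \<beta> = ginv g y \<beta> \<alpha>"
  unfolding ginv_def by (rule metric_sym[OF points_of_chart[OF chart_c(1)]])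

lemma BS_vh:
  assumes y: "y \<in> dom_of c" and \<theta>: "linear (\<theta> y)"
  shows "BS (y, r) (vlift_field \<theta> (y, r)) (hlift_field M D X (y, r)) = 0"
proof -
  have "BS (y, r) \<xi> \<eta> = BS (y, r) \<eta> \<xi>" for \<xi> \<eta>
    unfolding berger_sasaki_def Let_def prod.case
    using ginv_sym[OF y] metric_sym[OF points_of_chart[OF chart_c(1) y]] by (simp add: mult_ac)
  then show ?thesis using BS_hv[where y=y and \<theta>=\<theta> and r=r and X=X, OF y \<theta>] by metis
qed

lemma BS_vv:
  assumes u: "u \<in> coords c ` dom_of c" and y: "y = chart_inv c u" and r: "r' = (\<lambda>w. r \<bullet> tcomp M c y w)"
    and \<omega>: "linear (\<omega> y)" and \<theta>: "linear (\<theta> y)"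
  shows "BS (y, r') (vlift_field \<omega> (y, r')) (vlift_field \<theta> (y, r')) =
    form_rep c \<omega> u \<bullet> K u (form_rep c \<theta> u) + \<delta>\<^sup>2 * (form_rep c \<omega> u \<bullet> Jc c u (K u r)) * (form_rep c \<theta> u \<bullet> Jc c u (K u r))"
proof -
  have yc: "y \<in> dom_of c" using chart_inv_mem[OF chart_c(1) order_refl u] y by simp
  have cy: "coords c y = u" using coords_chart_inv[OF u] y by simp
  have lr: "linear r'" using linear_inner_tcomp[OF chart_c(1) yc] r by simp
  have fr: "fcomp M c y r' = r" using fcomp_inner_tcomp_form[OF chart_c(1) yc] r by simp
  note KJ = K_comp_J[OF yc lr, unfolded cy fr]
  show ?thesis
    unfolding vlift_field_def prod.case berger_sasaki_lifts(3)[OF riemannian points_of_chart[OF chart_c(1) yc] \<omega> \<theta>]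
    by (simp add: ginv_chart[OF yc] \<omega> \<theta> linear_comp_J[OF yc lr] KJ cy fr form_rep_def y[symmetric])
qed

lemma dir_hh:
  assumes X: "smooth_vfield_on M (dom_of c) X" and Y: "smooth_vfield_on M (dom_of c) Y"
  shows "dir_deriv TM (x, p) \<xi> (\<lambda>Q. BS Q (hlift_field M D X Q) (hlift_field M D Y Q)) =
    gc c u0 (nab X (fst \<xi>)) (Y x) + gc c u0 (X x) (nab Y (fst \<xi>))"
proof -
  let ?X = "vfield_rep M c X" and ?Y = "vfield_rep M c Y"
  \<comment> \<open>The Leibniz rule is applied once for each argument, here with the second one
    held fixed.\<close>
  have 1: "((\<lambda>u. gc c u (?X u) w) has_derivative (\<lambda>a. (gc c u0 (Gc c u0 a (X x)) w + gc c u0 (X x) (Gc c u0 a w)) +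
      gc c u0 (frechet_derivative ?X (at u0) a) w)) (at u0)" for w
    by (rule has_derivative_eq_rhs[OF has_derivative_linear_family[where L="\<lambda>u v. gc c u v w", OF open_S u0_mem linear_g_left deriv_g[OF u0_mem] smooth_rep_deriv[OF X]]])
      (simp_all add: rep_o)
  have lin: "linear (gc c u (?X u))" if "u \<in> coords c ` dom_of c" for u
    by (rule linear_g_right[OF that])
  have 2: "((\<lambda>u. gc c u (?X u) (?Y u)) has_derivative (\<lambda>a. ((gc c u0 (Gc c u0 a (X x)) (Y x) + gc c u0 (X x) (Gc c u0 a (Y x))) +
      gc c u0 (frechet_derivative ?X (at u0) a) (Y x)) + gc c u0 (X x) (frechet_derivative ?Y (at u0) a))) (at u0)"
    by (rule has_derivative_eq_rhs[OF has_derivative_linear_family[where L="\<lambda>u. gc c u (?X u)", OF open_S u0_mem lin 1 smooth_rep_deriv[OF Y]]])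
      (simp_all add: rep_o)
  have "((\<lambda>u. gc c u (?X u) (?Y u)) has_derivative (\<lambda>a. gc c u0 (nab X a) (Y x) + gc c u0 (X x) (nab Y a))) (at (fst (u0, q)))"
    unfolding fst_conv by (rule has_derivative_eq_rhs[OF 2]) (simp add: fun_eq_iff nab_def g_add_left[OF u0_mem] g_add_right[OF u0_mem])
  from has_derivative_compose[OF bounded_linear_imp_has_derivative[OF bounded_linear_fst] this]
  show ?thesis
  proof (rule dir_deriv_TM)
    fix u r assume u: "u \<in> coords c ` dom_of c"
    have y: "chart_inv c u \<in> dom_of c" by (rule chart_inv_mem[OF chart_c(1) order_refl u])
    show "BS (chart_inv c u, \<lambda>w. r \<bullet> tcomp M c (chart_inv c u) w)
        (hlift_field M D X (chart_inv c u, \<lambda>w. r \<bullet> tcomp M c (chart_inv c u) w))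
        (hlift_field M D Y (chart_inv c u, \<lambda>w. r \<bullet> tcomp M c (chart_inv c u) w)) =
        gc c (fst (u, r)) (?X (fst (u, r))) (?Y (fst (u, r)))"
      by (simp add: BS_hh[OF y] gc_def vfield_rep_def tvec_tcomp[OF chart_c(1) y])
  qed
qed

lemma dir_hv:
  assumes \<theta>: "\<And>y. y \<in> dom_of c \<Longrightarrow> linear (\<theta> y)"
  shows "dir_deriv TM (x, p) \<xi> (\<lambda>Q. BS Q (hlift_field M D X Q) (vlift_field \<theta> Q)) = 0"
    and "dir_deriv TM (x, p) \<xi> (\<lambda>Q. BS Q (vlift_field \<theta> Q) (hlift_field M D X Q)) = 0"
  by (rule dir_deriv_TM[OF has_derivative_const]; use chart_inv_mem[OF chart_c(1) order_refl] BS_hv BS_vh \<theta> in auto)+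

text \<open>The terms with \<open>h\<close> are the covariant Leibniz rule. The remaining ones come
  from the dependence of the deformation on the fibre coordinate; they involve only
  \<open>vp \<xi>\<close> and vanish in horizontal directions.\<close>

lemma dir_vv:
  assumes \<omega>: "smooth_on (coords c ` dom_of c) (form_rep c \<omega>)" "\<And>y. y \<in> dom_of c \<Longrightarrow> linear (\<omega> y)"
    and \<theta>: "smooth_on (coords c ` dom_of c) (form_rep c \<theta>)" "\<And>y. y \<in> dom_of c \<Longrightarrow> linear (\<theta> y)"
  defines "w \<equiv> fcomp M c x (\<omega> x)" and "t \<equiv> fcomp M c x (\<theta> x)" and "k \<equiv> Jc c u0 (K u0 q)"
  shows "dir_deriv TM (x, p) \<xi> (\<lambda>Q. BS Q (vlift_field \<omega> Q) (vlift_field \<theta> Q)) =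
    h (nabf \<omega> (fst \<xi>)) t + h w (nabf \<theta> (fst \<xi>)) +
    \<delta>\<^sup>2 * ((w \<bullet> Jc c u0 (K u0 (vp \<xi>))) * (t \<bullet> k) + (w \<bullet> k) * (t \<bullet> Jc c u0 (K u0 (vp \<xi>))))"
proof -
  note d\<omega> = smooth_on_has_derivative[OF \<omega>(1) open_S u0_mem] and d\<theta> = smooth_on_has_derivative[OF \<theta>(1) open_S u0_mem]
  let ?F = "\<lambda>z. form_rep c \<omega> (fst z) \<bullet> K (fst z) (form_rep c \<theta> (fst z)) +
    \<delta>\<^sup>2 * ((form_rep c \<omega> (fst z) \<bullet> Jc c (fst z) (K (fst z) (snd z))) * (form_rep c \<theta> (fst z) \<bullet> Jc c (fst z) (K (fst z) (snd z))))"
  have "(?F has_derivative (\<lambda>\<xi>. (nabf \<omega> (fst \<xi>) \<bullet> K u0 t + nabf \<theta> (fst \<xi>) \<bullet> K u0 w) +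
    \<delta>\<^sup>2 * ((w \<bullet> k) * (nabf \<theta> (fst \<xi>) \<bullet> k + t \<bullet> Jc c u0 (K u0 (vp \<xi>))) +
      (nabf \<omega> (fst \<xi>) \<bullet> k + w \<bullet> Jc c u0 (K u0 (vp \<xi>))) * (t \<bullet> k)))) (at (u0, q))"
    by (rule has_derivative_eq_rhs[OF has_derivative_add[OF deriv_inner_K[OF u0_mem d\<omega> d\<theta>]
        has_derivative_mult_right[OF has_derivative_mult[OF deriv_inner_J_K[OF u0_mem d\<omega>] deriv_inner_J_K[OF u0_mem d\<theta>]]]]])
      (simp add: fun_eq_iff w_def t_def k_def nabf_def form_rep_o vp_def)
  then show ?thesis
    by (rule trans[OF dir_deriv_TM])
     (use \<omega>(2) \<theta>(2) chart_inv_mem[OF chart_c(1) order_refl] in \<open>auto simp: BS_vv h_def inner_K_sym[OF u0_mem, of "fcomp M c x (\<omega> x)"] w_def t_def k_def algebra_simps\<close>)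
qed

end

section \<open>Brackets of lifts; the connection and curvature of the base at the point\<close>

context kaehler_point
begin

lemma h_field: "hlift_field M D X (x, p) = hlift M D (x, p) (X x)"
  and v_field: "vlift_field \<omega> (x, p) = vlift (\<omega> x)"
  by (simp_all add: hlift_field_def vlift_field_def)

lemma deriv_rep_h:
  assumes X: "smooth_vfield_on M (dom_of c) X"
  defines "X' \<equiv> frechet_derivative (vfield_rep M c X) (at u0)"
  shows "frechet_derivative (vfield_rep TM c' (hlift_field M D X)) (at (u0, q)) \<zeta> =
    (X' (fst \<zeta>), \<Sum>i\<in>Basis. (snd \<zeta> \<bullet> Gc c u0 (X x) i + q \<bullet> (dG u0 (fst \<zeta>) (X x) i + Gc c u0 (X' (fst \<zeta>)) i)) *\<^sub>R i)"
proof -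
  have fst: "((fst :: 'e \<times> 'e \<Rightarrow> 'e) has_derivative fst) (at (u0, q))" by (rule bounded_linear_imp_has_derivative[OF bounded_linear_fst])
  have dX: "((\<lambda>z::'e\<times>'e. vfield_rep M c X (fst z)) has_derivative (\<lambda>\<zeta>. X' (fst \<zeta>))) (at (u0, q))"
    by (rule has_derivative_compose[where g="vfield_rep M c X", OF fst]) (simp add: X'_def smooth_rep_deriv[OF X])
  have "((\<lambda>u. Gc c u (vfield_rep M c X u) i) has_derivative (\<lambda>a. dG u0 a (X x) i + Gc c u0 (X' a) i)) (at (fst (u0, q)))" for i
    unfolding fst_conv X'_def
    by (rule has_derivative_eq_rhs[OF has_derivative_linear_family[where L="\<lambda>u v. Gc c u v i", OF open_S u0_mem linear_G_left deriv_G[OF u0_mem] smooth_rep_deriv[OF X]]])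
      (simp_all add: rep_o)
  from has_derivative_compose[OF fst this]
  have dGX: "((\<lambda>z::'e\<times>'e. Gc c (fst z) (vfield_rep M c X (fst z)) i) has_derivative (\<lambda>\<zeta>. dG u0 (fst \<zeta>) (X x) i + Gc c u0 (X' (fst \<zeta>)) i)) (at (u0, q))" for i .
  have "((\<lambda>z. (vfield_rep M c X (fst z), \<Sum>i\<in>Basis. (snd z \<bullet> Gc c (fst z) (vfield_rep M c X (fst z)) i) *\<^sub>R i)) has_derivative
    (\<lambda>\<zeta>. (X' (fst \<zeta>), \<Sum>i\<in>Basis. (snd (u0, q) \<bullet> (dG u0 (fst \<zeta>) (X x) i + Gc c u0 (X' (fst \<zeta>)) i) +
        snd \<zeta> \<bullet> Gc c (fst (u0, q)) (vfield_rep M c X (fst (u0, q))) i) *\<^sub>R i))) (at (u0, q))"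
    by (intro has_derivative_Pair dX has_derivative_sum has_derivative_scaleR_left has_derivative_inner dGX
      bounded_linear_imp_has_derivative[OF bounded_linear_snd])
  then have "(vfield_rep TM c' (hlift_field M D X) has_derivative
    (\<lambda>\<zeta>. (X' (fst \<zeta>), \<Sum>i\<in>Basis. (snd (u0, q) \<bullet> (dG u0 (fst \<zeta>) (X x) i + Gc c u0 (X' (fst \<zeta>)) i) +
        snd \<zeta> \<bullet> Gc c (fst (u0, q)) (vfield_rep M c X (fst (u0, q))) i) *\<^sub>R i))) (at (u0, q))"
  proof (rule has_derivative_transform_within_open[OF _ open_SU o_SU])
    fix z assume "z \<in> coords c ` dom_of c \<times> (UNIV :: 'e set)"
    then obtain y r where y: "y \<in> dom_of c" and z: "z = (coords c y, r)" by auto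
    show "(vfield_rep M c X (fst z), \<Sum>i\<in>Basis. (snd z \<bullet> Gc c (fst z) (vfield_rep M c X (fst z)) i) *\<^sub>R i) =
      vfield_rep TM c' (hlift_field M D X) z"
      by (simp add: z vfield_rep_hlift[OF torsion_free chart_c(1) y] vfield_rep_coords[OF chart_c(1) y] chart_inv_coords[OF chart_c(1) y])
  qed
  from frechet_derivativeI[OF this] show ?thesis by (simp add: rep_o add.commute)
qed

lemma deriv_rep_v:
  assumes \<omega>: "smooth_on (coords c ` dom_of c) (form_rep c \<omega>)" "\<And>y. y \<in> dom_of c \<Longrightarrow> linear (\<omega> y)"
  shows "frechet_derivative (vfield_rep TM c' (vlift_field \<omega>)) (at (u0, q)) \<zeta> =
    (0, frechet_derivative (form_rep c \<omega>) (at u0) (fst \<zeta>))"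
proof -
  have fst: "((fst :: 'e \<times> 'e \<Rightarrow> 'e) has_derivative fst) (at (u0, q))" by (rule bounded_linear_imp_has_derivative[OF bounded_linear_fst])
  have "((\<lambda>z::'e\<times>'e. form_rep c \<omega> (fst z)) has_derivative (\<lambda>\<zeta>. frechet_derivative (form_rep c \<omega>) (at u0) (fst \<zeta>))) (at (u0, q))"
    by (rule has_derivative_compose[where g="form_rep c \<omega>", OF fst]) (simp add: smooth_on_has_derivative[OF \<omega>(1) open_S u0_mem])
  then have "((\<lambda>z. (0, form_rep c \<omega> (fst z))) has_derivative (\<lambda>\<zeta>. (0, frechet_derivative (form_rep c \<omega>) (at u0) (fst \<zeta>)))) (at (u0, q))"
    by (intro has_derivative_Pair has_derivative_const)
  then have "(vfield_rep TM c' (vlift_field \<omega>) has_derivative (\<lambda>\<zeta>. (0, frechet_derivative (form_rep c \<omega>) (at u0) (fst \<zeta>)))) (at (u0, q))"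
  proof (rule has_derivative_transform_within_open[OF _ open_SU o_SU])
    fix z assume "z \<in> coords c ` dom_of c \<times> (UNIV :: 'e set)"
    then obtain y r where y: "y \<in> dom_of c" and z: "z = (coords c y, r)" by auto
    show "(0, form_rep c \<omega> (fst z)) = vfield_rep TM c' (vlift_field \<omega>) z"
      by (simp add: z vfield_rep_vlift[OF chart_c(1) y, of \<omega>] \<omega>(2) y form_rep_def chart_inv_coords[OF chart_c(1) y])
  qed
  from frechet_derivativeI[OF this] show ?thesis by simp
qed

lemma lie_bracket_TM: "lie_bracket TM A B (x, p) =
    frechet_derivative (vfield_rep TM c' B) (at (u0, q)) (A (x, p)) - frechet_derivative (vfield_rep TM c' A) (at (u0, q)) (B (x, p))"
  unfolding lie_bracket_def Let_def chart_c'(3) coords_c' ..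

text \<open>Derivatives of the Christoffel symbols and products of two of them, antisymmetrised,
  form the curvature. The derivatives of \<open>X\<close> and \<open>Y\<close> in the fibre part are
  removed when the horizontal lift of the first component is subtracted.\<close>

lemma bracket_hh:
  assumes X: "smooth_vfield_on M (dom_of c) X" and Y: "smooth_vfield_on M (dom_of c) Y"
  shows "fst (lie_bracket TM (hlift_field M D X) (hlift_field M D Y) (x, p)) = nab Y (X x) - nab X (Y x)"
    and "vp (lie_bracket TM (hlift_field M D X) (hlift_field M D Y) (x, p)) = rho (X x) (Y x)"
proof -
  let ?B = "lie_bracket TM (hlift_field M D X) (hlift_field M D Y) (x, p)"
  define a where "a = frechet_derivative (vfield_rep M c Y) (at u0) (X x)"
  define b where "b = frechet_derivative (vfield_rep M c X) (at u0) (Y x)"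
  have B: "?B = (a, \<Sum>i\<in>Basis. (N u0 (X x) q \<bullet> Gc c u0 (Y x) i + q \<bullet> (dG u0 (X x) (Y x) i + Gc c u0 a i)) *\<^sub>R i) -
      (b, \<Sum>i\<in>Basis. (N u0 (Y x) q \<bullet> Gc c u0 (X x) i + q \<bullet> (dG u0 (Y x) (X x) i + Gc c u0 b i)) *\<^sub>R i)"
    unfolding lie_bracket_TM deriv_rep_h[OF X] deriv_rep_h[OF Y] h_field hlift_eq
    by (simp add: a_def b_def)
  show "fst ?B = nab Y (X x) - nab X (Y x)"
    unfolding B by (simp add: nab_def a_def b_def G_sym[OF u0_mem, of "X x"])
  show "vp ?B = rho (X x) (Y x)"
    unfolding B vp_def
  proof (rule euclidean_eqI)
    fix i :: 'e assume i: "i \<in> Basis"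
    show "(snd ((a, \<Sum>i\<in>Basis. (N u0 (X x) q \<bullet> Gc c u0 (Y x) i + q \<bullet> (dG u0 (X x) (Y x) i + Gc c u0 a i)) *\<^sub>R i) -
      (b, \<Sum>i\<in>Basis. (N u0 (Y x) q \<bullet> Gc c u0 (X x) i + q \<bullet> (dG u0 (Y x) (X x) i + Gc c u0 b i)) *\<^sub>R i)) -
      N u0 (fst ((a, \<Sum>i\<in>Basis. (N u0 (X x) q \<bullet> Gc c u0 (Y x) i + q \<bullet> (dG u0 (X x) (Y x) i + Gc c u0 a i)) *\<^sub>R i) -
      (b, \<Sum>i\<in>Basis. (N u0 (Y x) q \<bullet> Gc c u0 (X x) i + q \<bullet> (dG u0 (Y x) (X x) i + Gc c u0 b i)) *\<^sub>R i))) q) \<bullet> i =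
      rho (X x) (Y x) \<bullet> i"
      using i by (simp add: inner_diff_left linear_diff[OF linear_G_left[OF u0_mem]] rho_inner curv_def N_inner[OF u0_mem] inner_diff_right inner_add_right)
  qed
qed

lemma bracket_hv:
  assumes X: "smooth_vfield_on M (dom_of c) X"
    and \<omega>: "smooth_on (coords c ` dom_of c) (form_rep c \<omega>)" "\<And>y. y \<in> dom_of c \<Longrightarrow> linear (\<omega> y)"
  shows "lie_bracket TM (hlift_field M D X) (vlift_field \<omega>) (x, p) = (0, nabf \<omega> (X x))"
proof -
  have X0: "frechet_derivative (vfield_rep M c X) (at u0) 0 = 0"
    by (rule linear_0[OF has_derivative_linear[OF smooth_rep_deriv[OF X]]])
  have d0: "dG u0 0 v w = 0" for v w
    by (rule linear_0[OF has_derivative_linear[OF deriv_G[OF u0_mem]]])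
  show ?thesis
    unfolding lie_bracket_TM deriv_rep_h[OF X] h_field v_field hlift_eq vlift_eq
    by (simp add: deriv_rep_v[OF \<omega>(1)] \<omega>(2) nabf_def X0 d0 linear_0[OF linear_G_left[OF u0_mem]] N_def)
qed

lemma bracket_vv:
  assumes \<omega>: "smooth_on (coords c ` dom_of c) (form_rep c \<omega>)" "\<And>y. y \<in> dom_of c \<Longrightarrow> linear (\<omega> y)"
    and \<theta>: "smooth_on (coords c ` dom_of c) (form_rep c \<theta>)" "\<And>y. y \<in> dom_of c \<Longrightarrow> linear (\<theta> y)"
  shows "lie_bracket TM (vlift_field \<omega>) (vlift_field \<theta>) (x, p) = 0"
  unfolding lie_bracket_TM v_field vlift_eq
  using linear_0[OF has_derivative_linear[OF smooth_on_has_derivative[OF \<omega>(1) open_S u0_mem]]]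
    linear_0[OF has_derivative_linear[OF smooth_on_has_derivative[OF \<theta>(1) open_S u0_mem]]]
  by (simp add: deriv_rep_v[OF \<omega>(1)] \<omega>(2) deriv_rep_v[OF \<theta>(1)] \<theta>(2) zero_prod_def)

lemma conn_point:
  assumes X: "smooth_vfield_on M (dom_of c) X" and Y: "smooth_vfield_on M (dom_of c) Y"
  shows "D X Y x = nab Y (X x)"
  using conn_chart[OF chart_c(1) open_in_mfd_dom[OF chart_c(1)] order_refl chart_c(2) X Y]
  by (simp add: tcomp_c nab_def inv_o)

lemma form_deriv_point:
  assumes X: "smooth_vfield_on M (dom_of c) X"
    and \<theta>: "smooth_on (coords c ` dom_of c) (form_rep c \<theta>)" "\<And>y. y \<in> dom_of c \<Longrightarrow> linear (\<theta> y)"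
  shows "form_deriv M D X \<theta> x w = nabf \<theta> (X x) \<bullet> w"
proof -
  have "((\<lambda>u. form_rep c \<theta> u \<bullet> w) has_derivative (\<lambda>a. frechet_derivative (form_rep c \<theta>) (at u0) a \<bullet> w)) (at u0)"
    by (intro has_derivative_inner_left smooth_on_has_derivative[OF \<theta>(1) open_S u0_mem])
  then have "((\<lambda>y. \<theta> y (tvec M c y w)) \<circ> chart_inv c has_derivative (\<lambda>a. frechet_derivative (form_rep c \<theta>) (at u0) a \<bullet> w)) (at u0)"
  proof (rule has_derivative_transform_within_open[OF _ open_S u0_mem])
    fix u assume "u \<in> coords c ` dom_of c"
    then have y: "chart_inv c u \<in> dom_of c" by (rule chart_inv_mem[OF chart_c(1) order_refl])
    show "form_rep c \<theta> u \<bullet> w = ((\<lambda>y. \<theta> y (tvec M c y w)) \<circ> chart_inv c) u"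
      by (simp add: form_rep_def fcomp_inner[OF chart_c(1) y \<theta>(2)[OF y]])
  qed
  from dir_deriv_chart[OF chart_c this]
  have "dir_deriv M x (X x) (\<lambda>y. \<theta> y (tvec M c y w)) = frechet_derivative (form_rep c \<theta>) (at u0) (X x) \<bullet> w"
    by (simp add: tcomp_c)
  moreover have "\<theta> x (D X (\<lambda>y. tvec M c y w) x) = N u0 (X x) (fcomp M c x (\<theta> x)) \<bullet> w"
    by (simp add: conn_point[OF X smooth_chart_field[OF chart_c(1)]] nab_def frechet_vfield_rep_const[OF chart_c] tvec_c
      N_inner[OF u0_mem] fcomp_at[OF \<theta>(2)[OF chart_c(2)]])
  ultimately show ?thesis
    by (simp add: form_deriv_def extension_def nabf_def inner_diff_left)
qed

text \<open>The extensions in the definition are constant in the chart at \<open>x\<close>. Their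
  bracket vanishes on its whole domain, so the bracket term is zero by locality.\<close>

lemma curvature_point: "curvature M D x a b w = curv u0 a b w"
proof -
  let ?E = "\<lambda>v y. tvec M c y v"
  have dc: "open_in_mfd M (dom_of c)" by (rule open_in_mfd_dom[OF chart_c(1)])
  note E = smooth_chart_field[OF chart_c(1)]
  have "D (?E a) (D (?E b) (?E w)) x = dG u0 a b w + Gc c u0 a (Gc c u0 b w)" for a b
  proof -
    have "(vfield_rep M c (D (?E b) (?E w)) has_derivative (\<lambda>a. dG u0 a b w)) (at u0)"
      by (rule has_derivative_transform_within_open[OF deriv_G[OF u0_mem] open_S u0_mem])
        (auto simp: vfield_rep_def conn_chart_fields[OF chart_c(1)] chart_inv_coords[OF chart_c(1)])
    from frechet_derivativeI[OF this] show ?thesis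
      using conn_point[OF E smooth_conn[OF dc E E], of a b w] conn_point[OF E E, of b w]
      by (simp add: nab_def tvec_c frechet_vfield_rep_const[OF chart_c])
  qed
  moreover have "D (lie_bracket M (?E a) (?E b)) (?E w) x = 0"
    by (rule conn_vanish(2)[OF dc E _ chart_c(2)]) (rule lie_bracket_chart_fields[OF chart_c(1)])
  ultimately show ?thesis
    by (simp add: curvature_def curvature_op_def extension_def curv_def)
qed

end

section \<open>The Koszul computation of the four covariant derivatives\<close>

locale kaehler_bundle = kaehler_point M D J g \<delta> x p
  for M :: "('a, 'e::euclidean_space) manifold" and D J g \<delta> x p +
  fixes BSD
  assumes lc: "levi_civita_connection (cotangent_bundle M) (berger_sasaki M J g D \<delta>) BSD"
begin

abbreviation "hX X \<equiv> hlift_field M D X"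
abbreviation "co \<omega> \<equiv> fcomp M c x (\<omega> x)"

text \<open>Smoothness over one chart domain only, which admits as test fields the covector fields
  \<open>cst\<close>, constant in this chart.\<close>

definition chart_smooth_form :: "('a \<Rightarrow> 'e \<Rightarrow> real) \<Rightarrow> bool" where
  "chart_smooth_form \<omega> \<longleftrightarrow> smooth_on (coords c ` dom_of c) (form_rep c \<omega>) \<and> (\<forall>y\<in>dom_of c. linear (\<omega> y))"

lemma chart_smooth_formD: "chart_smooth_form \<omega> \<Longrightarrow> smooth_on (coords c ` dom_of c) (form_rep c \<omega>)"
    "chart_smooth_form \<omega> \<Longrightarrow> y \<in> dom_of c \<Longrightarrow> linear (\<omega> y)"
  by (auto simp: chart_smooth_form_def)

abbreviation "chart_smooth_field X \<equiv> smooth_vfield_on M (dom_of c) X"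

definition "E z y = tvec M c y z"
definition "cst z y w = z \<bullet> tcomp M c y w"

text \<open>The test fields are not parallel: constancy in the chart leaves a Christoffel term in
  the covariant derivative. In the Koszul formula these terms cancel between metric derivatives and
  brackets.\<close>

lemma const_field: "chart_smooth_field (E z)" "E z x = z" "nab (E z) a = Gc c u0 a z"
  using smooth_chart_field[OF chart_c(1), of z] frechet_vfield_rep_const[OF chart_c, of z a]
  by (simp_all add: E_def[abs_def] tvec_c nab_def)

lemma const_form: "chart_smooth_form (cst z)" "co (cst z) = z" "nabf (cst z) a = - N u0 a z"
proof -
  have rep: "form_rep c (cst z) u = z" if "u \<in> coords c ` dom_of c" for u
    unfolding form_rep_def cst_def using chart_inv_mem[OF chart_c(1) order_refl that]
    by (rule fcomp_inner_tcomp_form[OF chart_c(1)])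
  show "chart_smooth_form (cst z)"
    unfolding chart_smooth_form_def
    using smooth_on_cong[OF open_S smooth_on_const[OF open_S, of z]] rep linear_inner_tcomp[OF chart_c(1)]
    by (auto simp: cst_def[abs_def])
  show co: "co (cst z) = z" using rep[OF u0_mem] by (simp add: form_rep_o)
  have "(form_rep c (cst z) has_derivative (\<lambda>_. 0)) (at u0)"
    by (rule has_derivative_transform_within_open[OF has_derivative_const open_S u0_mem]) (simp add: rep)
  from frechet_derivativeI[OF this] show "nabf (cst z) a = - N u0 a z" by (simp add: nabf_def co)
qed

lemma smooth_lifts:
  "chart_smooth_field X \<Longrightarrow> smooth_vfield_on TM W (hX X)" "chart_smooth_form \<omega> \<Longrightarrow> smooth_vfield_on TM W (vlift_field \<omega>)"
  using smooth_hlift_field[OF torsion_free chart_c(1) open_in_mfd_dom[OF chart_c(1)] order_refl]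
    smooth_vlift_field[OF chart_c(1) open_in_mfd_dom[OF chart_c(1)] order_refl] by (auto simp: chart_smooth_form_def)

lemma koszul_TM:
  assumes "smooth_vfield_on TM W A" "smooth_vfield_on TM W B" "smooth_vfield_on TM W C"
  shows "2 * BS (x, p) (BSD A B (x, p)) (C (x, p)) =
    dir_deriv TM (x, p) (A (x, p)) (\<lambda>Q. BS Q (B Q) (C Q)) + dir_deriv TM (x, p) (B (x, p)) (\<lambda>Q. BS Q (A Q) (C Q))
    - dir_deriv TM (x, p) (C (x, p)) (\<lambda>Q. BS Q (A Q) (B Q))
    + BS (x, p) (lie_bracket TM A B (x, p)) (C (x, p)) - BS (x, p) (lie_bracket TM A C (x, p)) (B (x, p))
    - BS (x, p) (lie_bracket TM B C (x, p)) (A (x, p))"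
  by (rule koszul[OF lc open_W P_W assms])
    (simp add: BS_eq g_diff_left[OF u0_mem] linear_diff[OF vp_linear] linear_diff[OF linear_h(1)],
     simp add: BS_eq g_sym[OF u0_mem] h_sym)

lemma h_0: "h 0 a = 0" "h a 0 = 0"
  using linear_0[OF linear_h(1)] linear_0[OF linear_h(2)] by auto

lemma vp_Pair_0: "vp (0, a) = a"
  by (simp add: vp_def linear_0[OF linear_N_left[OF u0_mem]])

lemma BS_h: "BS (x, p) T (hX X (x, p)) = gc c u0 (fst T) (X x)"
  by (simp add: BS_eq h_field vp_lifts h_0)

lemma BS_v: "BS (x, p) T (vlift_field \<omega> (x, p)) = h (vp T) (co \<omega>)"
  by (simp add: BS_eq v_field vp_lifts g_zero_right[OF u0_mem])

lemma dirs:
  "chart_smooth_field X \<Longrightarrow> chart_smooth_field Y \<Longrightarrow> dir_deriv TM (x, p) \<xi> (\<lambda>Q. BS Q (hX X Q) (hX Y Q)) =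
    gc c u0 (nab X (fst \<xi>)) (Y x) + gc c u0 (X x) (nab Y (fst \<xi>))"
  "chart_smooth_form \<theta> \<Longrightarrow> dir_deriv TM (x, p) \<xi> (\<lambda>Q. BS Q (hX X Q) (vlift_field \<theta> Q)) = 0"
  "chart_smooth_form \<theta> \<Longrightarrow> dir_deriv TM (x, p) \<xi> (\<lambda>Q. BS Q (vlift_field \<theta> Q) (hX X Q)) = 0"
  "chart_smooth_form \<omega> \<Longrightarrow> chart_smooth_form \<theta> \<Longrightarrow> dir_deriv TM (x, p) \<xi> (\<lambda>Q. BS Q (vlift_field \<omega> Q) (vlift_field \<theta> Q)) =
    h (nabf \<omega> (fst \<xi>)) (co \<theta>) + h (co \<omega>) (nabf \<theta> (fst \<xi>)) +
    \<delta>\<^sup>2 * ((co \<omega> \<bullet> Jc c u0 (K u0 (vp \<xi>))) * (co \<theta> \<bullet> Jc c u0 (K u0 q)) + (co \<omega> \<bullet> Jc c u0 (K u0 q)) * (co \<theta> \<bullet> Jc c u0 (K u0 (vp \<xi>))))"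
  by (simp_all add: dir_hh dir_hv dir_vv chart_smooth_formD)

lemma brackets:
  "chart_smooth_field X \<Longrightarrow> chart_smooth_field Y \<Longrightarrow> fst (lie_bracket TM (hX X) (hX Y) (x, p)) = nab Y (X x) - nab X (Y x)"
  "chart_smooth_field X \<Longrightarrow> chart_smooth_field Y \<Longrightarrow> vp (lie_bracket TM (hX X) (hX Y) (x, p)) = rho (X x) (Y x)"
  "chart_smooth_field X \<Longrightarrow> chart_smooth_form \<omega> \<Longrightarrow> lie_bracket TM (hX X) (vlift_field \<omega>) (x, p) = (0, nabf \<omega> (X x))"
  "chart_smooth_field X \<Longrightarrow> chart_smooth_form \<omega> \<Longrightarrow> lie_bracket TM (vlift_field \<omega>) (hX X) (x, p) = (0, - nabf \<omega> (X x))"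
  "chart_smooth_form \<omega> \<Longrightarrow> chart_smooth_form \<theta> \<Longrightarrow> lie_bracket TM (vlift_field \<omega>) (vlift_field \<theta>) (x, p) = 0"
  by (simp_all add: bracket_hh bracket_hv bracket_vv chart_smooth_formD lie_bracket_antisym[of _ "vlift_field \<omega>" "hX X"])

lemma fst_fields: "fst (hX X (x, p)) = X x" "vp (hX X (x, p)) = 0"
    "fst (vlift_field \<omega> (x, p)) = 0" "vp (vlift_field \<omega> (x, p)) = co \<omega>"
  by (simp_all add: h_field v_field vp_lifts)

lemma nab_0: "chart_smooth_field X \<Longrightarrow> nab X 0 = 0"
  unfolding nab_def
  using linear_0[OF has_derivative_linear[OF smooth_rep_deriv]] linear_0[OF linear_G_left[OF u0_mem]] by simp

lemma nabf_0: "chart_smooth_form \<omega> \<Longrightarrow> nabf \<omega> 0 = 0"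
  unfolding nabf_def
  using linear_0[OF has_derivative_linear[OF smooth_on_has_derivative[OF chart_smooth_formD(1) open_S u0_mem]]]
    linear_0[OF linear_N_left[OF u0_mem]] by simp

lemmas koszul_simps = BS_h BS_v dirs brackets fst_fields nab_0 nabf_0 const_field const_form h_0 vp_Pair_0
  g_zero_left[OF u0_mem] g_zero_right[OF u0_mem] g_diff_left[OF u0_mem] linear_0[OF vp_linear]
  linear_0[OF linear_G_left[OF u0_mem]] linear_neg[OF linear_h(1)] linear_neg[OF linear_h(2)]

lemma conn_hh:
  assumes X: "chart_smooth_field X" and Y: "chart_smooth_field Y"
  shows "BSD (hX X) (hX Y) (x, p) = hlift M D (x, p) (nab Y (X x)) + (1/2) *\<^sub>R (0, rho (X x) (Y x))"
proof (rule tangent_eqI)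
  fix z
  let ?T = "BSD (hX X) (hX Y) (x, p)"
  have "2 * gc c u0 (fst ?T) z = 2 * gc c u0 (nab Y (X x)) z"
    using koszul_TM[OF smooth_lifts(1)[OF X] smooth_lifts(1)[OF Y] smooth_lifts(1)[OF const_field(1)[of z]]]
    by (simp add: koszul_simps X Y g_sym[OF u0_mem, of "X x"] g_sym[OF u0_mem, of "Y x"] G_sym[OF u0_mem, of _ z])
  then show "gc c u0 (fst ?T) z = gc c u0 (fst (hlift M D (x, p) (nab Y (X x)) + (1/2) *\<^sub>R (0, rho (X x) (Y x)))) z"
    by (simp add: vp_lifts)
  \<comment> \<open>Against a vertical test field only the bracket of the two horizontal lifts
    survives.\<close>
  have "2 * h (vp ?T) z = h (rho (X x) (Y x)) z"
    using koszul_TM[OF smooth_lifts(1)[OF X] smooth_lifts(1)[OF Y] smooth_lifts(2)[OF const_form(1)[of z]]]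
    by (simp add: koszul_simps X Y)
  then show "h (vp ?T) z = h (vp (hlift M D (x, p) (nab Y (X x)) + (1/2) *\<^sub>R (0, rho (X x) (Y x)))) z"
    by (simp add: linear_add[OF vp_linear] linear_scale[OF vp_linear] vp_lifts vp_Pair_0 linear_scale[OF linear_h(1)] del: scaleR_Pair)
qed

text \<open>In the Koszul formula the test vector \<open>b\<close> sits inside the curvature. Pair
  symmetry exposes it as an argument of the metric, so that the vector paired with it can be read
  off.\<close>

lemma q_curv: "q \<bullet> curv u0 a b w = - gc c u0 (curv u0 (K u0 q) w a) b"
proof -
  have "q \<bullet> curv u0 a b w = gc c u0 (curv u0 a b w) (K u0 q)"
    by (subst g_sym[OF u0_mem]) (simp add: g_K[OF u0_mem])
  also have "\<dots> = gc c u0 (curv u0 w (K u0 q) a) b" by (rule curv_pair_sym[OF u0_mem])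
  also have "\<dots> = - gc c u0 (curv u0 (K u0 q) w a) b"
    by (subst curv_antisym) (rule g_minus_left[OF u0_mem])
  finally show ?thesis .
qed

abbreviation "k \<equiv> K u0 q"
abbreviation "Jk \<equiv> Jc c u0 k"

text \<open>The undeformed part pairs \<open>rho a b\<close> with \<open>K u0 t\<close>, the
  deforming part with \<open>Jk\<close>, weighted by the pairing of \<open>t\<close> with
  \<open>Jk\<close>; \<open>q_curv\<close> applies to each.\<close>

lemma h_rho: "h (rho a b) t = - gc c u0 (curv u0 k (K u0 t) a + (\<delta>\<^sup>2 * (t \<bullet> Jk)) *\<^sub>R curv u0 k Jk a) b"
  by (simp add: h_def rho_inner q_curv g_add_left[OF u0_mem] g_scale_left[OF u0_mem])

lemma conn_hv:
  assumes X: "chart_smooth_field X" and \<theta>: "chart_smooth_form \<theta>"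
  shows "BSD (hX X) (vlift_field \<theta>) (x, p) = (0, nabf \<theta> (X x)) +
    (1/2) *\<^sub>R hlift M D (x, p) (curv u0 k (K u0 (co \<theta>)) (X x) + (\<delta>\<^sup>2 * (co \<theta> \<bullet> Jk)) *\<^sub>R curv u0 k Jk (X x))"
    (is "_ = ?R")
proof (rule tangent_eqI)
  fix z
  let ?T = "BSD (hX X) (vlift_field \<theta>) (x, p)"
  \<comment> \<open>Only the curvature in the bracket of the lifts of \<open>X\<close> and of the
    test field contributes.\<close>
  have "2 * gc c u0 (fst ?T) z = - h (rho (X x) z) (co \<theta>)"
    using koszul_TM[OF smooth_lifts(1)[OF X] smooth_lifts(2)[OF \<theta>] smooth_lifts(1)[OF const_field(1)[of z]]]
    by (simp add: koszul_simps X \<theta>)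
  then show "gc c u0 (fst ?T) z = gc c u0 (fst ?R) z"
    by (simp add: h_rho vp_lifts g_scale_left[OF u0_mem])
  \<comment> \<open>The metric derivative along the lift of \<open>X\<close> and the bracket with
    \<open>\<theta>\<close> each give one covariant derivative of \<open>\<theta>\<close>; those of
    the test form cancel.\<close>
  have "2 * h (vp ?T) z = 2 * h (nabf \<theta> (X x)) z"
    using koszul_TM[OF smooth_lifts(1)[OF X] smooth_lifts(2)[OF \<theta>] smooth_lifts(2)[OF const_form(1)[of z]]]
    by (simp add: koszul_simps X \<theta> linear_0[OF linear_K[OF u0_mem]] linear_0[OF linear_J[OF u0_mem]] h_sym[of "co \<theta>"])
  then show "h (vp ?T) z = h (vp ?R) z"
    by (simp add: linear_add[OF vp_linear] linear_scale[OF vp_linear] vp_lifts vp_Pair_0)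
qed

text \<open>By torsion-freeness this differs from \<open>conn_hv\<close> by a bracket, which cancels
  the vertical term.\<close>

lemma conn_vh:
  assumes Y: "chart_smooth_field Y" and \<omega>: "chart_smooth_form \<omega>"
  shows "BSD (vlift_field \<omega>) (hX Y) (x, p) =
    (1/2) *\<^sub>R hlift M D (x, p) (curv u0 k (K u0 (co \<omega>)) (Y x) + (\<delta>\<^sup>2 * (co \<omega> \<bullet> Jk)) *\<^sub>R curv u0 k Jk (Y x))"
proof -
  have "BSD (vlift_field \<omega>) (hX Y) (x, p) - BSD (hX Y) (vlift_field \<omega>) (x, p) = (0, - nabf \<omega> (Y x))"
    using lc open_W P_W smooth_lifts(1)[OF Y] smooth_lifts(2)[OF \<omega>] brackets(4)[OF Y \<omega>]
    unfolding levi_civita_connection_def torsion_free_def by metis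
  then show ?thesis
    by (simp add: conn_hv[OF Y \<omega>] diff_eq_eq zero_prod_def[symmetric])
qed

text \<open>The components of the covector \<open>a\<close> composed with \<open>J\<close>.\<close>

definition Jform :: "'e \<Rightarrow> 'e" where "Jform a = (\<Sum>i\<in>Basis. (a \<bullet> Jc c u0 i) *\<^sub>R i)"

lemma Jform_inner: "Jform a \<bullet> w = a \<bullet> Jc c u0 w"
  using linear_functional_rep[OF linear_compose[OF linear_J[OF u0_mem] linear_inner[of a]]]
  by (simp add: Jform_def o_def)

text \<open>The first term is the skewness \<open>K_J\<close>; in the deforming term
  \<open>J\<close> is applied twice, which leaves \<open>- (a \<bullet> k)\<close>.\<close>

lemma h_Jform: "h (Jform a) z = - (z \<bullet> Jc c u0 (K u0 a)) - \<delta>\<^sup>2 * (a \<bullet> k) * (z \<bullet> Jk)"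
  by (simp add: h_def Jform_inner K_J[OF u0_mem, of a z] J_J[OF u0_mem])

definition "lam = 1 + \<delta>\<^sup>2 * (q \<bullet> k)"

lemma lam_pos: "lam > 0"
  using g_pos[OF u0_mem, of k] g_K[OF u0_mem, of q k] g_zero_left[OF u0_mem]
  by (cases "k = 0") (auto simp: lam_def add_pos_nonneg)

text \<open>For \<open>a = q\<close> both terms of \<open>h_Jform\<close> are multiples of
  \<open>z \<bullet> Jk\<close>, and their coefficients add up to \<open>- lam\<close>.\<close>

lemma h_Jform_q: "h (Jform q) z = - lam * (z \<bullet> Jk)"
  by (simp add: h_Jform lam_def algebra_simps)

text \<open>The factors \<open>- (w \<bullet> Jk)\<close> and \<open>- (t \<bullet> Jk)\<close> are
  the pairings of the two forms with pJ, with the sign of \<open>K_comp_J\<close> kept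
  visible.\<close>

lemma conn_vv:
  assumes \<omega>: "chart_smooth_form \<omega>" and \<theta>: "chart_smooth_form \<theta>"
  defines "w \<equiv> co \<omega>" and "t \<equiv> co \<theta>"
  shows "BSD (vlift_field \<omega>) (vlift_field \<theta>) (x, p) =
    (0, \<delta>\<^sup>2 *\<^sub>R ((- (w \<bullet> Jk)) *\<^sub>R Jform t + (- (t \<bullet> Jk)) *\<^sub>R Jform w) -
       (\<delta> ^ 4 / lam * ((- (w \<bullet> Jk)) * (t \<bullet> k) + (w \<bullet> k) * (- (t \<bullet> Jk)))) *\<^sub>R Jform q)"
    (is "_ = (0, ?R)")
proof (rule tangent_eqI)
  fix z
  let ?T = "BSD (vlift_field \<omega>) (vlift_field \<theta>) (x, p)"
  \<comment> \<open>The derivative of the vertical metric along the horizontal test field is a pure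
    Leibniz expression, which the two brackets with that field cancel.\<close>
  have "2 * gc c u0 (fst ?T) z = 0"
    using koszul_TM[OF smooth_lifts(2)[OF \<omega>] smooth_lifts(2)[OF \<theta>] smooth_lifts(1)[OF const_field(1)[of z]]]
    by (simp add: koszul_simps \<omega> \<theta> linear_0[OF linear_K[OF u0_mem]] linear_0[OF linear_J[OF u0_mem]] h_sym[of "co \<omega>"])
  then show "gc c u0 (fst ?T) z = gc c u0 (fst (0, ?R)) z"
    by (simp add: g_zero_left[OF u0_mem])
  \<comment> \<open>Brackets of vertical lifts vanish, and so do covariant derivatives in direction
    0; only the fibre derivatives of the deforming term are left.\<close>
  have "2 * h (vp ?T) z = \<delta>\<^sup>2 * ((t \<bullet> Jc c u0 (K u0 w)) * (z \<bullet> Jk) + (t \<bullet> Jk) * (z \<bullet> Jc c u0 (K u0 w)))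
     + \<delta>\<^sup>2 * ((w \<bullet> Jc c u0 (K u0 t)) * (z \<bullet> Jk) + (w \<bullet> Jk) * (z \<bullet> Jc c u0 (K u0 t)))
     - \<delta>\<^sup>2 * ((w \<bullet> Jc c u0 (K u0 z)) * (t \<bullet> Jk) + (w \<bullet> Jk) * (t \<bullet> Jc c u0 (K u0 z)))"
    using koszul_TM[OF smooth_lifts(2)[OF \<omega>] smooth_lifts(2)[OF \<theta>] smooth_lifts(2)[OF const_form(1)[of z]]]
    by (simp add: koszul_simps \<omega> \<theta> w_def t_def linear_0[OF linear_N_left[OF u0_mem]])
  \<comment> \<open>Skewness cancels the terms pairing \<open>w\<close> with \<open>t\<close> and
    doubles those involving \<open>z\<close>.\<close>
  also have "\<dots> = 2 * (\<delta>\<^sup>2 * ((t \<bullet> Jk) * (z \<bullet> Jc c u0 (K u0 w)) + (w \<bullet> Jk) * (z \<bullet> Jc c u0 (K u0 t))))"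
    unfolding K_J[OF u0_mem, of w z] K_J[OF u0_mem, of t z] K_J[OF u0_mem, of t w] by (simp add: algebra_simps)
  finally have 1: "h (vp ?T) z = \<delta>\<^sup>2 * ((t \<bullet> Jk) * (z \<bullet> Jc c u0 (K u0 w)) + (w \<bullet> Jk) * (z \<bullet> Jc c u0 (K u0 t)))"
    by simp
  have "h ?R z = \<delta>\<^sup>2 * (- (w \<bullet> Jk) * h (Jform t) z + - (t \<bullet> Jk) * h (Jform w) z) -
       (\<delta> ^ 4 / lam * ((- (w \<bullet> Jk)) * (t \<bullet> k) + (w \<bullet> k) * (- (t \<bullet> Jk)))) * h (Jform q) z"
    by (simp only: linear_diff[OF linear_h(1)] linear_add[OF linear_h(1)] linear_scale[OF linear_h(1)] real_scaleR_def)
  \<comment> \<open>By \<open>h_Jform\<close>, the first two terms leave a surplus of order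
    \<open>\<delta> ^ 4\<close> proportional to \<open>z \<bullet> Jk\<close>; the factor
    \<open>lam\<close> from \<open>h_Jform_q\<close> cancels the denominator, and the last term
    removes the surplus.\<close>
  also have "\<dots> = \<delta>\<^sup>2 * ((t \<bullet> Jk) * (z \<bullet> Jc c u0 (K u0 w)) + (w \<bullet> Jk) * (z \<bullet> Jc c u0 (K u0 t)))"
    unfolding h_Jform_q h_Jform[of t] h_Jform[of w] using lam_pos
    by (simp add: field_simps power2_eq_square power4_eq_xxxx)
  finally show "h (vp ?T) z = h (vp (0, ?R)) z" by (simp only: 1 vp_Pair_0)
qed

end

section \<open>Translation of the component formulas into the intrinsic statement\<close>

lemma kaehler_bundleI:
  assumes kae: "standard_kaehler M J g D"
    and lc: "levi_civita_connection (cotangent_bundle M) (berger_sasaki M J g D \<delta>) BSD"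
    and P: "(x, p) \<in> points (cotangent_bundle M)"
  shows "kaehler_bundle M D J g \<delta> x p BSD"
proof -
  interpret smooth_charts M
    using kae by (intro smooth_manifold_charts) (simp add: standard_kaehler_def)
  show ?thesis
    by (intro kaehler_bundle.intro kaehler_point.intro kaehler.intro chart_connection.intro smooth_charts_axioms
        kaehler_bundle_axioms.intro kaehler_point_axioms.intro kaehler_axioms.intro chart_connection_axioms.intro)
      (use assms in \<open>auto simp: standard_kaehler_def levi_civita_connection_def points_cotangent_bundle cotangent_over_def\<close>)
qed

theorem theorem3p5:
  fixes M :: "('a, 'e::euclidean_space) manifold"
    and J :: "'a \<Rightarrow> 'e \<Rightarrow> 'e"
    and g :: "'a \<Rightarrow> 'e \<Rightarrow> 'e \<Rightarrow> real"
    and D :: "('a \<Rightarrow> 'e) \<Rightarrow> ('a \<Rightarrow> 'e) \<Rightarrow> 'a \<Rightarrow> 'e"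
    and BSD :: "('a \<times> ('e \<Rightarrow> real) \<Rightarrow> 'e \<times> 'e) \<Rightarrow> ('a \<times> ('e \<Rightarrow> real) \<Rightarrow> 'e \<times> 'e) \<Rightarrow>
                  'a \<times> ('e \<Rightarrow> real) \<Rightarrow> 'e \<times> 'e"
    and X Y :: "'a \<Rightarrow> 'e" and \<omega> \<theta> :: "'a \<Rightarrow> 'e \<Rightarrow> real"
    and x :: 'a and p :: "'e \<Rightarrow> real"
    and \<delta> :: real and m :: nat
  assumes "DIM('e) = 2 * m"
    and "standard_kaehler M J g D"
    and "levi_civita_connection (cotangent_bundle M) (berger_sasaki M J g D \<delta>) BSD"
    and "smooth_vfield_on M (points M) X" and "smooth_vfield_on M (points M) Y"
    and "smooth_form_on M (points M) \<omega>" and "smooth_form_on M (points M) \<theta>"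
    and "(x, p) \<in> points (cotangent_bundle M)"
  shows
    "let R = curvature M D x; G = ginv g x; H = hlift M D (x, p); pJ = p \<circ> J x;
         pt = sharp g x p; \<omega>t = sharp g x (\<omega> x); \<theta>t = sharp g x (\<theta> x);
         lam = 1 + \<delta>\<^sup>2 * G p p
     in
       BSD (hlift_field M D X) (hlift_field M D Y) (x, p) =
         H (D X Y x) + (1/2) *\<^sub>R vlift (\<lambda>z. p (R (X x) (Y x) z)) \<and>
       BSD (hlift_field M D X) (vlift_field \<theta>) (x, p) =
         vlift (form_deriv M D X \<theta> x) +
         (1/2) *\<^sub>R (H (R pt \<theta>t (X x)) - (\<delta>\<^sup>2 * G (\<theta> x) pJ) *\<^sub>R H (R pt (J x pt) (X x))) \<and>
       BSD (vlift_field \<omega>) (hlift_field M D Y) (x, p) =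
         (1/2) *\<^sub>R (H (R pt \<omega>t (Y x)) - (\<delta>\<^sup>2 * G (\<omega> x) pJ) *\<^sub>R H (R pt (J x pt) (Y x))) \<and>
       BSD (vlift_field \<omega>) (vlift_field \<theta>) (x, p) =
         \<delta>\<^sup>2 *\<^sub>R (G (\<omega> x) pJ *\<^sub>R vlift (\<theta> x \<circ> J x) + G (\<theta> x) pJ *\<^sub>R vlift (\<omega> x \<circ> J x)) -
         (\<delta>^4 / lam * (G (\<omega> x) pJ * G (\<theta> x) p + G (\<omega> x) p * G (\<theta> x) pJ)) *\<^sub>R vlift pJ"
proof -
  interpret B: kaehler_bundle M D J g \<delta> x p BSD
    by (rule kaehler_bundleI[OF assms(2,3,8)])
  let ?c = "chart_at M x"
  let ?u = "coords ?c x"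
  note chart_c = B.chart_c
  \<comment> \<open>The global fields and forms are restricted to the domain of the chart at
    \<open>x\<close>, over which the bundle computation takes place.\<close>
  have sub: "dom_of ?c \<subseteq> points M" using B.points_of_chart[OF chart_c(1)] by blast
  have X: "smooth_vfield_on M (dom_of ?c) X" and Y: "smooth_vfield_on M (dom_of ?c) Y"
    using assms(4,5) B.smooth_vfield_subset[OF _ sub] by auto
  have sf: "B.chart_smooth_form \<alpha>" if "smooth_form_on M (points M) \<alpha>" for \<alpha>
    unfolding B.chart_smooth_form_def
    using B.smooth_form_rep[OF chart_c(1) B.open_in_mfd_dom[OF chart_c(1)] order_refl B.smooth_form_subset[OF that sub]]
      B.linear_form_at[OF that] sub by blast
  note \<omega> = sf[OF assms(6)] and \<theta> = sf[OF assms(7)]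
  have lin: "linear (\<alpha> x)" if "smooth_form_on M (points M) \<alpha>" for \<alpha>
    using B.linear_form_at[OF that B.point] .
  note lp = B.linear_p
  have sharp: "sharp g x \<alpha> = B.K ?u (fcomp M ?c x \<alpha>)" if "linear \<alpha>" for \<alpha>
    by (simp add: B.sharp_chart[OF chart_c(2) that] B.tvec_c)
  have J: "J x v = B.Jc ?c ?u v" for v
    by (simp add: B.Jc_def B.inv_o B.tvec_c B.tcomp_c)
  \<comment> \<open>This sign turns the positive deformation terms of \<open>conn_hv\<close> and
    \<open>conn_vh\<close> into the subtracted ones of the statement.\<close>
  have ginv_pJ: "ginv g x \<alpha> (p \<circ> J x) = - (fcomp M ?c x \<alpha> \<bullet> B.Jk)" if "linear \<alpha>" for \<alpha>
    by (simp add: B.ginv_chart[OF chart_c(2) that B.linear_comp_J[OF chart_c(2) lp]] B.K_comp_J[OF chart_c(2) lp])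
  have ginv_p: "ginv g x \<alpha> p = fcomp M ?c x \<alpha> \<bullet> B.k" if "linear \<alpha>" for \<alpha>
    by (rule B.ginv_chart[OF chart_c(2) that lp])
  have vJ: "vlift (\<alpha> \<circ> J x) = (0, B.Jform (fcomp M ?c x \<alpha>))" if "linear \<alpha>" for \<alpha>
    unfolding B.vlift_eq
    by (simp, rule euclidean_eqI) (simp add: B.fcomp_comp_J[OF chart_c(2) that] B.Jform_inner)
  have vR: "vlift (\<lambda>z. p (B.curv ?u a b z)) = (0, B.rho a b)" for a b
    unfolding B.vlift_eq B.rho_def B.fcomp_at[OF lp]
    by (simp add: fcomp_def[of M ?c x "\<lambda>z. p (B.curv ?u a b z)"] B.tvec_c)
  have vform: "vlift (form_deriv M D X \<theta> x) = (0, B.nabf \<theta> (X x))"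
  proof -
    have "form_deriv M D X \<theta> x = (\<lambda>w. B.nabf \<theta> (X x) \<bullet> w)"
      using B.form_deriv_point[OF X B.chart_smooth_formD[OF \<theta>]] by blast
    then show ?thesis by (simp add: B.vlift_eq B.fcomp_inner_form)
  qed
  \<comment> \<open>The component lemmas lift one combined vector, while the statement combines two
    lifts.\<close>
  have linH: "linear (hlift M D (x, p))"
    by (rule linearI) (simp_all add: B.hlift_eq linear_add[OF B.linear_N_left[OF B.u0_mem]]
      linear_scale[OF B.linear_N_left[OF B.u0_mem]])
  note H = linear_add[OF linH] linear_scale[OF linH]
  show ?thesis
    unfolding Let_def
    by (simp only: B.conn_hh[OF X Y] B.conn_hv[OF X \<theta>] B.conn_vh[OF Y \<omega>] B.conn_vv[OF \<omega> \<theta>]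
        B.conn_point[OF X Y] vR vform vJ[OF lp] vJ[OF lin[OF assms(6)]] vJ[OF lin[OF assms(7)]]
        ginv_pJ[OF lin[OF assms(6)]] ginv_pJ[OF lin[OF assms(7)]] ginv_p[OF lin[OF assms(6)]] ginv_p[OF lin[OF assms(7)]]
        ginv_p[OF lp] sharp[OF lp] sharp[OF lin[OF assms(6)]] sharp[OF lin[OF assms(7)]] B.curvature_point J H B.lam_def)
      (simp add: algebra_simps)
qed

end
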